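(* Let $H$ be an infinite-dimensional separable real prehilbert space. Any unitary representation of the Clifford algebra $C(H)$ on a separable complex Hilbert space that admits an invariant quaternionic structure is unitarily equivalent to a standard one (of quaternionic type).
   Context: A unitary representation of $C(H)$ is a representation on a complex Hilbert space with $\|h\cdot v\|=\|h\|\|v\|$ for $h\in H$; with an orthonormal basis of $H$ enumerated as $h_1,h_1',h_2,h_2',\dots$, it is given by mutually anticommuting unitary operators $J_1,J_1',J_2,J_2',\dots$ of square $-I$. An invariant quaternionic structure is a $\mathbb C$-antilinear norm-preserving operator $Q$ with $Q^2=-I$ commuting with all of them. $X=\mathbb Z_2^{\infty}$ is the compact abelian group of sequences $x=(x_1,x_2,\dots)$ of $0$'s and $1$'s with componentwise addition mod $2$, the product topology and its Borel $\sigma$-algebra. $\delta^k\in X$ has a $1$ in position $k$ and $0$ elsewhere; $\Delta\subset X$ is the subgroup of sequences with finitely many $1$'s; $\check x=x+(1,1,\dots)$; $\check\nu(x)=\nu(\check x)$, $\check\mu(A)=\mu(\check A)$, $\check A=\{\check x:x\in A\}$. A standard representation of quaternionic type is constructed from the following data: a $\sigma$-finite positive Borel measure $\mu$ on $X$, quasi-invariant under $\Delta$ (for $\delta\in\Delta$, $A\mapsto\mu(A+\delta)$ is mutually absolutely continuous with $\mu$), with $\check\mu$ equivalent to $\mu$; a measurable family of nonzero separable real Hilbert spaces $U_x$ with $U_{x+\delta}=U_x=U_{\check x}$ for $\delta\in\Delta$ and almost all $x$; $V_x=\mathbb C\otimes U_x$, with $\nu(x)=\dim V_x$ measurable and $\check\nu=\nu$;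 bar denotes conjugation of $V_x$ with respect to $U_x$, and $\overline A(v)=\overline{A(\bar v)}$ for operators; a measurable family of unitary operators $c_k(x):V_x\to V_{x+\delta^k}=V_x$, $k\ge1$, with $c_k(x)^*=c_k(x+\delta^k)$, $c_k(x)c_l(x+\delta^k)=c_l(x)c_k(x+\delta^l)$ for all $k,l$, $\overline{c_1(x)}=c_1(\check x)$, and $\overline{c_k(x)}=(-1)^kc_k(\check x)$ for $k\ge2$, for almost all $x$. The representation is on $V=\int_X^\oplus V_x\,d\mu(x)$ with $$J_kf(x)=-i(-1)^{x_1+\dots+x_{k-1}}c_k(x)\sqrt{\tfrac{d\mu(x+\delta^k)}{d\mu(x)}}f(x+\delta^k),\quad J_k'f(x)=(-1)^{x_1+\dots+x_{k}}c_k(x)\sqrt{\tfrac{d\mu(x+\delta^k)}{d\mu(x)}}f(x+\delta^k),$$ and it has the invariant quaternionic structure $Qf(x)=(-1)^{x_1}\sqrt{d\check\mu(x)/d\mu(x)}\;\overline{f(\check x)}$. Here $d\mu(x+\delta^k)/d\mu(x)$ is the Radon–Nikodym derivative of $A\mapsto\mu(A+\delta^k)$ with respect to $\mu$. *)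

theory Defs
  imports
    "HOL-Analysis.Analysis"
    "HOL-Library.Z2"
    "HOL-Library.Function_Algebras"
begin

section \<open>The Clifford algebra of a real prehilbert space\<close>

text \<open>
  The real unital associative algebra generated by \<open>H\<close> subject to \<open>\<iota>\<close> being linear and
  \<open>\<iota> u * \<iota> u = - \<parallel>u\<parallel>\<^sup>2\<close>, presented as formal expressions modulo the congruence generated by the
  axioms of an algebra and these relations.
\<close>

datatype 'h clifford_term =
    Scalar real
  | Vector 'h
  | Plus "'h clifford_term" "'h clifford_term"
  | Times "'h clifford_term" "'h clifford_term"

inductive clifford_eq :: "'h::real_inner clifford_term \<Rightarrow> 'h clifford_term \<Rightarrow> bool" where
  refl: "clifford_eq a a"
| sym: "clifford_eq a b \<Longrightarrow> clifford_eq b a"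
| trans: "clifford_eq a b \<Longrightarrow> clifford_eq b c \<Longrightarrow> clifford_eq a c"
| cong_Plus: "clifford_eq a a' \<Longrightarrow> clifford_eq b b' \<Longrightarrow> clifford_eq (Plus a b) (Plus a' b')"
| cong_Times: "clifford_eq a a' \<Longrightarrow> clifford_eq b b' \<Longrightarrow> clifford_eq (Times a b) (Times a' b')"
| add_assoc: "clifford_eq (Plus (Plus a b) c) (Plus a (Plus b c))"
| add_commute: "clifford_eq (Plus a b) (Plus b a)"
| add_0: "clifford_eq (Plus (Scalar 0) a) a"
| add_minus: "clifford_eq (Plus (Times (Scalar (- 1)) a) a) (Scalar 0)"
| mult_assoc: "clifford_eq (Times (Times a b) c) (Times a (Times b c))"
| mult_1_left: "clifford_eq (Times (Scalar 1) a) a"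
| mult_1_right: "clifford_eq (Times a (Scalar 1)) a"
| distrib_right: "clifford_eq (Times (Plus a b) c) (Plus (Times a c) (Times b c))"
| distrib_left: "clifford_eq (Times a (Plus b c)) (Plus (Times a b) (Times a c))"
| Scalar_add: "clifford_eq (Scalar (r + s)) (Plus (Scalar r) (Scalar s))"
| Scalar_mult: "clifford_eq (Scalar (r * s)) (Times (Scalar r) (Scalar s))"
| Scalar_central: "clifford_eq (Times (Scalar r) a) (Times a (Scalar r))"
| Vector_add: "clifford_eq (Vector (u + v)) (Plus (Vector u) (Vector v))"
| Vector_scaleR: "clifford_eq (Vector (r *\<^sub>R u)) (Times (Scalar r) (Vector u))"
| Vector_square: "clifford_eq (Times (Vector u) (Vector u)) (Scalar (- ((norm u)\<^sup>2)))"

quotient_type (overloaded) 'h clifford = "'h::real_inner clifford_term" / clifford_eq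
proof (rule equivpI)
  show "reflp clifford_eq" by (simp add: reflp_def clifford_eq.refl)
  show "symp clifford_eq" by (auto simp: symp_def intro: clifford_eq.sym)
  show "transp clifford_eq" by (auto simp: transp_def intro: clifford_eq.trans)
qed

lift_definition cliff :: "'h::real_inner \<Rightarrow> 'h clifford" is Vector .

instantiation clifford :: (real_inner) "{real_algebra, monoid_mult}"
begin

lift_definition zero_clifford :: "'a clifford" is "Scalar 0" .
lift_definition one_clifford :: "'a clifford" is "Scalar 1" .
lift_definition plus_clifford :: "'a clifford \<Rightarrow> 'a clifford \<Rightarrow> 'a clifford" is Plus
  by (rule clifford_eq.cong_Plus)
lift_definition times_clifford :: "'a clifford \<Rightarrow> 'a clifford \<Rightarrow> 'a clifford" is Times
  by (rule clifford_eq.cong_Times)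
lift_definition uminus_clifford :: "'a clifford \<Rightarrow> 'a clifford" is "Times (Scalar (- 1))"
  by (intro clifford_eq.cong_Times clifford_eq.refl)
lift_definition minus_clifford :: "'a clifford \<Rightarrow> 'a clifford \<Rightarrow> 'a clifford"
  is "\<lambda>a b. Plus a (Times (Scalar (- 1)) b)"
  by (intro clifford_eq.cong_Plus clifford_eq.cong_Times clifford_eq.refl)
lift_definition scaleR_clifford :: "real \<Rightarrow> 'a clifford \<Rightarrow> 'a clifford"
  is "\<lambda>r. Times (Scalar r)"
  by (intro clifford_eq.cong_Times clifford_eq.refl)

instance
proof
  fix a b c :: "'a clifford" and r s :: real
  show "a + b + c = a + (b + c)" by transfer (rule clifford_eq.add_assoc)
  show "a + b = b + a" by transfer (rule clifford_eq.add_commute)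
  show "0 + a = a" by transfer (rule clifford_eq.add_0)
  show "- a + a = 0" by transfer (rule clifford_eq.add_minus)
  show "a - b = a + - b" by transfer (rule clifford_eq.refl)
  show "a * b * c = a * (b * c)" by transfer (rule clifford_eq.mult_assoc)
  show "1 * a = a" by transfer (rule clifford_eq.mult_1_left)
  show "a * 1 = a" by transfer (rule clifford_eq.mult_1_right)
  show "(a + b) * c = a * c + b * c" by transfer (rule clifford_eq.distrib_right)
  show "a * (b + c) = a * b + a * c" by transfer (rule clifford_eq.distrib_left)
  show "r *\<^sub>R (a + b) = r *\<^sub>R a + r *\<^sub>R b" by transfer (rule clifford_eq.distrib_left)
  show "(r + s) *\<^sub>R a = r *\<^sub>R a + s *\<^sub>R a"
    by transfer (meson clifford_eq.trans clifford_eq.cong_Times clifford_eq.refl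
        clifford_eq.Scalar_add clifford_eq.distrib_right)
  show "r *\<^sub>R s *\<^sub>R a = (r * s) *\<^sub>R a"
    by transfer (meson clifford_eq.trans clifford_eq.sym clifford_eq.cong_Times clifford_eq.refl
        clifford_eq.Scalar_mult clifford_eq.mult_assoc)
  show "1 *\<^sub>R a = a" by transfer (rule clifford_eq.mult_1_left)
  show "r *\<^sub>R a * b = r *\<^sub>R (a * b)" by transfer (rule clifford_eq.mult_assoc)
  show "a * r *\<^sub>R b = r *\<^sub>R (a * b)"
    by transfer (meson clifford_eq.trans clifford_eq.sym clifford_eq.cong_Times clifford_eq.refl
        clifford_eq.Scalar_central clifford_eq.mult_assoc)
qed

end

lemma cliff_add: "cliff (u + v) = cliff u + cliff v"
  by transfer (rule clifford_eq.Vector_add)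

lemma cliff_scaleR: "cliff (r *\<^sub>R u) = r *\<^sub>R cliff u"
  by transfer (rule clifford_eq.Vector_scaleR)

lemma scaleR_one_clifford: "r *\<^sub>R (1 :: 'h::real_inner clifford) = abs_clifford (Scalar r)"
  by (simp add: one_clifford.abs_eq scaleR_clifford.abs_eq clifford.abs_eq_iff clifford_eq.mult_1_right)

lemma cliff_square: "cliff u * cliff u = - ((norm u)\<^sup>2 *\<^sub>R 1)"
proof -
  have "cliff u * cliff u = (- ((norm u)\<^sup>2)) *\<^sub>R 1"
    by transfer (meson clifford_eq.trans clifford_eq.sym clifford_eq.Vector_square
        clifford_eq.mult_1_right)
  then show ?thesis by simp
qed

lemma clifford_induct [case_names scalar vector plus times]:
  assumes "\<And>r. P (r *\<^sub>R 1)" and "\<And>u. P (cliff u)"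
    and "\<And>a b. P a \<Longrightarrow> P b \<Longrightarrow> P (a + b)" and "\<And>a b. P a \<Longrightarrow> P b \<Longrightarrow> P (a * b)"
  shows "P (a :: 'h::real_inner clifford)"
proof (induction a rule: clifford.abs_induct)
  case (1 t)
  show ?case
  proof (induction t)
    case (Scalar r)
    then show ?case using assms(1)[of r] by (simp add: scaleR_one_clifford)
  next
    case (Vector u)
    then show ?case using assms(2)[of u] by (simp add: cliff.abs_eq)
  next
    case (Plus a b)
    then show ?case using assms(3) by (metis plus_clifford.abs_eq)
  next
    case (Times a b)
    then show ?case using assms(4) by (metis times_clifford.abs_eq)
  qed
qed

text \<open>The universal property, as a check on the presentation.\<close>

theorem clifford_universal:
  fixes f :: "'h::real_inner \<Rightarrow> 'b::{real_algebra, monoid_mult}"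
  assumes lin: "linear f" and sq: "\<And>u. f u * f u = - ((norm u)\<^sup>2 *\<^sub>R 1)"
  shows "\<exists>!F. linear F \<and> F 1 = 1 \<and> (\<forall>a b. F (a * b) = F a * F b) \<and> (\<forall>u. F (cliff u) = f u)"
proof -
  interpret linear f by (rule lin)
  define ev :: "'h clifford_term \<Rightarrow> 'b" where
    "ev = rec_clifford_term (\<lambda>r. r *\<^sub>R 1) f (\<lambda>_ _ x y. x + y) (\<lambda>_ _ x y. x * y)"
  have ev [simp]: "ev (Scalar r) = r *\<^sub>R 1" "ev (Vector u) = f u"
    "ev (Plus a b) = ev a + ev b" "ev (Times a b) = ev a * ev b" for r u a b
    by (simp_all add: ev_def)
  have resp: "clifford_eq a b \<Longrightarrow> ev a = ev b" for a b
    by (induction rule: clifford_eq.induct)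
      (simp_all add: algebra_simps sq add scaleR)
  define F where "F a = ev (rep_clifford a)" for a
  have F_abs: "F (abs_clifford t) = ev t" for t
    unfolding F_def
    by (rule resp) (metis Quotient3_clifford Quotient3_rep_abs clifford_eq.refl)
  have F_add: "F (a + b) = F a + F b" for a b
    by (induction a rule: clifford.abs_induct, induction b rule: clifford.abs_induct)
      (simp add: plus_clifford.abs_eq F_abs)
  have F_mult: "F (a * b) = F a * F b" for a b
    by (induction a rule: clifford.abs_induct, induction b rule: clifford.abs_induct)
      (simp add: times_clifford.abs_eq F_abs)
  have F_scale: "F (r *\<^sub>R a) = r *\<^sub>R F a" for r a
    by (induction a rule: clifford.abs_induct) (simp add: scaleR_clifford.abs_eq F_abs)
  show ?thesis
  proof (rule ex1I)
    show "linear F \<and> F 1 = 1 \<and> (\<forall>a b. F (a * b) = F a * F b) \<and> (\<forall>u. F (cliff u) = f u)"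
      by (auto intro!: linearI simp: F_add F_mult F_scale F_abs one_clifford.abs_eq cliff.abs_eq)
  next
    fix G :: "'h clifford \<Rightarrow> 'b"
    assume G: "linear G \<and> G 1 = 1 \<and> (\<forall>a b. G (a * b) = G a * G b) \<and> (\<forall>u. G (cliff u) = f u)"
    have F1: "F 1 = 1" "F (cliff u) = f u" for u
      by (simp_all add: F_abs one_clifford.abs_eq cliff.abs_eq)
    show "G = F"
    proof
      fix a show "G a = F a"
        by (induction a rule: clifford_induct)
          (use G in \<open>auto simp: F_add F_mult F_scale F1 linear_add linear_scale\<close>)
    qed
  qed
qed


section \<open>Complex inner product spaces and unitary representations\<close>

text \<open>The inner product \<^term>\<open>cinner\<close> is linear in its first argument; \<^term>\<open>inner\<close> is its real part.\<close>

class complex_inner = real_inner +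
  fixes scaleC :: "complex \<Rightarrow> 'a \<Rightarrow> 'a" (infixr \<open>*\<^sub>C\<close> 75)
    and cinner :: "'a \<Rightarrow> 'a \<Rightarrow> complex"
  assumes scaleC_add_right: "a *\<^sub>C (x + y) = a *\<^sub>C x + a *\<^sub>C y"
    and scaleC_add_left: "(a + b) *\<^sub>C x = a *\<^sub>C x + b *\<^sub>C x"
    and scaleC_scaleC: "a *\<^sub>C b *\<^sub>C x = (a * b) *\<^sub>C x"
    and scaleR_scaleC: "r *\<^sub>R x = complex_of_real r *\<^sub>C x"
    and cinner_commute: "cinner x y = cnj (cinner y x)"
    and cinner_add_left: "cinner (x + y) z = cinner x z + cinner y z"
    and cinner_scaleC_left: "cinner (a *\<^sub>C x) y = a * cinner x y"
    and inner_eq_Re_cinner: "inner x y = Re (cinner x y)"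

instantiation complex :: complex_inner
begin
definition scaleC_complex :: "complex \<Rightarrow> complex \<Rightarrow> complex" where "scaleC_complex z x = z * x"
definition cinner_complex :: "complex \<Rightarrow> complex \<Rightarrow> complex" where "cinner_complex x y = x * cnj y"
instance
  by standard
    (simp_all add: scaleC_complex_def cinner_complex_def algebra_simps inner_complex_def
      scaleR_conv_of_real)
end

definition clinear :: "('v::complex_inner \<Rightarrow> 'v) \<Rightarrow> bool" where
  "clinear A \<longleftrightarrow> (\<forall>v w. A (v + w) = A v + A w) \<and> (\<forall>z v. A (z *\<^sub>C v) = z *\<^sub>C A v)"

definition clifford_rep :: "('h::real_inner clifford \<Rightarrow> 'v::complex_inner \<Rightarrow> 'v) \<Rightarrow> bool" where
  "clifford_rep \<rho> \<longleftrightarrow>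
     (\<forall>a. clinear (\<rho> a)) \<and>
     (\<forall>v. \<rho> 1 v = v) \<and>
     (\<forall>a b v. \<rho> (a * b) v = \<rho> a (\<rho> b v)) \<and>
     (\<forall>a b v. \<rho> (a + b) v = \<rho> a v + \<rho> b v) \<and>
     (\<forall>r a v. \<rho> (r *\<^sub>R a) v = r *\<^sub>R \<rho> a v)"

definition unitary_clifford_rep ::
  "('h::real_inner clifford \<Rightarrow> 'v::{complex_inner, complete_space} \<Rightarrow> 'v) \<Rightarrow> bool" where
  "unitary_clifford_rep \<rho> \<longleftrightarrow>
     clifford_rep \<rho> \<and> (\<forall>u v. norm (\<rho> (cliff u) v) = norm u * norm v)"

definition invariant_quaternionic_structure ::
  "('h::real_inner clifford \<Rightarrow> 'v::complex_inner \<Rightarrow> 'v) \<Rightarrow> ('v \<Rightarrow> 'v) \<Rightarrow> bool" where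
  "invariant_quaternionic_structure \<rho> Q \<longleftrightarrow>
     (\<forall>v w. Q (v + w) = Q v + Q w) \<and>
     (\<forall>z v. Q (z *\<^sub>C v) = cnj z *\<^sub>C Q v) \<and>
     (\<forall>v. norm (Q v) = norm v) \<and>
     (\<forall>v. Q (Q v) = - v) \<and>
     (\<forall>a v. Q (\<rho> a v) = \<rho> a (Q v))"

text \<open>
  An orthonormal basis of a prehilbert space \<open>h\<^sub>1, h\<^sub>1', h\<^sub>2, h\<^sub>2', \<dots>\<close>, where \<open>h\<^sub>k\<close> is \<^term>\<open>h (k - 1)\<close>
  (sequences are indexed from 0 throughout).  As usual in the Hilbert space setting, the linear span
  of a basis is only required to be dense.
\<close>

definition paired_orthonormal_basis :: "(nat \<Rightarrow> 'h::real_inner) \<Rightarrow> (nat \<Rightarrow> 'h) \<Rightarrow> bool" where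
  "paired_orthonormal_basis h h' \<longleftrightarrow>
     (\<forall>j k. h j \<bullet> h k = (if j = k then 1 else 0)) \<and>
     (\<forall>j k. h' j \<bullet> h' k = (if j = k then 1 else 0)) \<and>
     (\<forall>j k. h j \<bullet> h' k = 0) \<and>
     closure (span (range h \<union> range h')) = UNIV"

text \<open>Such a basis exists for every infinite-dimensional separable prehilbert space.\<close>

lemma orthonormal_extension:
  fixes B :: "'h::real_inner set"
  assumes inf: "\<not> (\<exists>B :: 'h set. finite B \<and> span B = UNIV)"
    and B: "finite B" "\<And>b c. b \<in> B \<Longrightarrow> c \<in> B \<Longrightarrow> b \<bullet> c = (if b = c then 1 else 0)"
  shows "\<exists>u. norm u = 1 \<and> (\<forall>b\<in>B. u \<bullet> b = 0) \<and> d \<in> span (insert u B)"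
proof -
  obtain y where y: "y \<notin> span B" "d \<notin> span B \<Longrightarrow> y = d"
    using inf B(1) by (metis UNIV_eq_I)
  define p where "p = (\<Sum>b\<in>B. (y \<bullet> b) *\<^sub>R b)"
  have p: "p \<in> span B" unfolding p_def by (intro span_sum span_scale span_base)
  then have "norm (y - p) \<noteq> 0" using y(1) by auto
  define u where "u = (y - p) /\<^sub>R norm (y - p)"
  have y_eq: "y = norm (y - p) *\<^sub>R u + p" using \<open>norm (y - p) \<noteq> 0\<close> by (simp add: u_def)
  have "u \<bullet> b = 0" if "b \<in> B" for b
  proof -
    have "p \<bullet> b = (\<Sum>c\<in>B. if c = b then y \<bullet> b else 0)"
      unfolding p_def inner_sum_left by (rule sum.cong) (use B(2) that in auto)
    then show ?thesis using B(1) that by (simp add: u_def inner_diff_left)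
  qed
  moreover have "d \<in> span (insert u B)"
  proof (cases "d \<in> span B")
    case True
    then show ?thesis using span_mono[of B "insert u B"] by auto
  next
    case False
    have "p \<in> span (insert u B)" using p span_mono[of B "insert u B"] by blast
    then have "norm (y - p) *\<^sub>R u + p \<in> span (insert u B)"
      by (simp add: span_add span_scale span_base)
    then show ?thesis using y(2)[OF False] y_eq by metis
  qed
  moreover have "norm u = 1" using \<open>norm (y - p) \<noteq> 0\<close> by (simp add: u_def)
  ultimately show ?thesis by blast
qed

theorem paired_orthonormal_basis_exists:
  assumes inf: "\<not> (\<exists>B :: 'h::real_inner set. finite B \<and> span B = UNIV)"
    and sep: "separable_space (euclidean :: 'h topology)"
  shows "\<exists>h h' :: nat \<Rightarrow> 'h. paired_orthonormal_basis h h'"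
proof -
  obtain D :: "'h set" where D: "countable D" "closure D = UNIV"
    using sep by (auto simp: separable_space_def euclidean_closure_of)
  then have "D \<noteq> {}" by auto
  define d where "d = from_nat_into D"
  have d: "range d = D" unfolding d_def using D(1) \<open>D \<noteq> {}\<close> by (rule range_from_nat_into[rotated])
  define nxt where "nxt k B = (SOME u. norm u = 1 \<and> (\<forall>b\<in>B. u \<bullet> b = 0) \<and> d k \<in> span (insert u B))"
    for k B
  define S where "S = rec_nat {} (\<lambda>k B. insert (nxt k B) B)"
  have S [simp]: "S 0 = {}" "S (Suc k) = insert (nxt k (S k)) (S k)" for k
    by (simp_all add: S_def)
  define b where "b k = nxt k (S k)" for k
  have S_eq: "S k = b ` {..<k}" for k
    by (induction k) (auto simp: b_def lessThan_Suc)
  have ex: "norm (b k) = 1 \<and> (\<forall>v\<in>B. b k \<bullet> v = 0) \<and> d k \<in> span (insert (b k) B)"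
    if "B = S k" "\<And>u v. u \<in> B \<Longrightarrow> v \<in> B \<Longrightarrow> u \<bullet> v = (if u = v then 1 else 0)" for k B
    unfolding b_def nxt_def that(1)[symmetric]
    by (rule someI_ex, rule orthonormal_extension[OF inf]) (use that S_eq in auto)
  have orth: "u \<bullet> v = (if u = v then 1 else 0)" if "u \<in> S k" "v \<in> S k" for u v k
    using that
  proof (induction k arbitrary: u v)
    case (Suc k)
    have *: "norm (b k) = 1" "\<And>v. v \<in> S k \<Longrightarrow> b k \<bullet> v = 0"
      using ex[OF HOL.refl Suc.IH] by blast+
    have "b k \<bullet> b k = 1" using *(1) by (simp add: norm_eq_1)
    then have "b k \<notin> S k" using *(2) by force
    with Suc * \<open>b k \<bullet> b k = 1\<close> show ?case
      by (auto simp: b_def[symmetric] inner_commute)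
  qed simp
  have b: "norm (b k) = 1" "\<And>v. v \<in> S k \<Longrightarrow> b k \<bullet> v = 0" "d k \<in> span (S (Suc k))" for k
    using ex[OF HOL.refl orth] by (auto simp: b_def[symmetric])
  have lt: "b k \<bullet> b j = 0" if "j < k" for j k
    using b(2)[of "b j" k] that by (simp add: S_eq)
  have on: "b j \<bullet> b k = (if j = k then 1 else 0)" for j k
    using lt[of j k] lt[of k j] b(1)[of j]
    by (cases j k rule: linorder_cases) (auto simp: inner_commute norm_eq_1)
  have "range b = range (\<lambda>k. b (2 * k)) \<union> range (\<lambda>k. b (2 * k + 1))"
  proof -
    have "b k \<in> range (\<lambda>k. b (2 * k)) \<union> range (\<lambda>k. b (2 * k + 1))" for k
      by (cases "even k") (auto elim!: evenE oddE)
    then show ?thesis by auto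
  qed
  moreover have "closure (span (range b)) = UNIV"
  proof -
    have "d k \<in> span (range b)" for k
      using b(3)[of k] span_mono[of "S (Suc k)" "range b"] unfolding S_eq by blast
    then have "D \<subseteq> span (range b)" using d by blast
    then show ?thesis using closure_mono D(2) by blast
  qed
  ultimately have "paired_orthonormal_basis (\<lambda>k. b (2 * k)) (\<lambda>k. b (2 * k + 1))"
    by (auto simp: paired_orthonormal_basis_def on) presburger+
  then show ?thesis by blast
qed


section \<open>Real \<open>\<ell>\<^sup>2\<close> and complexification\<close>

typedef ell2 = "{f :: nat \<Rightarrow> real. summable (\<lambda>n. (f n)\<^sup>2)}"
  morphisms ell2_nth Abs_ell2
  by (rule exI[of _ "\<lambda>_. 0"]) simp

setup_lifting type_definition_ell2

lemma summable_ell2: "summable (\<lambda>n. (ell2_nth x n)\<^sup>2)"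
  using ell2_nth by auto

lemma summable_sq_add:
  fixes f g :: "nat \<Rightarrow> real"
  assumes "summable (\<lambda>n. (f n)\<^sup>2)" "summable (\<lambda>n. (g n)\<^sup>2)"
  shows "summable (\<lambda>n. (f n + g n)\<^sup>2)"
proof (rule summable_comparison_test')
  show "summable (\<lambda>n. 2 * (f n)\<^sup>2 + 2 * (g n)\<^sup>2)"
    using assms by (intro summable_add summable_mult)
  show "norm ((f n + g n)\<^sup>2) \<le> 2 * (f n)\<^sup>2 + 2 * (g n)\<^sup>2" if "n \<ge> 0" for n
    using sum_squares_bound[of "f n" "g n"] abs_of_nonneg[OF zero_le_power2[of "f n + g n"]]
    by (simp add: power2_sum)
qed

lemma summable_sq_mult:
  fixes f g :: "nat \<Rightarrow> real"
  assumes "summable (\<lambda>n. (f n)\<^sup>2)" "summable (\<lambda>n. (g n)\<^sup>2)"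
  shows "summable (\<lambda>n. f n * g n)"
proof (rule summable_comparison_test')
  show "summable (\<lambda>n. (f n)\<^sup>2 + (g n)\<^sup>2)"
    using assms by (rule summable_add)
  show "norm (f n * g n) \<le> (f n)\<^sup>2 + (g n)\<^sup>2" if "n \<ge> 0" for n
  proof -
    have "2 * \<bar>f n * g n\<bar> \<le> (f n)\<^sup>2 + (g n)\<^sup>2"
      using sum_squares_bound[of "\<bar>f n\<bar>" "\<bar>g n\<bar>"] by (simp add: abs_mult)
    then show ?thesis by simp
  qed
qed

instantiation ell2 :: real_inner
begin

lift_definition zero_ell2 :: ell2 is "\<lambda>_. 0" by simp
lift_definition plus_ell2 :: "ell2 \<Rightarrow> ell2 \<Rightarrow> ell2" is "\<lambda>f g n. f n + g n"
  by (simp add: summable_sq_add)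
lift_definition uminus_ell2 :: "ell2 \<Rightarrow> ell2" is "\<lambda>f n. - f n" by simp
lift_definition minus_ell2 :: "ell2 \<Rightarrow> ell2 \<Rightarrow> ell2" is "\<lambda>f g n. f n - g n"
  using summable_sq_add[of _ "\<lambda>n. - g n" for g] by fastforce
lift_definition scaleR_ell2 :: "real \<Rightarrow> ell2 \<Rightarrow> ell2" is "\<lambda>r f n. r * f n"
  by (simp add: power_mult_distrib summable_mult)
definition inner_ell2 :: "ell2 \<Rightarrow> ell2 \<Rightarrow> real" where
  "inner_ell2 x y = (\<Sum>n. ell2_nth x n * ell2_nth y n)"
definition norm_ell2 :: "ell2 \<Rightarrow> real" where "norm_ell2 x = sqrt (inner x x)"
definition sgn_ell2 :: "ell2 \<Rightarrow> ell2" where "sgn_ell2 x = inverse (norm x) *\<^sub>R x"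
definition dist_ell2 :: "ell2 \<Rightarrow> ell2 \<Rightarrow> real" where "dist_ell2 x y = norm (x - y)"
definition uniformity_ell2 :: "(ell2 \<times> ell2) filter" where
  "uniformity_ell2 = (INF e\<in>{0 <..}. principal {(x, y). dist x y < e})"
definition open_ell2 :: "ell2 set \<Rightarrow> bool" where
  "open_ell2 S \<longleftrightarrow> (\<forall>x\<in>S. \<forall>\<^sub>F (x', y) in uniformity. x' = x \<longrightarrow> y \<in> S)"

instance
proof
  fix x y z :: ell2 and r s :: real
  show "x + y + z = x + (y + z)" "x + y = y + x" "0 + x = x" "- x + x = 0" "x - y = x + - y"
    "r *\<^sub>R (x + y) = r *\<^sub>R x + r *\<^sub>R y" "(r + s) *\<^sub>R x = r *\<^sub>R x + s *\<^sub>R x"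
    "r *\<^sub>R s *\<^sub>R x = (r * s) *\<^sub>R x" "1 *\<^sub>R x = x"
    by (transfer; simp add: algebra_simps)+
  show "dist x y = norm (x - y)" by (rule dist_ell2_def)
  show "sgn x = inverse (norm x) *\<^sub>R x" by (rule sgn_ell2_def)
  show "uniformity = (INF e\<in>{0 <..}. principal {(x :: ell2, y). dist x y < e})"
    by (rule uniformity_ell2_def)
  show "open S \<longleftrightarrow> (\<forall>x\<in>S. \<forall>\<^sub>F (x', y) in uniformity. x' = x \<longrightarrow> y \<in> S)" for S :: "ell2 set"
    by (rule open_ell2_def)
  have summ: "summable (\<lambda>n. ell2_nth x n * ell2_nth y n)" for x y
    by (intro summable_sq_mult summable_ell2)
  show "inner x y = inner y x" by (simp add: inner_ell2_def mult.commute)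
  show "inner (x + y) z = inner x z + inner y z"
    using suminf_add[OF summ[of x z] summ[of y z]]
    by (simp add: inner_ell2_def plus_ell2.rep_eq algebra_simps)
  show "inner (r *\<^sub>R x) y = r * inner x y"
    unfolding inner_ell2_def scaleR_ell2.rep_eq mult.assoc by (rule suminf_mult[OF summ])
  show "0 \<le> inner x x"
    unfolding inner_ell2_def by (intro suminf_nonneg summ) simp
  show "inner x x = 0 \<longleftrightarrow> x = 0"
    unfolding inner_ell2_def
    by (subst suminf_eq_zero_iff[OF summ]) (auto simp: ell2_nth_inject[symmetric] zero_ell2.rep_eq)
  show "norm x = sqrt (inner x x)" by (rule norm_ell2_def)
qed

end

lemma norm_ell2_sq: "(norm x)\<^sup>2 = (\<Sum>n. (ell2_nth x n)\<^sup>2)"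
  by (subst power2_norm_eq_inner) (simp add: inner_ell2_def power2_eq_square)

lemma sum_le_norm_ell2_sq: "(\<Sum>n<N. (ell2_nth x n)\<^sup>2) \<le> (norm x)\<^sup>2"
  unfolding norm_ell2_sq by (intro sum_le_suminf summable_ell2) auto

lemma abs_ell2_nth_le: "\<bar>ell2_nth x n\<bar> \<le> norm x"
proof -
  have "(ell2_nth x n)\<^sup>2 \<le> (\<Sum>k<Suc n. (ell2_nth x k)\<^sup>2)"
    by (simp add: sum_nonneg)
  also have "\<dots> \<le> (norm x)\<^sup>2" by (rule sum_le_norm_ell2_sq)
  finally show ?thesis by (simp add: abs_le_square_iff[symmetric])
qed

instance ell2 :: complete_space
proof
  fix X :: "nat \<Rightarrow> ell2"
  assume X: "Cauchy X"
  have "Cauchy (\<lambda>m. ell2_nth (X m) n)" for n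
  proof (rule metric_CauchyI)
    fix e :: real assume "e > 0"
    then obtain M where M: "\<And>i j. i \<ge> M \<Longrightarrow> j \<ge> M \<Longrightarrow> dist (X i) (X j) < e"
      using X metric_CauchyD by blast
    have "dist (ell2_nth (X i) n) (ell2_nth (X j) n) < e" if "i \<ge> M" "j \<ge> M" for i j
      using abs_ell2_nth_le[of "X i - X j" n] M[OF that]
      by (simp add: dist_norm minus_ell2.rep_eq)
    then show "\<exists>M. \<forall>i\<ge>M. \<forall>j\<ge>M. dist (ell2_nth (X i) n) (ell2_nth (X j) n) < e" by blast
  qed
  then have "\<forall>n. \<exists>l. (\<lambda>m. ell2_nth (X m) n) \<longlonglongrightarrow> l"
    by (meson Cauchy_convergent_iff convergent_def)
  then obtain g where g: "\<And>n. (\<lambda>m. ell2_nth (X m) n) \<longlonglongrightarrow> g n" by metis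
  have bound: "\<exists>M. \<forall>i\<ge>M. \<forall>N. (\<Sum>n<N. (ell2_nth (X i) n - g n)\<^sup>2) \<le> e\<^sup>2" if "e > 0" for e
  proof -
    obtain M where M: "\<And>i j. i \<ge> M \<Longrightarrow> j \<ge> M \<Longrightarrow> dist (X i) (X j) < e"
      using X metric_CauchyD \<open>e > 0\<close> by blast
    have "(\<Sum>n<N. (ell2_nth (X i) n - g n)\<^sup>2) \<le> e\<^sup>2" if "i \<ge> M" for i N
    proof (rule tendsto_upperbound)
      show "(\<lambda>j. \<Sum>n<N. (ell2_nth (X i) n - ell2_nth (X j) n)\<^sup>2) \<longlonglongrightarrow>
          (\<Sum>n<N. (ell2_nth (X i) n - g n)\<^sup>2)"
        by (intro tendsto_intros g)
      have "(\<Sum>n<N. (ell2_nth (X i) n - ell2_nth (X j) n)\<^sup>2) \<le> e\<^sup>2" if "j \<ge> M" for j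
      proof -
        have "(\<Sum>n<N. (ell2_nth (X i) n - ell2_nth (X j) n)\<^sup>2) \<le> (norm (X i - X j))\<^sup>2"
          using sum_le_norm_ell2_sq[where x = "X i - X j"] by (simp add: minus_ell2.rep_eq)
        also have "\<dots> \<le> e\<^sup>2"
          using M[OF \<open>i \<ge> M\<close> that] by (intro power_mono) (auto simp: dist_norm)
        finally show ?thesis .
      qed
      then show "\<forall>\<^sub>F j in sequentially. (\<Sum>n<N. (ell2_nth (X i) n - ell2_nth (X j) n)\<^sup>2) \<le> e\<^sup>2"
        using eventually_at_top_linorder by blast
    qed simp
    then show ?thesis by blast
  qed
  have diff: "summable (\<lambda>n. (ell2_nth (X i) n - g n)\<^sup>2)"
    if "\<forall>N. (\<Sum>n<N. (ell2_nth (X i) n - g n)\<^sup>2) \<le> e" for i e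
    using that by (intro summableI_nonneg_bounded[where x = e]) auto
  obtain i where "\<forall>N. (\<Sum>n<N. (ell2_nth (X i) n - g n)\<^sup>2) \<le> 1\<^sup>2"
    using bound[of 1] by auto
  then have "summable (\<lambda>n. (ell2_nth (X i) n - g n)\<^sup>2)" by (rule diff)
  then have "summable (\<lambda>n. (- (ell2_nth (X i) n - g n))\<^sup>2)" by (simp only: power2_minus)
  then have "summable (\<lambda>n. (- (ell2_nth (X i) n - g n) + ell2_nth (X i) n)\<^sup>2)"
    by (intro summable_sq_add summable_ell2)
  then have "summable (\<lambda>n. (g n)\<^sup>2)" by simp
  then have nth: "ell2_nth (Abs_ell2 g) = g" by (simp add: Abs_ell2_inverse)
  have "X \<longlonglongrightarrow> Abs_ell2 g"
  proof (rule metric_LIMSEQ_I)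
    fix e :: real assume "e > 0"
    then obtain M where M: "\<forall>i\<ge>M. \<forall>N. (\<Sum>n<N. (ell2_nth (X i) n - g n)\<^sup>2) \<le> (e/2)\<^sup>2"
      using bound[of "e/2"] by auto
    have "dist (X i) (Abs_ell2 g) < e" if "i \<ge> M" for i
    proof -
      have "(norm (X i - Abs_ell2 g))\<^sup>2 \<le> (e/2)\<^sup>2"
        unfolding norm_ell2_sq minus_ell2.rep_eq nth
        by (rule suminf_le_const) (use M that diff in blast)+
      then have "norm (X i - Abs_ell2 g) \<le> e/2"
        using \<open>e > 0\<close> by (simp add: power2_le_iff_abs_le)
      then show ?thesis using \<open>e > 0\<close> by (simp add: dist_norm)
    qed
    then show "\<exists>M. \<forall>i\<ge>M. dist (X i) (Abs_ell2 g) < e" by blast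
  qed
  then show "convergent X" by (auto simp: convergent_def)
qed

text \<open>Finite rational sequences are dense.\<close>

lift_definition ell2_of_list :: "rat list \<Rightarrow> ell2"
  is "\<lambda>qs n. if n < length qs then real_of_rat (qs ! n) else 0"
  by (rule summable_finite[of "{..<length qs}" for qs]) auto

lemma ell2_of_list_dense:
  assumes "e > 0" shows "\<exists>qs. dist x (ell2_of_list qs) < e"
proof -
  have "(\<lambda>N. \<Sum>n. (ell2_nth x (n + N))\<^sup>2) \<longlonglongrightarrow> 0"
    by (rule suminf_exist_split2) (rule summable_ell2)
  then have "\<forall>\<^sub>F N in sequentially. (\<Sum>n. (ell2_nth x (n + N))\<^sup>2) < e\<^sup>2 / 2"
    using assms by (intro order_tendstoD(2)) auto
  then obtain N where N: "(\<Sum>n. (ell2_nth x (n + N))\<^sup>2) < e\<^sup>2 / 2"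
    by (auto simp: eventually_at_top_linorder)
  define d where "d = e / sqrt (2 * (real N + 1))"
  have d: "d > 0" "d\<^sup>2 = e\<^sup>2 / (2 * (real N + 1))"
    using assms by (auto simp: d_def power_divide)
  have "\<exists>q. \<bar>ell2_nth x n - real_of_rat q\<bar> < d" for n
  proof -
    obtain q where "ell2_nth x n - d < real_of_rat q" "real_of_rat q < ell2_nth x n + d"
      using of_rat_dense[of "ell2_nth x n - d" "ell2_nth x n + d"] d(1) by auto
    then show ?thesis by (intro exI[of _ q]) (simp add: abs_less_iff)
  qed
  then obtain q where q: "\<And>n. \<bar>ell2_nth x n - real_of_rat (q n)\<bar> < d" by metis
  define y where "y = ell2_of_list (map q [0..<N])"
  have y: "ell2_nth (x - y) n = (if n < N then ell2_nth x n - real_of_rat (q n) else ell2_nth x n)" for n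
    by (simp add: y_def minus_ell2.rep_eq ell2_of_list.rep_eq)
  have "(norm (x - y))\<^sup>2 = (\<Sum>n. (ell2_nth (x - y) (n + N))\<^sup>2) + (\<Sum>n<N. (ell2_nth (x - y) n)\<^sup>2)"
    unfolding norm_ell2_sq by (rule suminf_split_initial_segment) (rule summable_ell2)
  also have "(\<Sum>n. (ell2_nth (x - y) (n + N))\<^sup>2) < e\<^sup>2 / 2"
    using N by (simp add: y)
  also have "(\<Sum>n<N. (ell2_nth (x - y) n)\<^sup>2) \<le> (\<Sum>n<N. d\<^sup>2)"
  proof (rule sum_mono)
    fix n assume "n \<in> {..<N}"
    then show "(ell2_nth (x - y) n)\<^sup>2 \<le> d\<^sup>2"
      using q[of n] d(1) by (simp add: y abs_le_square_iff[symmetric])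
  qed
  also have "(\<Sum>n<N. d\<^sup>2) \<le> e\<^sup>2 / 2"
    using assms by (simp add: d(2) field_simps)
  finally have "(norm (x - y))\<^sup>2 < e\<^sup>2" by simp
  then have "dist x y < e"
    using assms by (simp add: dist_norm power2_less_imp_less)
  then show ?thesis unfolding y_def by blast
qed

instance ell2 :: second_countable_topology
proof
  define B where "B = (\<lambda>(qs, r). ball (ell2_of_list qs) (real_of_rat r)) ` (UNIV :: (rat list \<times> rat) set)"
  have "countable B" unfolding B_def by (intro countable_image) simp
  moreover have "topological_basis B"
  proof (rule topological_basisI)
    show "open b" if "b \<in> B" for b using that by (auto simp: B_def)
  next
    fix O' :: "ell2 set" and x assume "open O'" "x \<in> O'"
    then obtain e where e: "e > 0" "ball x e \<subseteq> O'" by (auto simp: open_contains_ball)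
    obtain r where r: "0 < real_of_rat r" "real_of_rat r < e / 2"
      using of_rat_dense[of 0 "e / 2"] e(1) by auto
    obtain qs where qs: "dist x (ell2_of_list qs) < real_of_rat r"
      using ell2_of_list_dense r(1) by blast
    have "ball (ell2_of_list qs) (real_of_rat r) \<subseteq> ball x e"
    proof
      fix z assume "z \<in> ball (ell2_of_list qs) (real_of_rat r)"
      then show "z \<in> ball x e"
        using dist_triangle[of x z "ell2_of_list qs"] qs r(2) by simp
    qed
    moreover have "ball (ell2_of_list qs) (real_of_rat r) \<in> B"
      unfolding B_def by (rule image_eqI[where x = "(qs, r)"]) auto
    ultimately show "\<exists>B'\<in>B. x \<in> B' \<and> B' \<subseteq> O'"
      using e(2) qs by (intro bexI[of _ "ball (ell2_of_list qs) (real_of_rat r)"]) (auto simp: dist_commute)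
  qed
  ultimately show "\<exists>B :: ell2 set set. countable B \<and> open = generate_topology B"
    using topological_basis_imp_subbasis by blast
qed

text \<open>
  The complexification \<open>\<complex> \<otimes> U\<close> of a real Hilbert space \<open>U\<close> is \<open>U \<times> U\<close>, the pair \<open>(u, v)\<close> standing
  for \<open>1 \<otimes> u + \<i> \<otimes> v\<close>.  The product norm of \<open>(u, v)\<close> is \<open>sqrt (\<parallel>u\<parallel>\<^sup>2 + \<parallel>v\<parallel>\<^sup>2)\<close>.
\<close>

definition cx_scale :: "complex \<Rightarrow> 'u::real_vector \<times> 'u \<Rightarrow> 'u \<times> 'u" where
  "cx_scale z p = (Re z *\<^sub>R fst p - Im z *\<^sub>R snd p, Re z *\<^sub>R snd p + Im z *\<^sub>R fst p)"

definition cx_inner :: "'u::real_inner \<times> 'u \<Rightarrow> 'u \<times> 'u \<Rightarrow> complex" where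
  "cx_inner p q =
     Complex (fst p \<bullet> fst q + snd p \<bullet> snd q) (snd p \<bullet> fst q - fst p \<bullet> snd q)"

definition cx_conj :: "'u::real_vector \<times> 'u \<Rightarrow> 'u \<times> 'u" where
  "cx_conj p = (fst p, - snd p)"

interpretation cx: vector_space cx_scale
  by standard (auto simp: cx_scale_def algebra_simps)

lemma cx_inner_scale_left: "cx_inner (cx_scale z p) q = z * cx_inner p q"
  by (simp add: cx_inner_def cx_scale_def complex_eq_iff algebra_simps inner_simps)

lemma cx_inner_commute: "cx_inner p q = cnj (cx_inner q p)"
  by (simp add: cx_inner_def complex_eq_iff inner_commute)

lemma cx_inner_self: "cx_inner p p = complex_of_real ((norm p)\<^sup>2)"
  by (simp add: cx_inner_def complex_eq_iff norm_prod_def power2_norm_eq_inner inner_commute)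

definition cx_dim :: "('u::real_inner \<times> 'u) set \<Rightarrow> enat" where
  "cx_dim V = (if \<exists>B. finite B \<and> V \<subseteq> cx.span B then enat (cx.dim V) else \<infinity>)"

definition cx_unitary ::
  "('u::real_inner \<times> 'u) set \<Rightarrow> ('u \<times> 'u) set \<Rightarrow> ('u \<times> 'u \<Rightarrow> 'u \<times> 'u) \<Rightarrow> bool" where
  "cx_unitary V W A \<longleftrightarrow>
     A ` V = W \<and>
     (\<forall>v\<in>V. \<forall>w\<in>V. A (v + w) = A v + A w) \<and>
     (\<forall>z. \<forall>v\<in>V. A (cx_scale z v) = cx_scale z (A v)) \<and>
     (\<forall>v\<in>V. \<forall>w\<in>V. cx_inner (A v) (A w) = cx_inner v w)"


section \<open>Standard representations of quaternionic type\<close>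

instantiation bit :: discrete_topology
begin
definition open_bit :: "bit set \<Rightarrow> bool" where "open_bit S \<longleftrightarrow> True"
instance by standard (simp_all add: open_bit_def)
end

instance bit :: second_countable_topology
proof
  have "finite (UNIV :: bit set)"
    by (metis (full_types) UNIV_I bit_not_zero_iff finite.emptyI finite.insertI finite_subset insertCI subsetI)
  then have "countable (UNIV :: bit set set)"
    by (simp add: Finite_Set.finite_set countable_finite)
  moreover have "open = generate_topology (UNIV :: bit set set)"
    by (auto simp: fun_eq_iff open_bit_def intro: generate_topology.Basis)
  ultimately show "\<exists>B :: bit set set. countable B \<and> open = generate_topology B" by blast
qed

text \<open>
  \<open>X = \<int>\<^sub>2\<^sup>\<infinity>\<close>, with the pointwise addition and product topology of the function type; the paper's
  \<open>x\<^sub>k\<close> is \<^term>\<open>x (k - 1)\<close>.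
\<close>

type_synonym cantor = "nat \<Rightarrow> bit"

definition delta :: "nat \<Rightarrow> cantor" where
  "delta k = (\<lambda>i. if i = k then 1 else 0)"

definition Delta :: "cantor set" where
  "Delta = {d. finite {i. d i = 1}}"

definition check :: "cantor \<Rightarrow> cantor" where
  "check x = x + (\<lambda>_. 1)"

definition parity_sign :: "cantor \<Rightarrow> nat \<Rightarrow> real" where
  "parity_sign x n = (- 1) ^ card {i. i < n \<and> x i = 1}"

text \<open>The measure \<open>A \<mapsto> \<mu> (A + d)\<close>; recall \<open>x + d = x - d\<close>.\<close>

definition translate_measure :: "cantor measure \<Rightarrow> cantor \<Rightarrow> cantor measure" where
  "translate_measure \<mu> d = distr \<mu> borel (\<lambda>x. x + d)"

definition check_measure :: "cantor measure \<Rightarrow> cantor measure" where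
  "check_measure \<mu> = distr \<mu> borel check"

definition equivalent_measures :: "'a measure \<Rightarrow> 'a measure \<Rightarrow> bool" where
  "equivalent_measures M N \<longleftrightarrow> absolutely_continuous M N \<and> absolutely_continuous N M"

text \<open>
  Every separable real Hilbert space is isometric to a closed subspace of \<open>\<ell>\<^sup>2\<close>, so fibres are taken
  to be such subspaces; a measurable family is one that admits a fundamental sequence of measurable
  sections.
\<close>

definition measurable_hilbert_family :: "(cantor \<Rightarrow> ell2 set) \<Rightarrow> bool" where
  "measurable_hilbert_family U \<longleftrightarrow>
     (\<forall>x. subspace (U x) \<and> closed (U x)) \<and>
     (\<exists>e :: nat \<Rightarrow> cantor \<Rightarrow> ell2. (\<forall>n. e n \<in> borel_measurable borel) \<and>
        (\<forall>x. closure (span (range (\<lambda>n. e n x))) = U x))"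

definition complexified :: "(cantor \<Rightarrow> ell2 set) \<Rightarrow> cantor \<Rightarrow> (ell2 \<times> ell2) set" where
  "complexified U x = U x \<times> U x"

definition measurable_operator_family ::
  "(cantor \<Rightarrow> (ell2 \<times> ell2) set) \<Rightarrow> (cantor \<Rightarrow> ell2 \<times> ell2 \<Rightarrow> ell2 \<times> ell2) \<Rightarrow> bool" where
  "measurable_operator_family V A \<longleftrightarrow>
     (\<forall>f \<in> borel_measurable borel. (\<forall>x. f x \<in> V x) \<longrightarrow> (\<lambda>x. A x (f x)) \<in> borel_measurable borel)"

text \<open>
  The data of a standard representation of quaternionic type.  The paper's \<open>c\<^sub>k\<close> is \<^term>\<open>c (k - 1)\<close>,
  whence the shifted exponent in \<open>conj_c_Suc\<close>.
\<close>

locale standard_quaternionic_data =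
  fixes \<mu> :: "cantor measure"
    and U :: "cantor \<Rightarrow> ell2 set"
    and c :: "nat \<Rightarrow> cantor \<Rightarrow> ell2 \<times> ell2 \<Rightarrow> ell2 \<times> ell2"
  assumes sets_mu: "sets \<mu> = sets borel"
    and sigma_finite: "sigma_finite_measure \<mu>"
    and quasi_invariant: "\<And>d. d \<in> Delta \<Longrightarrow> equivalent_measures (translate_measure \<mu> d) \<mu>"
    and check_equivalent: "equivalent_measures (check_measure \<mu>) \<mu>"
    and measurable_U: "measurable_hilbert_family U"
    and U_nonzero: "\<And>x. U x \<noteq> {0}"
    and U_invariant: "\<And>d. d \<in> Delta \<Longrightarrow> AE x in \<mu>. U (x + d) = U x \<and> U (check x) = U x"
    and nu_measurable: "(\<lambda>x. cx_dim (complexified U x)) \<in> measurable borel (count_space UNIV)"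
    and nu_check: "AE x in \<mu>. cx_dim (complexified U (check x)) = cx_dim (complexified U x)"
    and c_measurable: "\<And>k. measurable_operator_family (complexified U) (c k)"
    and c_unitary: "\<And>k. AE x in \<mu>. cx_unitary (complexified U x) (complexified U (x + delta k)) (c k x)"
    and c_adjoint: "\<And>k. AE x in \<mu>. \<forall>v \<in> complexified U x. \<forall>w \<in> complexified U (x + delta k).
        cx_inner (c k x v) w = cx_inner v (c k (x + delta k) w)"
    and c_commute: "\<And>k l. AE x in \<mu>. \<forall>v \<in> complexified U x.
        c k x (c l (x + delta k) v) = c l x (c k (x + delta l) v)"
    and conj_c_0: "AE x in \<mu>. \<forall>v \<in> complexified U x. cx_conj (c 0 x (cx_conj v)) = c 0 (check x) v"
    and conj_c_Suc: "\<And>k. k \<ge> 1 \<Longrightarrow> AE x in \<mu>. \<forall>v \<in> complexified U x.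
        cx_conj (c k x (cx_conj v)) = (- 1) ^ (k + 1) *\<^sub>R c k (check x) v"

text \<open>Square-integrable sections; elements of the direct integral are these modulo equality a.e.\<close>

definition direct_integral ::
  "cantor measure \<Rightarrow> (cantor \<Rightarrow> (ell2 \<times> ell2) set) \<Rightarrow> (cantor \<Rightarrow> ell2 \<times> ell2) set" where
  "direct_integral \<mu> V =
     {f \<in> borel_measurable borel. (AE x in \<mu>. f x \<in> V x) \<and> integrable \<mu> (\<lambda>x. (norm (f x))\<^sup>2)}"

definition standard_J ::
  "cantor measure \<Rightarrow> (nat \<Rightarrow> cantor \<Rightarrow> ell2 \<times> ell2 \<Rightarrow> ell2 \<times> ell2) \<Rightarrow> nat \<Rightarrow>
   (cantor \<Rightarrow> ell2 \<times> ell2) \<Rightarrow> cantor \<Rightarrow> ell2 \<times> ell2" where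
  "standard_J \<mu> c k f x =
     cx_scale (- \<i> * complex_of_real (parity_sign x k
        * sqrt (enn2real (RN_deriv \<mu> (translate_measure \<mu> (delta k)) x))))
       (c k x (f (x + delta k)))"

definition standard_J' ::
  "cantor measure \<Rightarrow> (nat \<Rightarrow> cantor \<Rightarrow> ell2 \<times> ell2 \<Rightarrow> ell2 \<times> ell2) \<Rightarrow> nat \<Rightarrow>
   (cantor \<Rightarrow> ell2 \<times> ell2) \<Rightarrow> cantor \<Rightarrow> ell2 \<times> ell2" where
  "standard_J' \<mu> c k f x =
     (parity_sign x (k + 1) * sqrt (enn2real (RN_deriv \<mu> (translate_measure \<mu> (delta k)) x)))
       *\<^sub>R c k x (f (x + delta k))"

text \<open>\<open>T\<close> induces a unitary operator onto the direct integral.\<close>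

definition unitary_onto_direct_integral ::
  "cantor measure \<Rightarrow> (cantor \<Rightarrow> (ell2 \<times> ell2) set) \<Rightarrow>
   ('v::complex_inner \<Rightarrow> cantor \<Rightarrow> ell2 \<times> ell2) \<Rightarrow> bool" where
  "unitary_onto_direct_integral \<mu> V T \<longleftrightarrow>
     (\<forall>v. T v \<in> direct_integral \<mu> V) \<and>
     (\<forall>v w. AE x in \<mu>. T (v + w) x = T v x + T w x) \<and>
     (\<forall>z v. AE x in \<mu>. T (z *\<^sub>C v) x = cx_scale z (T v x)) \<and>
     (\<forall>v w. (LINT x|\<mu>. cx_inner (T v x) (T w x)) = cinner v w) \<and>
     (\<forall>f \<in> direct_integral \<mu> V. \<exists>v. AE x in \<mu>. T v x = f x)"

text \<open>
  The standard representation is determined by its values \<^const>\<open>standard_J\<close>, \<^const>\<open>standard_J'\<close>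
  on the basis, so a unitary operator is an equivalence iff it intertwines these.
\<close>

definition equivalent_to_standard ::
  "('h::real_inner clifford \<Rightarrow> 'v::complex_inner \<Rightarrow> 'v) \<Rightarrow> (nat \<Rightarrow> 'h) \<Rightarrow> (nat \<Rightarrow> 'h) \<Rightarrow>
   cantor measure \<Rightarrow> (cantor \<Rightarrow> ell2 set) \<Rightarrow>
   (nat \<Rightarrow> cantor \<Rightarrow> ell2 \<times> ell2 \<Rightarrow> ell2 \<times> ell2) \<Rightarrow> bool" where
  "equivalent_to_standard \<rho> h h' \<mu> U c \<longleftrightarrow>
     (\<exists>T. unitary_onto_direct_integral \<mu> (complexified U) T \<and>
       (\<forall>k v. AE x in \<mu>. T (\<rho> (cliff (h k)) v) x = standard_J \<mu> c k (T v) x) \<and>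
       (\<forall>k v. AE x in \<mu>. T (\<rho> (cliff (h' k)) v) x = standard_J' \<mu> c k (T v) x))"

end

theory Submission
  imports Defs
begin

text \<open>
  Put \<open>S\<^sub>k = \<i> J'\<^sub>k J\<^sub>k\<close>, \<open>W\<^sub>k = \<i> S\<^sub>1 \<dots> S\<^bsub>k-1\<^esub> J\<^sub>k\<close> and \<open>K = S\<^sub>1 Q\<close>.  The \<open>S\<^sub>k\<close> and the \<open>W\<^sub>k\<close>
  are two families of commuting self-adjoint involutions, \<open>W\<^sub>k\<close> anticommutes with \<open>S\<^sub>k\<close> and commutes
  with the other \<open>S\<^sub>l\<close>, and \<open>K\<close> is an antilinear involution anticommuting with every \<open>S\<^sub>k\<close>.  In a
  standard representation \<open>S\<^sub>k\<close> is multiplication by the coordinate character \<open>(-1)\<^bsup>x\<^sub>k\<^esup>\<close>, \<open>W\<^sub>k\<close> is the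
  weighted translation by \<open>\<delta>\<^sup>k\<close> and \<open>K\<close> is \<open>f \<mapsto> conj (f (check x))\<close>.

  The \<open>S\<^sub>k\<close> have a joint spectral measure on the Cantor group.  Cyclic subspaces generated by
  \<open>K\<close>-fixed vectors are \<open>K\<close>-invariant and have check-invariant spectral measures; decomposing into such
  subspaces and listing, at each point \<open>x\<close>, those whose density does not vanish at \<open>x\<close> gives a unitary
  \<open>T\<close> onto a direct integral with fibres \<open>\<complex>\<^bsup>\<nu>(x)\<^esup>\<close>, under which \<open>S\<^sub>k\<close> and \<open>K\<close> are as required.
  Since \<open>W\<^sub>k\<close> translates the spectral measure, \<open>|T (W\<^sub>k v) x|\<^sup>2 = D\<^sub>k x |T v (x + \<delta>\<^sup>k)|\<^sup>2\<close> almost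
  everywhere.  By polarization this defines the fibre isometries \<open>c\<^sub>k x\<close>; comparing dimensions shows that
  \<open>\<nu>\<close> is \<open>\<Delta>\<close>-invariant, and the relations between \<open>c\<^sub>k\<close> are the relations between \<open>W\<^sub>k\<close> and \<open>K\<close> after
  cancelling positive scalars, which agree because all the maps are isometric.
\<close>

section \<open>Completeness in Hilbert spaces and \<open>L\<^sup>2\<close>\<close>

text \<open>\<open>Q\<close> has no nonzero fixed vectors, since its square is -I. It anticommutes
  with every S_k, because these contain a factor i; hence K = S_1 Q squares to +I and is a genuine
  conjugation. For a K-fixed vector e the isometry K shows that the moment of a word in the S_k at e
  equals (-1)^length times itself. So the odd moments vanish, which is exactly invariance of the
  spectral measure under \<open>check\<close>. The product S_1 ... S_(k-1) in W_k is a Jordan-Wigner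
  factor: it turns the anticommuting J_k into commuting operators. The obstacle is that T is
  determined only up to a null set for each vector, whereas c_k(x) must be a map of the whole fibre
  at almost every single x. Therefore c_k(x) is built from countably many vectors only, the
  T-preimages of a measurable frame of the fibres; identities are proved on the frame and carried to
  the fibre by isometry. The exceptional sign of c_1 comes from the factor S_1 of K, which
  anticommutes with W_1 and commutes with every other W_k.\<close>

lemma riesz_on_subspace:
  fixes M :: "'a::{real_inner, complete_space} set"
  assumes M: "closed M" "subspace M" and phi: "bounded_linear \<phi>"
  obtains w where "w \<in> M" "\<And>v. v \<in> M \<Longrightarrow> \<phi> v = v \<bullet> w"
proof -
  interpret \<phi>: bounded_linear \<phi> by (rule phi)
  obtain B where B: "\<And>v. norm (\<phi> v) \<le> norm v * B"
    using \<phi>.bounded by blast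
  \<comment> \<open>The representing vector is the minimiser of \<open>q\<close> on \<open>M\<close>.\<close>
  define q where "q v = v \<bullet> v - 2 * \<phi> v" for v
  have low: "q v \<ge> - (B\<^sup>2)" for v
  proof -
    have "\<phi> v \<le> norm v * B" using B[of v] by simp
    moreover have "0 \<le> (norm v - B)\<^sup>2" by simp
    ultimately show ?thesis
      by (simp add: q_def power2_diff dot_square_norm)
  qed
  define d where "d = Inf (q ` M)"
  have bdd: "bdd_below (q ` M)" using low by (intro bdd_belowI) auto
  have "0 \<in> M" using M(2) by (rule subspace_0)
  have d_le: "d \<le> q v" if "v \<in> M" for v
    unfolding d_def using bdd that by (intro cInf_lower) auto
  define r where "r n = inverse (real (Suc n))" for n
  have "\<exists>v\<in>M. q v < d + r n" for n
    using cInf_lessD[of "q ` M" "d + r n"] \<open>0 \<in> M\<close>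
    by (auto simp: d_def r_def)
  then obtain v where v: "\<And>n. v n \<in> M" "\<And>n. q (v n) < d + r n" by metis
  \<comment> \<open>The parallelogram law for q: two near-minimisers are close, because q at their
    midpoint is still at least d.\<close>
  have par: "(norm (x - y))\<^sup>2 \<le> 2 * (q x - d) + 2 * (q y - d)" if "x \<in> M" "y \<in> M" for x y
  proof -
    have m: "(1/2) *\<^sub>R (x + y) \<in> M"
      using that M(2) by (simp add: subspace_add subspace_scale)
    have "4 * q ((1/2) *\<^sub>R (x + y)) = (x + y) \<bullet> (x + y) - 4 * \<phi> (x + y)"
      by (simp add: q_def \<phi>.scale)
    then have "(norm (x - y))\<^sup>2 + 4 * q ((1/2) *\<^sub>R (x + y)) = 2 * q x + 2 * q y"
      by (simp add: power2_norm_eq_inner q_def \<phi>.add inner_diff_left inner_diff_right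
          inner_add_left inner_add_right inner_commute)
    with d_le[OF m] show ?thesis by simp
  qed
  have "Cauchy v"
  proof (rule metric_CauchyI)
    fix e :: real assume "e > 0"
    obtain N where N: "r N < e\<^sup>2 / 4"
      using reals_Archimedean[of "e\<^sup>2 / 4"] \<open>e > 0\<close> by (auto simp: r_def)
    have r: "r n \<le> r N" if "n \<ge> N" for n
      unfolding r_def using that by (auto intro: le_imp_inverse_le)
    have "dist (v m) (v n) < e" if "m \<ge> N" "n \<ge> N" for m n
    proof -
      have "q (v m) - d < e\<^sup>2 / 4" "q (v n) - d < e\<^sup>2 / 4"
        using v(2)[of m] v(2)[of n] N r that by force+
      then have "(norm (v m - v n))\<^sup>2 < e\<^sup>2"
        using par[OF v(1) v(1), of m n] by simp
      then show ?thesis using \<open>e > 0\<close> by (simp add: dist_norm power2_less_imp_less)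
    qed
    then show "\<exists>N. \<forall>m\<ge>N. \<forall>n\<ge>N. dist (v m) (v n) < e" by blast
  qed
  then obtain w where w: "v \<longlonglongrightarrow> w" by (auto simp: Cauchy_convergent_iff convergent_def)
  have "w \<in> M" using closed_sequentially[OF M(1)] v(1) w by blast
  have "(\<lambda>n. q (v n)) \<longlonglongrightarrow> q w"
    unfolding q_def by (intro tendsto_intros \<phi>.tendsto w)
  moreover have "(\<lambda>n. d + r n) \<longlonglongrightarrow> d + 0"
    unfolding r_def by (intro tendsto_intros LIMSEQ_inverse_real_of_nat)
  ultimately have "q w \<le> d + 0" by (rule LIMSEQ_le) (use v(2) less_imp_le in blast)
  have "\<phi> u = u \<bullet> w" if "u \<in> M" for u
  proof -
    \<comment> \<open>Minimality of w along the line through w in direction u. A nonnegative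
      quadratic in t without constant term must have zero linear coefficient.\<close>
    have quad: "0 \<le> 2 * t * (u \<bullet> w - \<phi> u) + t\<^sup>2 * (u \<bullet> u)" for t
    proof -
      have "w + t *\<^sub>R u \<in> M" using that \<open>w \<in> M\<close> M(2) by (simp add: subspace_add subspace_scale)
      then have "q w \<le> q (w + t *\<^sub>R u)" using d_le \<open>q w \<le> d + 0\<close> by fastforce
      then show ?thesis
        by (simp add: q_def \<phi>.add \<phi>.scale inner_add_left inner_add_right inner_commute
            power2_eq_square algebra_simps)
    qed
    define a where "a = u \<bullet> w - \<phi> u"
    have "a = 0"
    proof (rule ccontr)
      assume "a \<noteq> 0"
      \<comment> \<open>The step t = - a / c makes the linear term win over the quadratic one; the
        summand 1 keeps c positive when u = 0.\<close>
      define c where "c = u \<bullet> u + 1"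
      have "c > 0" "u \<bullet> u < c" by (auto simp: c_def add_nonneg_pos)
      have "0 \<le> 2 * (- a / c) * a + (- a / c)\<^sup>2 * (u \<bullet> u)" using quad[of "- a / c"] by (simp add: a_def)
      also have "\<dots> \<le> 2 * (- a / c) * a + (- a / c)\<^sup>2 * c"
        using \<open>u \<bullet> u < c\<close> by (intro add_left_mono mult_left_mono) auto
      also have "\<dots> = - (a\<^sup>2 / c)" using \<open>c > 0\<close> by (simp add: field_simps power2_eq_square)
      also have "\<dots> < 0" using \<open>a \<noteq> 0\<close> \<open>c > 0\<close> by simp
      finally show False by simp
    qed
    then show ?thesis by (simp add: a_def)
  qed
  with \<open>w \<in> M\<close> show ?thesis using that by blast
qed

text \<open>The core of the Riesz-Fischer theorem. The geometric rate makes the sequence itself,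
  rather than a subsequence, converge almost everywhere; this pointwise convergence later puts
  limits into the fibres.\<close>

lemma L2_Cauchy_limit:
  fixes F :: "nat \<Rightarrow> 'a \<Rightarrow> 'b::{banach, second_countable_topology}"
  assumes "finite_measure M" and F: "\<And>m. F m \<in> borel_measurable M"
    and fast: "\<And>m k. m \<le> k \<Longrightarrow> (\<integral>\<^sup>+x. ennreal ((norm (F k x - F m x))\<^sup>2) \<partial>M) \<le> ennreal ((1/4)^m)"
  obtains f where "f \<in> borel_measurable M" "AE x in M. (\<lambda>m. F m x) \<longlonglongrightarrow> f x"
    "\<And>m. (\<integral>\<^sup>+x. ennreal ((norm (f x - F m x))\<^sup>2) \<partial>M) \<le> ennreal ((1/4)^m)"
proof -
  interpret finite_measure M by fact
  define f where "f x = lim (\<lambda>m. F m x)" for x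
  have f: "f \<in> borel_measurable M" unfolding f_def by (intro borel_measurable_lim_metric F)
  define g where "g m x = norm (F (Suc m) x - F m x)" for m x
  \<comment> \<open>Trades the square-integral bound for a bound on the integral of g m: the factor
    2^m loses only half of the decay 4^-m, and the remainder 2^-m is summable against the finite
    total mass.\<close>
  have g_le: "ennreal (g m x) \<le> ennreal (2^m * (g m x)\<^sup>2) + ennreal ((1/2)^m)" for m x
  proof -
    have "0 \<le> (2^m * g m x - 1/2)\<^sup>2" by simp
    then have "2^m * g m x \<le> 2^m * (2^m * (g m x)\<^sup>2 + (1/2)^m)"
      by (simp add: power2_eq_square algebra_simps power_one_over)
    then have "g m x \<le> 2^m * (g m x)\<^sup>2 + (1/2)^m" by simp
    then show ?thesis by (simp add: ennreal_leI flip: ennreal_plus)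
  qed
  have "(\<integral>\<^sup>+x. ennreal (g m x) \<partial>M) \<le> ennreal ((1/2)^m) * (1 + emeasure M (space M))" for m
  proof -
    have [measurable]: "g m \<in> borel_measurable M" unfolding g_def using F by measurable
    have "(\<integral>\<^sup>+x. ennreal (g m x) \<partial>M) \<le>
        (\<integral>\<^sup>+x. ennreal (2^m * (g m x)\<^sup>2) + ennreal ((1/2)^m) \<partial>M)"
      by (intro nn_integral_mono g_le)
    also have "\<dots> = (\<integral>\<^sup>+x. ennreal (2^m) * ennreal ((g m x)\<^sup>2) \<partial>M) + ennreal ((1/2)^m) * emeasure M (space M)"
      by (subst nn_integral_add) (auto simp: ennreal_mult)
    also have "\<dots> \<le> ennreal ((1/2)^m) + ennreal ((1/2)^m) * emeasure M (space M)"
    proof (rule add_right_mono)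
      have "(\<integral>\<^sup>+x. ennreal (2^m) * ennreal ((g m x)\<^sup>2) \<partial>M) =
          ennreal (2^m) * (\<integral>\<^sup>+x. ennreal ((g m x)\<^sup>2) \<partial>M)"
        by (rule nn_integral_cmult) measurable
      also have "\<dots> \<le> ennreal (2^m) * ennreal ((1/4)^m)"
        unfolding g_def by (intro mult_left_mono fast) auto
      also have "\<dots> = ennreal ((1/2)^m)"
        by (simp add: ennreal_mult[symmetric] power_mult_distrib[symmetric])
      finally show "(\<integral>\<^sup>+x. ennreal (2^m) * ennreal ((g m x)\<^sup>2) \<partial>M) \<le> ennreal ((1/2)^m)" .
    qed
    finally show ?thesis by (simp add: semiring_class.distrib_left)
  qed
  moreover have "(\<Sum>m. ennreal ((1/2)^m) * (1 + emeasure M (space M))) < \<infinity>"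
  proof -
    have "(\<Sum>m. ennreal ((1/2)^m)) = ennreal (\<Sum>m. (1/2)^m)"
      by (rule suminf_ennreal2) auto
    then have "(\<Sum>m. ennreal ((1/2)^m)) < \<infinity>" by simp
    then show ?thesis
      by (simp add: ennreal_suminf_multc[symmetric] ennreal_mult_less_top emeasure_eq_measure)
  qed
  ultimately have "(\<Sum>m. \<integral>\<^sup>+x. ennreal (g m x) \<partial>M) < \<infinity>"
    by (meson le_less_trans suminf_le summableI)
  then have "(\<integral>\<^sup>+x. (\<Sum>m. ennreal (g m x)) \<partial>M) < \<infinity>"
    by (subst nn_integral_suminf) (use F in \<open>auto simp: g_def\<close>)
  then have "AE x in M. (\<Sum>m. ennreal (g m x)) \<noteq> \<infinity>"
    by (intro nn_integral_noteq_infinite) (use F in \<open>auto simp: g_def\<close>)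
  then have conv: "AE x in M. (\<lambda>m. F m x) \<longlonglongrightarrow> f x"
  proof eventually_elim
    case (elim x)
    have "summable (\<lambda>m. g m x)"
      using elim by (intro summable_suminf_not_top) (auto simp: g_def)
    then have "summable (\<lambda>m. F (Suc m) x - F m x)"
      unfolding g_def by (rule summable_norm_cancel)
    then have "convergent (\<lambda>n. \<Sum>m<n. F (Suc m) x - F m x)" by (simp add: summable_iff_convergent)
    then have "convergent (\<lambda>n. (F n x - F 0 x) + F 0 x)"
      unfolding sum_lessThan_telescope[of "\<lambda>n. F n x"] by (intro convergent_add convergent_const)
    then show ?case unfolding f_def by (simp add: convergent_LIMSEQ_iff)
  qed
  have "(\<integral>\<^sup>+x. ennreal ((norm (f x - F m x))\<^sup>2) \<partial>M) \<le> ennreal ((1/4)^m)" for m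
  proof -
    have "(\<integral>\<^sup>+x. ennreal ((norm (f x - F m x))\<^sup>2) \<partial>M) =
        (\<integral>\<^sup>+x. liminf (\<lambda>k. ennreal ((norm (F k x - F m x))\<^sup>2)) \<partial>M)"
    proof (rule nn_integral_cong_AE, use conv in eventually_elim)
      case (elim x)
      have "(\<lambda>k. ennreal ((norm (F k x - F m x))\<^sup>2)) \<longlonglongrightarrow> ennreal ((norm (f x - F m x))\<^sup>2)"
        by (intro tendsto_intros elim)
      then show ?case by (rule lim_imp_Liminf[OF trivial_limit_sequentially, symmetric])
    qed
    \<comment> \<open>Fatou's lemma in k, with m fixed.\<close>
    also have "\<dots> \<le> liminf (\<lambda>k. \<integral>\<^sup>+x. ennreal ((norm (F k x - F m x))\<^sup>2) \<partial>M)"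
      using F by (intro nn_integral_liminf) measurable
    also have "\<dots> \<le> liminf (\<lambda>k. ennreal ((1/4)^m))"
      by (intro Liminf_mono eventually_sequentiallyI[of m] fast)
    finally show ?thesis by (simp add: Liminf_const)
  qed
  with f conv show ?thesis using that by blast
qed

section \<open>Characters and measures on the Cantor group\<close>

definition bsgn :: "bit \<Rightarrow> real" where
  "bsgn b = (if b = 0 then 1 else - 1)"

text \<open>The character group of the Cantor group, indexed by lists instead of finite sets so that
  \<open>chi L\<close> and the operator word \<open>Sp L\<close> share one recursion; a repeated
  index cancels in both.\<close>

definition chi :: "nat list \<Rightarrow> cantor \<Rightarrow> real" where
  "chi L x = (\<Prod>k\<leftarrow>L. bsgn (x k))"

lemma chi_simps [simp]:
  "chi [] x = 1" "chi (k # L) x = bsgn (x k) * chi L x"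
  by (simp_all add: chi_def)

lemma bsgn_sq [simp]: "bsgn b * bsgn b = 1" and abs_bsgn [simp]: "\<bar>bsgn b\<bar> = 1"
  and bsgn_0 [simp]: "bsgn 0 = 1" and bsgn_1 [simp]: "bsgn 1 = -1"
  by (auto simp: bsgn_def)

lemma bsgn_left_sq [simp]: "bsgn b * (bsgn b * c) = c"
  by (auto simp: bsgn_def)

lemma bsgn_add: "bsgn (a + b) = bsgn a * bsgn b"
  by (cases a rule: bit.exhaust; cases b rule: bit.exhaust) (auto simp: bsgn_def)

lemma bsgn_ne: "a \<noteq> b \<Longrightarrow> bsgn a = - bsgn b"
  by (cases "a = 0"; cases "b = 0") auto

lemma chi_add: "chi L (x + y) = chi L x * chi L y"
  by (induction L) (auto simp: bsgn_add)

lemma abs_chi [simp]: "\<bar>chi L x\<bar> = 1"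
  by (induction L) (auto simp: abs_mult)

lemma chi_ones: "chi L (\<lambda>_. 1) = (- 1) ^ length L"
  by (induction L) auto

lemma chi_check: "chi L (check x) = (- 1) ^ length L * chi L x"
  by (simp add: check_def chi_add chi_ones)

lemma bsgn_measurable [measurable]: "bsgn \<in> borel_measurable borel"
  by (intro borel_measurable_continuous_onI) simp

lemma coord_borel: "(\<lambda>x :: cantor. x k) \<in> borel_measurable borel"
  by (intro borel_measurable_continuous_onI) simp

lemma chi_borel [measurable]: "chi L \<in> borel_measurable borel"
proof (induction L)
  case (Cons k L)
  have "(\<lambda>x. bsgn (x k) * chi L x) \<in> borel_measurable borel"
    by (intro borel_measurable_times Cons measurable_compose[OF coord_borel bsgn_measurable])
  then show ?case by (simp add: chi_simps[abs_def])
qed (simp add: chi_def)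

lemma cantor_measurableI:
  assumes "\<And>k. (\<lambda>x. f x k) \<in> borel_measurable M"
  shows "(f :: 'a \<Rightarrow> cantor) \<in> borel_measurable M"
proof -
  have "f \<in> measurable M (Pi\<^sub>M UNIV (\<lambda>_. borel))"
    by (rule measurable_PiM_single') (use assms in auto)
  then show ?thesis
    by (simp only: measurable_cong_sets[OF HOL.refl sets_PiM_equal_borel])
qed

lemma translate_borel: "(\<lambda>x :: cantor. x + d) \<in> borel_measurable borel"
proof (rule cantor_measurableI)
  fix k
  have "(\<lambda>b. b + d k) \<in> borel_measurable borel"
    by (rule borel_measurable_continuous_onI) (rule Topological_Spaces.continuous_on_discrete)
  from measurable_compose[OF coord_borel[of k] this]
  show "(\<lambda>x :: cantor. (x + d) k) \<in> borel_measurable borel"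
    by (simp only: plus_fun_apply)
qed

lemma check_borel [measurable]: "check \<in> borel_measurable borel"
  unfolding check_def[abs_def] by (rule translate_borel)

section \<open>Cylinder sets as generators of the Borel sets\<close>

definition cylinder :: "nat \<Rightarrow> cantor \<Rightarrow> cantor set" where
  "cylinder N y = {x. \<forall>i<N. x i = y i}"

lemma cylinder_0 [simp]: "cylinder 0 y = UNIV"
  by (auto simp: cylinder_def)

lemma cylinder_Suc: "cylinder (Suc N) y = cylinder N y \<inter> {x. x N = y N}"
  by (auto simp: cylinder_def less_Suc_eq)

lemma cylinder_cong: "(\<And>i. i < N \<Longrightarrow> y i = z i) \<Longrightarrow> cylinder N y = cylinder N z"
  by (auto simp: cylinder_def)

lemma cylinder_inter:
  "cylinder N y \<inter> cylinder M z = {} \<or> (\<exists>L u. cylinder N y \<inter> cylinder M z = cylinder L u)"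
proof (cases "cylinder N y \<inter> cylinder M z = {}")
  case False
  then obtain x where "x \<in> cylinder N y" "x \<in> cylinder M z" by blast
  then have "cylinder N y \<inter> cylinder M z = cylinder (max N M) x"
    by (intro set_eqI) (simp add: cylinder_def less_max_iff_disj, metis)
  then show ?thesis by blast
qed auto

text \<open>The empty set is included because disjoint cylinders would otherwise break stability
  under intersection.\<close>

definition cylinders :: "cantor set set" where
  "cylinders = insert {} {cylinder N y | N y. True}"

lemma Int_stable_cylinders: "Int_stable cylinders"
proof (rule Int_stableI)
  fix a b assume ab: "a \<in> cylinders" "b \<in> cylinders"
  show "a \<inter> b \<in> cylinders"
  proof (cases "a \<inter> b = {}")
    case False
    then obtain N y M z where "a = cylinder N y" "b = cylinder M z"
      using ab unfolding cylinders_def by auto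
    then show ?thesis
      using cylinder_inter[of N y M z] False unfolding cylinders_def by auto
  qed (simp add: cylinders_def)
qed

lemma cylinder_measurable [measurable]: "cylinder N y \<in> sets borel"
proof (induction N)
  case (Suc N)
  have "{x :: cantor. x N = y N} = (\<lambda>x. x N) -` {y N} \<inter> space borel" by auto
  also have "\<dots> \<in> sets borel"
    by (rule measurable_sets[OF coord_borel]) simp
  finally show ?case using Suc by (simp add: cylinder_Suc)
qed simp

lemma range_cylinder_countable: "countable (range (cylinder N))"
proof (induction N)
  case (Suc N)
  have "range (cylinder (Suc N)) \<subseteq> (\<lambda>(A, b). A \<inter> {x. x N = b}) ` (range (cylinder N) \<times> {0, 1})"
  proof
    fix A assume "A \<in> range (cylinder (Suc N))"
    then obtain y where "A = (\<lambda>(A, b). A \<inter> {x. x N = b}) (cylinder N y, y N)"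
      by (auto simp: cylinder_Suc)
    moreover have "y N \<in> {0, 1}" by (cases "y N = 0") auto
    ultimately show "A \<in> (\<lambda>(A, b). A \<inter> {x. x N = b}) ` (range (cylinder N) \<times> {0, 1})"
      by blast
  qed
  then show ?case by (rule countable_subset) (use Suc in auto)
qed (simp add: image_constant_conv)

lemma sets_borel_cylinders: "sets (borel :: cantor measure) = sigma_sets UNIV cylinders"
proof
  show "sigma_sets UNIV cylinders \<subseteq> sets (borel :: cantor measure)"
  proof
    fix A assume "A \<in> sigma_sets UNIV cylinders"
    then show "A \<in> sets (borel :: cantor measure)"
      by (induction) (auto simp: cylinders_def)
  qed
  define S where "S = sigma UNIV cylinders"
  have sets_S: "sets S = sigma_sets UNIV cylinders" and space_S: "space S = UNIV"
    by (auto simp: S_def)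
  have "(\<lambda>x. x) \<in> borel_measurable S"
  proof (rule cantor_measurableI)
    fix k
    have single: "{x. x k = b} \<in> sets S" for b
    proof -
      have "{x. x k = b} = \<Union> (range (cylinder (Suc k)) \<inter> {A. A \<subseteq> {x. x k = b}})"
        by (auto simp: cylinder_def)
      also have "\<dots> \<in> sets S"
        by (rule sets.countable_Union) (auto simp: sets_S cylinders_def intro!: countable_Int1 range_cylinder_countable)
      finally show ?thesis .
    qed
    show "(\<lambda>x. x k) \<in> borel_measurable S"
    proof (rule borel_measurableI)
      fix B :: "bit set"
      have "(\<lambda>x :: cantor. x k) -` B \<inter> space S = (\<Union>b\<in>{0,1} \<inter> B. {x. x k = b})"
      proof -
        have "b \<in> {0, 1}" for b :: bit by (cases "b = 0") auto
        then show ?thesis by (auto simp: space_S)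
      qed
      also have "\<dots> \<in> sets S" using single by (intro sets.finite_UN) auto
      finally show "(\<lambda>x :: cantor. x k) -` B \<inter> space S \<in> sets S" .
    qed
  qed
  then have "A \<in> sets S" if "A \<in> sets (borel :: cantor measure)" for A
    using measurable_sets[OF _ that, of "\<lambda>x. x" S] by (simp add: space_S)
  then show "sets (borel :: cantor measure) \<subseteq> sigma_sets UNIV cylinders"
    by (auto simp: sets_S)
qed

lemma integrable_chi:
  assumes "finite_measure M" "sets M = sets borel"
  shows "integrable M (\<lambda>x. chi L x)"
proof -
  interpret finite_measure M by fact
  show ?thesis
  proof (rule integrable_const_bound[where B = 1])
    show "(\<lambda>x. chi L x) \<in> borel_measurable M"
      using chi_borel by (simp only: measurable_cong_sets[OF assms(2) HOL.refl])
  qed simp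
qed

lemma measure_eq_on_cylinders:
  assumes M: "finite_measure M" "sets M = sets borel" and N: "finite_measure N" "sets N = sets borel"
    and eq: "\<And>n y. emeasure M (cylinder n y) = emeasure N (cylinder n y)"
  shows "M = N"
proof (rule measure_eqI_generator_eq[OF Int_stable_cylinders, where A = "\<lambda>_. UNIV" and \<Omega> = UNIV])
  show "emeasure M A = emeasure N A" if A: "A \<in> cylinders" for A
  proof (cases "A = {}")
    case False
    then obtain n y where "A = cylinder n y" using A unfolding cylinders_def by blast
    then show ?thesis by (simp only: eq)
  qed simp
  have "cylinder 0 (\<lambda>_. 0) \<in> cylinders" unfolding cylinders_def by blast
  then show "range (\<lambda>_ :: nat. UNIV) \<subseteq> cylinders" by auto
  show "emeasure M UNIV \<noteq> \<infinity>"
    using finite_measure.emeasure_finite[OF M(1), of UNIV] by (simp only: infinity_ennreal_def not_False_eq_True)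
  show "cylinders \<subseteq> Pow UNIV" by (rule subset_Pow_Union[THEN subset_trans]) simp
  show "(\<Union>i :: nat. UNIV) = (UNIV :: cantor set)" by simp
  show "sets M = sigma_sets UNIV cylinders" by (rule HOL.trans[OF M(2) sets_borel_cylinders])
  show "sets N = sigma_sets UNIV cylinders" by (rule HOL.trans[OF N(2) sets_borel_cylinders])
qed

text \<open>The indicator of the event that x n = y n is (1 + \<open>bsgn (y n)\<close>
  \<open>bsgn (x n)\<close>) / 2, so the indicator of a cylinder is a finite linear combination of
  characters.\<close>

theorem measure_eq_of_characters:
  assumes M: "finite_measure M" "sets M = sets borel" and N: "finite_measure N" "sets N = sets borel"
    and eq: "\<And>L. (\<integral>x. chi L x \<partial>M) = (\<integral>x. chi L x \<partial>N)"
  shows "M = N"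
proof (rule measure_eq_on_cylinders[OF M N])
  fix n and y :: cantor
  \<comment> \<open>The extra factor \<open>chi L\<close> is there for the induction: resolving
    coordinate n replaces L by n # L in one of the two terms.\<close>
  have 1: "(\<integral>x. indicator (cylinder n y) x * chi L x \<partial>M) =
      (\<integral>x. indicator (cylinder n y) x * chi L x \<partial>N)" for L
  proof (induction n arbitrary: L)
    case (Suc n)
    have ind: "indicator (cylinder (Suc n) y) x * chi L x =
        1/2 * (indicator (cylinder n y) x * chi L x) +
        bsgn (y n) / 2 * (indicator (cylinder n y) x * chi (n # L) x)" for x
      using bsgn_ne[of "x n" "y n"] by (cases "x n = y n") (auto simp: cylinder_Suc indicator_def)
    have int: "integrable P (\<lambda>x. indicator (cylinder n y) x * chi L x)"
      if "finite_measure P" "sets P = sets borel" for P L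
      using integrable_mult_indicator[of "cylinder n y" P "chi L"] integrable_chi[OF that, of L] that
      by simp
    note split = Bochner_Integration.integral_add[OF integrable_mult_right integrable_mult_right]
    show ?case
      unfolding ind split[OF int[OF M] int[OF M]] split[OF int[OF N] int[OF N]]
        integral_mult_right_zero Suc by (rule HOL.refl)
  qed (use eq in simp)
  interpret M: finite_measure M by fact
  interpret N: finite_measure N by fact
  have "measure M (cylinder n y) = measure N (cylinder n y)"
    using 1[of "[]"] M(2) N(2) by simp
  then show "emeasure M (cylinder n y) = emeasure N (cylinder n y)"
    by (simp add: M.emeasure_eq_measure N.emeasure_eq_measure)
qed

section \<open>Spectral measures of commuting involutions\<close>

text \<open>
  The measure is the image of Lebesgue measure on \<open>[0, p 0)\<close> under the map that assigns to each cylinder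
  an interval and splits it in proportion to the weights of the two halves of the cylinder.
\<close>

lemma cantor_measure_exists:
  fixes p :: "nat \<Rightarrow> cantor \<Rightarrow> real"
  assumes nn: "\<And>N y. 0 \<le> p N y"
    and split: "\<And>N y. p N y = p (Suc N) (y(N := 0)) + p (Suc N) (y(N := 1))"
    and cong: "\<And>N y z. (\<And>i. i < N \<Longrightarrow> y i = z i) \<Longrightarrow> p N y = p N z"
  obtains m where "finite_measure m" "sets m = sets borel"
    "\<And>N y. emeasure m (cylinder N y) = ennreal (p N y)"
proof -
  \<comment> \<open>\<open>l N y\<close> is the left endpoint of the interval assigned to
    \<open>cylinder N y\<close>: the total weight of the cylinders of the same length that precede
    it lexicographically.\<close>
  define l where "l N y = (\<Sum>i<N. if y i = 0 then 0 else p (Suc i) (y(i := 0)))" for N and y :: cantor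
  have l_0 [simp]: "l 0 y = 0" for y by (simp add: l_def)
  have l_Suc: "l (Suc N) y = l N y + (if y N = 0 then 0 else p (Suc N) (y(N := 0)))" for N y
    by (simp add: l_def)
  have l_cong: "l N y = l N z" if yz: "\<And>i. i < N \<Longrightarrow> y i = z i" for N y z
  proof -
    have "p (Suc i) (y(i := 0)) = p (Suc i) (z(i := 0))" if "i < N" for i
      by (rule cong) (use yz that in auto)
    then show ?thesis unfolding l_def by (intro sum.cong) (auto simp: yz)
  qed
  define p0 where "p0 = p 0 (\<lambda>_. 0)"
  have p0: "p 0 y = p0" for y unfolding p0_def by (rule cong) simp
  have bounds: "0 \<le> l N y \<and> l N y + p N y \<le> p0" for N y
  proof (induction N)
    case (Suc N)
    have y: "y N = 0 \<Longrightarrow> y(N := 0) = y" "y N = 1 \<Longrightarrow> y(N := 1) = y" by auto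
    show ?case
      using Suc split[of N y] nn[of "Suc N" "y(N := 0)"] nn[of "Suc N" "y(N := 1)"] y
      by (cases "y N = 0") (auto simp: l_Suc)
  qed (simp add: p0)
  \<comment> \<open>\<open>pre t N\<close> holds the first N digits of the code of t, followed by
    zeros. Digit N is 0 exactly when t falls into the left one of the two subintervals.\<close>
  define pre where "pre t = rec_nat (\<lambda>_. 0)
    (\<lambda>N y. y(N := if t < l N y + p (Suc N) (y(N := 0)) then 0 else 1 :: bit))" for t
  have pre_Suc: "pre t (Suc N) = (pre t N)
      (N := if t < l N (pre t N) + p (Suc N) ((pre t N)(N := 0)) then 0 else 1)" for t N
    by (simp add: pre_def)
  define X where "X t i = pre t (Suc i) i" for t i
  have pre_X: "pre t N i = X t i" if "i < N" for t N i
    using that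
  proof (induction N)
    case (Suc N)
    show ?case
    proof (cases "i = N")
      case False
      then have "pre t (Suc N) i = pre t N i" by (simp add: pre_Suc)
      then show ?thesis using Suc False by simp
    qed (simp add: X_def)
  qed simp
  \<comment> \<open>The recursion passes from the truncations to the full sequence
    \<open>X t\<close> because l and p at level N depend only on coordinates below N.\<close>
  have X_rec: "X t N = (if t < l N (X t) + p (Suc N) ((X t)(N := 0)) then 0 else 1)" for t N
  proof -
    have "l N (pre t N) = l N (X t)" by (rule l_cong) (rule pre_X)
    moreover have "p (Suc N) ((pre t N)(N := 0)) = p (Suc N) ((X t)(N := 0))"
      by (rule cong) (auto simp: pre_X)
    ultimately show ?thesis by (simp add: X_def[of t N] pre_Suc)
  qed
  have X_cyl: "X t \<in> cylinder N y \<longleftrightarrow> l N y \<le> t \<and> t < l N y + p N y" if t: "0 \<le> t" "t < p0" for t N y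
  proof (induction N)
    case (Suc N)
    define q where "q = p (Suc N) (y(N := 0))"
    show ?case
    proof (cases "X t \<in> cylinder N y")
      case True
      then have eq: "X t i = y i" if "i < N" for i using that by (simp add: cylinder_def)
      have "l N (X t) = l N y" by (rule l_cong) (rule eq)
      moreover have "p (Suc N) ((X t)(N := 0)) = q" unfolding q_def by (rule cong) (auto simp: eq)
      ultimately have XN: "X t N = (if t < l N y + q then 0 else 1)" using X_rec[of t N] by simp
      show ?thesis
      proof (cases "y N = 0")
        case yN: True
        then have "y(N := 0) = y" by auto
        then show ?thesis using True XN yN Suc by (simp add: cylinder_Suc l_Suc q_def)
      next
        case False
        then have "y(N := 1) = y" by auto
        then show ?thesis using True XN False Suc split[of N y]
          by (auto simp: cylinder_Suc l_Suc q_def)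
      qed
    next
      case False
      have y: "y N = 0 \<Longrightarrow> y(N := 0) = y" "y N \<noteq> 0 \<Longrightarrow> y(N := 1) = y" by auto
      show ?thesis
        using False Suc split[of N y] nn[of "Suc N" "y(N := 0)"] nn[of "Suc N" "y(N := 1)"] y
        by (cases "y N = 0") (auto simp: cylinder_Suc l_Suc)
    qed
  qed (use t p0 in simp)
  define I where "I = restrict_space lborel {0..<p0}"
  have space_I: "space I = {0..<p0}" by (simp add: I_def space_restrict_space)
  have vim: "X -` cylinder N y \<inter> space I = {l N y..<l N y + p N y}" for N y
    using bounds[of N y] by (auto simp: space_I X_cyl)
  have sets_I: "{l N y..<l N y + p N y} \<in> sets I" for N y
    using bounds[of N y] by (auto simp: I_def sets_restrict_space_iff)
  have X: "X \<in> measurable I borel"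
  proof (rule measurable_sigma_sets[OF sets_borel_cylinders])
    show "X -` A \<inter> space I \<in> sets I" if "A \<in> cylinders" for A
      using that vim sets_I unfolding cylinders_def by auto
  qed auto
  define m where "m = distr I borel X"
  have em: "emeasure m (cylinder N y) = ennreal (p N y)" for N y
  proof -
    have "emeasure m (cylinder N y) = emeasure I {l N y..<l N y + p N y}"
      using X by (simp add: m_def emeasure_distr vim)
    also have "\<dots> = emeasure lborel {l N y..<l N y + p N y}"
      unfolding I_def using bounds[of N y] by (intro emeasure_restrict_space) auto
    finally show ?thesis using nn[of N y] by simp
  qed
  show ?thesis
  proof (rule that[OF _ _ em])
    show "sets m = sets borel" by (simp add: m_def)
    have "space m = cylinder 0 (\<lambda>_. 0)" by (simp add: m_def)
    then have "emeasure m (space m) = ennreal (p 0 (\<lambda>_. 0))" by (simp only: em)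
    then show "finite_measure m" by (intro finite_measureI) simp
  qed
qed

locale involutions =
  fixes S :: "nat \<Rightarrow> 'v::real_inner \<Rightarrow> 'v"
  assumes S_linear: "\<And>k. linear (S k)"
    and S_norm: "\<And>k v. norm (S k v) = norm v"
    and S_S [simp]: "\<And>k v. S k (S k v) = v"
    and S_commute: "\<And>j k v. S j (S k v) = S k (S j v)"
begin

lemma S_add: "S k (v + w) = S k v + S k w" and S_diff: "S k (v - w) = S k v - S k w"
  and S_scaleR: "S k (r *\<^sub>R v) = r *\<^sub>R S k v" and S_zero [simp]: "S k 0 = 0"
  using S_linear[of k] by (auto simp: linear_add linear_diff linear_scale linear_0)

lemma S_selfadjoint: "S k v \<bullet> w = v \<bullet> S k w"
proof -
  have iso: "S k a \<bullet> S k b = a \<bullet> b" for a b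
    using S_norm[of k "a + b"] S_norm[of k a] S_norm[of k b]
    by (simp add: dot_norm S_add[symmetric])
  show ?thesis using iso[of "v" "S k w"] by simp
qed

definition Sp :: "nat list \<Rightarrow> 'v \<Rightarrow> 'v" where
  "Sp L v = foldr S L v"

lemma Sp_simps [simp]: "Sp [] v = v" "Sp (k # L) v = S k (Sp L v)"
  by (simp_all add: Sp_def)

lemma Sp_add: "Sp L (v + w) = Sp L v + Sp L w" and Sp_diff: "Sp L (v - w) = Sp L v - Sp L w"
  and Sp_scaleR: "Sp L (r *\<^sub>R v) = r *\<^sub>R Sp L v"
  by (induction L) (auto simp: S_add S_diff S_scaleR)

lemma S_Sp: "S k (Sp L v) = Sp L (S k v)"
  by (induction L) (auto simp: S_commute[of k])

lemma Sp_selfadjoint: "Sp L v \<bullet> w = v \<bullet> Sp L w"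
  by (induction L arbitrary: v w) (auto simp: S_selfadjoint S_Sp)

lemma Sp_Sp [simp]: "Sp L (Sp L v) = v"
  by (induction L) (auto simp: S_Sp[symmetric])

lemma Sp_norm [simp]: "norm (Sp L v) = norm v"
  by (induction L) (auto simp: S_norm)

text \<open>The product of (I + \<open>bsgn (y i)\<close> S_i) / 2 over i < N: the projection onto
  the joint eigenspace on which each such S_i is \<open>bsgn (y i)\<close>. It plays the role of the
  spectral projection of \<open>cylinder N y\<close>.\<close>

fun cproj :: "nat \<Rightarrow> cantor \<Rightarrow> 'v \<Rightarrow> 'v" where
  "cproj 0 y v = v"
| "cproj (Suc N) y v = (1/2) *\<^sub>R (cproj N y v + bsgn (y N) *\<^sub>R S N (cproj N y v))"

lemma cproj_cong: "(\<And>i. i < N \<Longrightarrow> y i = z i) \<Longrightarrow> cproj N y v = cproj N z v"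
  by (induction N) auto

lemma S_cproj: "k < N \<Longrightarrow> S k (cproj N y v) = bsgn (y k) *\<^sub>R cproj N y v"
proof (induction N)
  case (Suc N)
  show ?case
  proof (cases "k = N")
    case True
    then show ?thesis by (simp add: S_add S_scaleR algebra_simps)
  next
    case False
    then have "S k (cproj N y v) = bsgn (y k) *\<^sub>R cproj N y v" using Suc by simp
    then show ?thesis
      by (simp add: S_add S_scaleR S_commute[of k N] algebra_simps)
  qed
qed simp

lemma Sp_cproj: "(\<And>k. k \<in> set L \<Longrightarrow> k < N) \<Longrightarrow> Sp L (cproj N y v) = chi L y *\<^sub>R cproj N y v"
  by (induction L) (auto simp: S_scaleR S_cproj)

lemma cproj_split: "cproj N y v = cproj (Suc N) (y(N := 0)) v + cproj (Suc N) (y(N := 1)) v"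
proof -
  have "cproj N (y(N := b)) v = cproj N y v" for b by (rule cproj_cong) auto
  then show ?thesis by (simp add: algebra_simps scaleR_half_double flip: scaleR_add_left)
qed

text \<open>The two halves are eigenvectors of \<open>S N\<close> for opposite eigenvalues and
  \<open>Sp L\<close> commutes with \<open>S N\<close>, so the cross terms vanish.\<close>

lemma cproj_split_inner:
  "Sp L (cproj N y v) \<bullet> cproj N y v =
    Sp L (cproj (Suc N) (y(N := 0)) v) \<bullet> cproj (Suc N) (y(N := 0)) v +
    Sp L (cproj (Suc N) (y(N := 1)) v) \<bullet> cproj (Suc N) (y(N := 1)) v"
proof -
  define a where "a = cproj (Suc N) (y(N := 0)) v"
  define b where "b = cproj (Suc N) (y(N := 1)) v"
  have a: "S N a = a" and b: "S N b = - b"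
    unfolding a_def b_def using S_cproj[of N "Suc N" _ v] by (simp_all del: cproj.simps)
  have "Sp L a \<bullet> b = S N (Sp L a) \<bullet> S N b"
    by (simp add: S_selfadjoint)
  also have "\<dots> = - (Sp L a \<bullet> b)" by (simp add: S_Sp a b)
  finally have ab: "Sp L a \<bullet> b = 0" by simp
  then have "Sp L b \<bullet> a = 0" by (metis Sp_selfadjoint inner_commute)
  with ab show ?thesis unfolding cproj_split[of N y v] a_def[symmetric] b_def[symmetric]
    by (simp add: Sp_add inner_add_left inner_add_right)
qed

text \<open>A cylinder gets as mass the squared norm of the projection of v that belongs to it;
  additivity under splitting is \<open>cproj_split_inner\<close> for the empty word.\<close>

theorem spectral_measure:
  obtains m where "finite_measure m" "sets m = sets borel"
    "\<And>L. (\<integral>x. chi L x \<partial>m) = Sp L v \<bullet> v"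
proof -
  obtain m where m: "finite_measure m" "sets m = sets borel"
    and cyl: "\<And>N y. emeasure m (cylinder N y) = ennreal (cproj N y v \<bullet> cproj N y v)"
  proof (rule cantor_measure_exists[of "\<lambda>N y. cproj N y v \<bullet> cproj N y v"])
    show "cproj N y v \<bullet> cproj N y v = cproj (Suc N) (y(N := 0)) v \<bullet> cproj (Suc N) (y(N := 0)) v +
        cproj (Suc N) (y(N := 1)) v \<bullet> cproj (Suc N) (y(N := 1)) v" for N y
      using cproj_split_inner[of "[]" N y v] by (simp del: cproj.simps)
    show "cproj N y v \<bullet> cproj N y v = cproj N z v \<bullet> cproj N z v" if "\<And>i. i < N \<Longrightarrow> y i = z i" for N y z
      using cproj_cong[of N y z v] that by simp
  qed auto
  interpret m: finite_measure m by fact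
  have space_m: "space m = UNIV" using sets_eq_imp_space_eq[OF m(2)] by simp
  have int: "integrable m (\<lambda>x. indicator (cylinder N y) x * chi L x)" for N y L
    using integrable_mult_indicator[of "cylinder N y" m "chi L"] integrable_chi[OF m, of L] m(2)
    by simp
  have "(\<integral>x. chi L x \<partial>m) = Sp L v \<bullet> v" for L
  proof -
    obtain M where M: "\<And>k. k \<in> set L \<Longrightarrow> k < M"
      using finite_nat_set_iff_bounded[of "set L"] by auto
    \<comment> \<open>Downward induction from a level M beyond all indices in L: there
      \<open>chi L\<close> is constant on each cylinder and \<open>Sp L\<close> acts on the
      projected vector as that constant. Each step down adds two halves.\<close>
    have "(\<integral>x. indicator (cylinder N y) x * chi L x \<partial>m) = Sp L (cproj N y v) \<bullet> cproj N y v"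
      if "N \<le> M" for N y
      using that
    proof (induction arbitrary: y rule: inc_induct)
      case base
      have "(\<integral>x. indicator (cylinder M y) x * chi L x \<partial>m) =
          (\<integral>x. indicator (cylinder M y) x * chi L y \<partial>m)"
      proof (rule Bochner_Integration.integral_cong[OF HOL.refl])
        fix x
        have "chi L x = chi L y" if "x \<in> cylinder M y"
          unfolding chi_def using that M by (intro arg_cong[of _ _ prod_list] map_cong) (auto simp: cylinder_def)
        then show "indicator (cylinder M y) x * chi L x =
            (indicator (cylinder M y) x * chi L y :: real)" by (simp add: indicator_def)
      qed
      also have "\<dots> = measure m (cylinder M y) * chi L y" using m(2) by simp
      also have "measure m (cylinder M y) = cproj M y v \<bullet> cproj M y v"
        using cyl[of M y] by (simp add: measure_def)
      finally show ?case using Sp_cproj[of L M y v] M by simp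
    next
      case (step N)
      have ind: "indicator (cylinder N y) x * chi L x =
          indicator (cylinder (Suc N) (y(N := 0))) x * chi L x +
          indicator (cylinder (Suc N) (y(N := 1))) x * chi L x" for x
      proof -
        have "cylinder N (y(N := b)) = cylinder N y" for b by (rule cylinder_cong) simp
        then show ?thesis by (cases "x N = 0") (auto simp: cylinder_Suc indicator_def)
      qed
      show ?case
        unfolding ind Bochner_Integration.integral_add[OF int int] step.IH cproj_split_inner[of L N y] ..
    qed
    from this[of 0 "\<lambda>_. 0"] show ?thesis by simp
  qed
  with m show ?thesis using that by blast
qed

end

section \<open>Cyclic decomposition\<close>

lemma isometry_bounded_linear:
  fixes F :: "'a::real_normed_vector \<Rightarrow> 'b::real_normed_vector"
  assumes "linear F" "\<And>v. norm (F v) = norm v"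
  shows "bounded_linear F"
  using assms by (intro bounded_linear.intro bounded_linear_axioms.intro exI[of _ 1]) auto

lemma isometry_inner:
  fixes F :: "'a::real_inner \<Rightarrow> 'b::real_inner"
  assumes "linear F" "\<And>v. norm (F v) = norm v"
  shows "F v \<bullet> F w = v \<bullet> w"
  using assms(2)[of "v + w"] assms(2)[of v] assms(2)[of w]
  by (simp add: dot_norm linear_add[OF assms(1), symmetric])

section \<open>Multiplication by i as a skew isometry of the real inner product\<close>

abbreviation Jc :: "'v::complex_inner \<Rightarrow> 'v" where
  "Jc v \<equiv> \<i> *\<^sub>C v"

lemma scaleC_minus_one: "(- 1) *\<^sub>C v = - (v :: 'v::complex_inner)"
  using scaleR_scaleC[of "-1" v] by simp

lemma Jc_Jc [simp]: "Jc (Jc v) = - (v :: 'v::complex_inner)"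
  by (simp add: scaleC_scaleC scaleC_minus_one)

lemma Jc_linear: "linear (Jc :: 'v::complex_inner \<Rightarrow> 'v)"
  by (rule linearI) (simp_all add: scaleC_add_right scaleR_scaleC scaleC_scaleC mult.commute)

lemma scaleC_Re_Im: "z *\<^sub>C v = Re z *\<^sub>R v + Im z *\<^sub>R Jc (v :: 'v::complex_inner)"
proof -
  have "z *\<^sub>C v = (complex_of_real (Re z) + complex_of_real (Im z) * \<i>) *\<^sub>C v"
    by (metis complex_eq mult.commute)
  then show ?thesis by (simp add: scaleC_add_left scaleR_scaleC scaleC_scaleC)
qed

lemma norm_Jc [simp]: "norm (Jc v) = norm (v :: 'v::complex_inner)"
proof -
  have "cinner (Jc v) (Jc v) = \<i> * cnj (\<i> * cinner v v)"
    by (metis cinner_commute cinner_scaleC_left)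
  also have "\<dots> = cnj (cinner v v)" by (simp add: complex_eq_iff)
  finally have "inner (Jc v) (Jc v) = inner v v" by (simp add: inner_eq_Re_cinner)
  then show ?thesis by (simp add: norm_eq_sqrt_inner)
qed

lemma Jc_skew: "Jc v \<bullet> w = - (v \<bullet> Jc (w :: 'v::complex_inner))"
  using isometry_inner[OF Jc_linear norm_Jc, of v "Jc w"] by simp

lemma cinner_real: "cinner v w = Complex (v \<bullet> w) (v \<bullet> Jc (w :: 'v::complex_inner))"
proof -
  have "cinner v (Jc w) = - \<i> * cinner v w"
    using cinner_commute[of v "Jc w"] cinner_commute[of w v] by (simp add: cinner_scaleC_left)
  then show ?thesis by (simp add: inner_eq_Re_cinner complex_eq_iff)
qed

locale conjugate_system = involutions S
  for S :: "nat \<Rightarrow> 'v::{complex_inner, complete_space} \<Rightarrow> 'v" +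
  fixes K :: "'v \<Rightarrow> 'v"
  assumes S_Jc: "\<And>k v. S k (Jc v) = Jc (S k v)"
    and K_linear: "linear K"
    and K_norm: "\<And>v. norm (K v) = norm v"
    and K_K [simp]: "\<And>v. K (K v) = v"
    and K_Jc: "\<And>v. K (Jc v) = - Jc (K v)"
    and K_S: "\<And>k v. K (S k v) = - S k (K v)"
    and separable: "\<exists>D :: 'v set. countable D \<and> closure D = UNIV"
begin

lemma K_add: "K (v + w) = K v + K w" and K_diff: "K (v - w) = K v - K w"
  and K_scaleR: "K (r *\<^sub>R v) = r *\<^sub>R K v" and K_minus: "K (- v) = - K v"
  using K_linear by (auto simp: linear_add linear_diff linear_scale linear_neg)

lemmas K_inner = isometry_inner[OF K_linear K_norm]

lemma Sp_Jc: "Sp L (Jc v) = Jc (Sp L v)"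
  by (induction L) (auto simp: S_Jc)

lemma K_Sp: "K (Sp L v) = (-1) ^ length L *\<^sub>R Sp L (K v)"
  by (induction L) (auto simp: K_S S_scaleR)

definition inv_subspace :: "'v set \<Rightarrow> bool" where
  "inv_subspace M \<longleftrightarrow> closed M \<and> subspace M \<and> (\<forall>v\<in>M. Jc v \<in> M) \<and> (\<forall>k. \<forall>v\<in>M. S k v \<in> M)"

lemma inv_subspace_hull: "inv_subspace (inv_subspace hull X)"
  by (rule hull_in) (auto simp: inv_subspace_def intro!: closed_Inter subspace_Inter)

lemma inv_subspace_Sp: "inv_subspace M \<Longrightarrow> v \<in> M \<Longrightarrow> Sp L v \<in> M"
  by (induction L) (auto simp: inv_subspace_def)

text \<open>Invariance under K is not built into \<open>inv_subspace\<close>. It comes from the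
  generators: the preimage of the hull under K is again an invariant subspace, as K only produces
  signs, and it contains X when K fixes X.\<close>

lemma hull_K_invariant:
  assumes X: "\<And>x. x \<in> X \<Longrightarrow> K x = x" and v: "v \<in> inv_subspace hull X"
  shows "K v \<in> inv_subspace hull X"
proof -
  have "inv_subspace (K -` (inv_subspace hull X))"
    using inv_subspace_hull[of X] isometry_bounded_linear[OF K_linear K_norm]
    unfolding inv_subspace_def
    by (auto simp: subspace_def K_add K_scaleR K_Jc K_S linear_0[OF K_linear] subspace_neg
        intro!: continuous_closed_vimage linear_continuous_at)
  moreover have "X \<subseteq> K -` (inv_subspace hull X)" using X hull_subset[of X] by auto
  ultimately show ?thesis using hull_minimal[of X "K -` (inv_subspace hull X)" inv_subspace] v by blast
qed

text \<open>Every v is (a - i b) / 2 with the K-fixed vectors a = v + K v and b = i v + K (i v).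
  Even and odd indices of d list these two parts along a dense sequence.\<close>

lemma real_generators:
  obtains d :: "nat \<Rightarrow> 'v" where "\<And>n. K (d n) = d n" "inv_subspace hull (range d) = UNIV"
proof -
  obtain D :: "'v set" where D: "countable D" "closure D = UNIV" using separable by blast
  then have "D \<noteq> {}" by auto
  define s where "s = from_nat_into D"
  have s: "range s = D" unfolding s_def using D(1) \<open>D \<noteq> {}\<close> by (rule range_from_nat_into[rotated])
  define d where "d n = (if even n then s (n div 2) + K (s (n div 2))
    else Jc (s (n div 2)) + K (Jc (s (n div 2))))" for n
  have "K (d n) = d n" for n by (simp add: d_def K_add add.commute)
  moreover have "inv_subspace hull (range d) = UNIV"
  proof -
    let ?M = "inv_subspace hull (range d)"
    have M: "subspace ?M" "closed ?M" "\<And>v. v \<in> ?M \<Longrightarrow> Jc v \<in> ?M"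
      using inv_subspace_hull[of "range d"] by (auto simp: inv_subspace_def)
    have "s n \<in> ?M" for n
    proof -
      have d: "d (2 * n) \<in> ?M" "d (2 * n + 1) \<in> ?M" using hull_subset[of "range d" inv_subspace] by auto
      have "s n = (1/2) *\<^sub>R (d (2 * n) - Jc (d (2 * n + 1)))"
      proof -
        have "(2 * n + 1) div 2 = n" by simp
        then have "d (2 * n) - Jc (d (2 * n + 1)) = s n + K (s n) - Jc (Jc (s n) - Jc (K (s n)))"
          by (simp add: d_def K_Jc)
        also have "\<dots> = 2 *\<^sub>R s n"
          by (simp add: linear_diff[OF Jc_linear] scaleR_2)
        finally show ?thesis by simp
      qed
      then show ?thesis using M d by (simp add: subspace_diff subspace_scale)
    qed
    then have "D \<subseteq> ?M" using s by blast
    then have "closure D \<subseteq> ?M" using M(2) by (rule closure_minimal)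
    then show ?thesis unfolding D(2) by auto
  qed
  ultimately show ?thesis using that by blast
qed

text \<open>Gram-Schmidt with cyclic subspaces in place of lines. Orthogonality is stated twice,
  against \<open>e n\<close> and against \<open>Jc (e n)\<close>, since \<open>inner\<close> is only
  the real part of the complex inner product. Some \<open>e n\<close> may be zero.\<close>

theorem cyclic_decomposition:
  obtains e :: "nat \<Rightarrow> 'v" where "\<And>n. K (e n) = e n" "\<And>n. norm (e n) \<le> (1/2)^n"
    "\<And>m n L. m \<noteq> n \<Longrightarrow> Sp L (e m) \<bullet> e n = 0" "\<And>m n L. m \<noteq> n \<Longrightarrow> Sp L (e m) \<bullet> Jc (e n) = 0"
    "inv_subspace hull (range e) = UNIV"
proof -
  obtain d :: "nat \<Rightarrow> 'v" where Kd: "\<And>n. K (d n) = d n" and d: "inv_subspace hull (range d) = UNIV"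
    by (rule real_generators) blast
  define M where "M n = inv_subspace hull (d ` {..<n})" for n
  have inv: "inv_subspace (M n)" for n unfolding M_def by (rule inv_subspace_hull)
  then have M: "closed (M n)" "subspace (M n)" "v \<in> M n \<Longrightarrow> Jc v \<in> M n" for n v
    by (auto simp: inv_subspace_def)
  have "\<exists>p. p \<in> M n \<and> (\<forall>v\<in>M n. v \<bullet> (d n - p) = 0)" for n
    by (rule riesz_on_subspace[OF M(1,2) bounded_linear_inner_left, of n "d n"])
       (auto simp: inner_diff_right)
  then obtain p where p: "\<And>n. p n \<in> M n" "\<And>n v. v \<in> M n \<Longrightarrow> v \<bullet> (d n - p n) = 0" by metis
  define f where "f n = d n - p n" for n
  have KM: "K v \<in> M n" if "v \<in> M n" for v n
    using that unfolding M_def by (rule hull_K_invariant[rotated]) (auto simp: Kd)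
  \<comment> \<open>The projection onto \<open>M n\<close> commutes with K, because K is isometric
    and preserves \<open>M n\<close>; so subtracting it keeps a K-fixed vector K-fixed.\<close>
  have Kf: "K (f n) = f n" for n
  proof -
    have "K (p n) - p n \<in> M n" using KM p(1) M(2) by (simp add: subspace_diff)
    moreover have "v \<bullet> (K (p n) - p n) = 0" if "v \<in> M n" for v
    proof -
      have "v \<bullet> (d n - K (p n)) = K v \<bullet> (d n - p n)"
        using K_inner[of "v" "K (d n - p n)"] K_inner[of v "d n - p n"] K_inner[of "K v" "d n - p n"]
        by (simp add: K_diff Kd)
      also have "\<dots> = 0" using p(2) KM that by blast
      finally show ?thesis using p(2)[OF that] by (simp add: inner_diff_right)
    qed
    ultimately have "K (p n) - p n = 0" using inner_eq_zero_iff by blast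
    then show ?thesis by (simp add: f_def K_diff Kd)
  qed
  have dM: "d m \<in> M n" if "m < n" for m n
    using hull_subset[of "d ` {..<n}" inv_subspace] that by (auto simp: M_def)
  have M_mono: "M m \<subseteq> M n" if "m \<le> n" for m n
    unfolding M_def by (rule hull_mono) (use that in auto)
  have fM: "f m \<in> M n" if "m < n" for m n
    using dM[OF that] p(1)[of m] M_mono[of m n] M(2) that
    unfolding f_def by (intro subspace_diff) auto
  \<comment> \<open>The rescaling makes the masses of the spectral measures summable; 1 + norm in
    the denominator covers f n = 0.\<close>
  define c where "c n = (1/2)^n / (1 + norm (f n))" for n
  have c: "c n > 0" for n unfolding c_def by (intro divide_pos_pos add_pos_nonneg) auto
  define e where "e n = c n *\<^sub>R f n" for n
  have eM: "e m \<in> M n" if "m < n" for m n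
    using fM[OF that] M(2) by (simp add: e_def subspace_scale)
  have e_orth: "v \<bullet> e n = 0" if "v \<in> M n" for v n
    using p(2)[OF that] by (simp add: e_def f_def)
  have lt: "Sp L (e m) \<bullet> e n = 0" "Sp L (e m) \<bullet> Jc (e n) = 0" if "m < n" for m n L
  proof -
    have *: "Sp L (e m) \<in> M n" using inv_subspace_Sp[OF inv] eM[OF that] by blast
    show "Sp L (e m) \<bullet> e n = 0" using e_orth[OF *] .
    have "Jc (Sp L (e m)) \<bullet> e n = 0" using e_orth[OF M(3)[OF *]] .
    then show "Sp L (e m) \<bullet> Jc (e n) = 0" by (simp add: Jc_skew)
  qed
  have 1: "Sp L (e m) \<bullet> e n = 0" if "m \<noteq> n" for m n L
  proof (cases "m < n")
    case False
    then have "Sp L (e n) \<bullet> e m = 0" using that lt by simp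
    then show ?thesis by (metis Sp_selfadjoint inner_commute)
  qed (use lt in blast)
  have 2: "Sp L (e m) \<bullet> Jc (e n) = 0" if "m \<noteq> n" for m n L
  proof (cases "m < n")
    case False
    then have "Sp L (e n) \<bullet> Jc (e m) = 0" using that lt by simp
    then show ?thesis
      by (metis Jc_skew Sp_Jc Sp_selfadjoint inner_commute neg_equal_0_iff_equal)
  qed (use lt in blast)
  have 3: "norm (e n) \<le> (1/2)^n" for n
  proof -
    have "norm (f n) / (1 + norm (f n)) \<le> 1" by (simp add: divide_le_eq_1 add_pos_nonneg)
    then have "(1/2)^n * (norm (f n) / (1 + norm (f n))) \<le> (1/2)^n * 1"
      by (intro mult_left_mono) auto
    then show ?thesis using c[of n] by (simp add: e_def c_def)
  qed
  have 4: "K (e n) = e n" for n by (simp add: e_def K_scaleR Kf)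
  have 5: "inv_subspace hull (range e) = UNIV"
  proof -
    let ?E = "inv_subspace hull (range e)"
    have E: "inv_subspace ?E" by (rule inv_subspace_hull)
    \<comment> \<open>Undoes Gram-Schmidt: d n is f n plus a vector of \<open>M n\<close>, and
      \<open>M n\<close> is generated by the earlier d, already known to lie in the hull.\<close>
    have "d n \<in> ?E" for n
    proof (induction n rule: less_induct)
      case (less n)
      then have "M n \<subseteq> ?E" unfolding M_def by (intro hull_minimal[where S = inv_subspace and t = "?E"] E) auto
      then have "p n \<in> ?E" using p(1) by blast
      moreover have "e n \<in> ?E" using hull_subset[of "range e" inv_subspace] by blast
      then have "(1 / c n) *\<^sub>R e n \<in> ?E" using E by (auto simp: inv_subspace_def subspace_scale)
      then have "f n \<in> ?E" using c[of n] by (simp add: e_def)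
      ultimately have "f n + p n \<in> ?E" using E by (auto simp: inv_subspace_def subspace_add)
      then show ?case by (simp add: f_def)
    qed
    then have "inv_subspace hull (range d) \<subseteq> ?E" by (intro hull_minimal[where S = inv_subspace and t = "?E"] E) auto
    then show ?thesis using d by auto
  qed
  show ?thesis by (rule that[OF 4 3 1 2 5])
qed

end

section \<open>Spectral densities\<close>

text \<open>Countable additivity is an exchange of two sums of nonnegative terms, read as an
  integral over the counting measure.\<close>

lemma sum_of_measures:
  fixes m :: "nat \<Rightarrow> 'a measure"
  assumes m: "\<And>n. sets (m n) = sets N"
  obtains \<mu> where "sets \<mu> = sets N" "\<And>A. A \<in> sets N \<Longrightarrow> emeasure \<mu> A = (\<Sum>n. emeasure (m n) A)"
proof -
  define \<mu> where "\<mu> = measure_of (space N) (sets N) (\<lambda>A. \<Sum>n. emeasure (m n) A)"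
  have sets_mu: "sets \<mu> = sets N" by (simp add: \<mu>_def)
  have "emeasure \<mu> A = (\<Sum>n. emeasure (m n) A)" if A: "A \<in> sets N" for A
  proof (rule emeasure_measure_of[OF \<mu>_def])
    show "countably_additive (sets \<mu>) (\<lambda>A. \<Sum>n. emeasure (m n) A)"
    proof (rule countably_additiveI)
      fix B :: "nat \<Rightarrow> 'a set"
      assume B: "range B \<subseteq> sets \<mu>" "disjoint_family B"
      have "emeasure (m n) (\<Union> (range B)) = (\<Sum>i. emeasure (m n) (B i))" for n
        using B m sets_mu by (intro suminf_emeasure[symmetric]) auto
      then have "(\<Sum>n. emeasure (m n) (\<Union> (range B))) = (\<Sum>n. \<Sum>i. emeasure (m n) (B i))"
        by simp
      also have "\<dots> = (\<integral>\<^sup>+n. (\<Sum>i. emeasure (m n) (B i)) \<partial>count_space UNIV)"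
        by (rule nn_integral_count_space_nat[symmetric])
      also have "\<dots> = (\<Sum>i. \<integral>\<^sup>+n. emeasure (m n) (B i) \<partial>count_space UNIV)"
        by (rule nn_integral_suminf) simp
      finally show "(\<Sum>i. \<Sum>n. emeasure (m n) (B i)) = (\<Sum>n. emeasure (m n) (\<Union> (range B)))"
        by (simp add: nn_integral_count_space_nat)
    qed
  qed (use A sets_mu in \<open>auto simp: positive_def sets.space_closed\<close>)
  with sets_mu show ?thesis using that by blast
qed

lemma check_check [simp]: "check (check x) = x"
proof -
  have "(b :: bit) + 1 + 1 = b" for b by (cases "b = 0") auto
  then show ?thesis by (simp add: check_def fun_eq_iff)
qed

lemma measurable_borel_eq: "sets M = sets borel \<Longrightarrow> borel_measurable M = borel_measurable (borel :: 'a::topological_space measure)"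
  by (rule measurable_cong_sets[OF _ HOL.refl])

locale cantor_measure = finite_measure \<mu> for \<mu> :: "cantor measure" +
  assumes sets_mu: "sets \<mu> = sets borel"

text \<open>\<open>f n\<close> is a density of the spectral measure of \<open>e n\<close> with
  respect to \<mu>. Check-invariance of the densities and positivity of at least one of them hold at
  every point, so the fibres built from them are check-invariant and nonzero everywhere and not just
  almost everywhere.\<close>

locale spectral_model = conjugate_system S K + cantor_measure \<mu>
  for S :: "nat \<Rightarrow> 'v::{complex_inner, complete_space} \<Rightarrow> 'v" and K :: "'v \<Rightarrow> 'v" and \<mu> :: "cantor measure" +
  fixes e :: "nat \<Rightarrow> 'v" and f :: "nat \<Rightarrow> cantor \<Rightarrow> real"
  assumes K_e: "\<And>n. K (e n) = e n"
    and e_orth: "\<And>m n L. m \<noteq> n \<Longrightarrow> Sp L (e m) \<bullet> e n = 0" "\<And>m n L. m \<noteq> n \<Longrightarrow> Sp L (e m) \<bullet> Jc (e n) = 0"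
    and e_total: "inv_subspace hull (range e) = UNIV"
    and mu_check: "distr \<mu> borel check = \<mu>"
    and f_measurable [measurable]: "\<And>n. f n \<in> borel_measurable borel"
    and f_nonneg: "\<And>n x. 0 \<le> f n x"
    and f_check: "\<And>n x. f n (check x) = f n x"
    and f_pos: "\<And>x. \<exists>n. 0 < f n x"
    and f_integrable: "\<And>n. integrable \<mu> (f n)"
    and f_char: "\<And>n L. (\<integral>x. chi L x * f n x \<partial>\<mu>) = Sp L (e n) \<bullet> e n"

context conjugate_system
begin

theorem spectral_model_exists: obtains \<mu> e f where "spectral_model S K \<mu> e f"
proof -
  obtain e :: "nat \<Rightarrow> 'v" where e: "\<And>n. K (e n) = e n" "\<And>n. norm (e n) \<le> (1/2)^n"
    "\<And>m n L. m \<noteq> n \<Longrightarrow> Sp L (e m) \<bullet> e n = 0" "\<And>m n L. m \<noteq> n \<Longrightarrow> Sp L (e m) \<bullet> Jc (e n) = 0"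
    "inv_subspace hull (range e) = UNIV"
    by (rule cyclic_decomposition) blast
  \<comment> \<open>For odd length this says that the moment is zero; this is where the K-fixed
    generators are used.\<close>
  have parity: "(-1) ^ length L * (Sp L (e n) \<bullet> e n) = Sp L (e n) \<bullet> e n" for L n
    using K_inner[of "Sp L (e n)" "e n"] by (simp add: K_Sp e(1))
  have "\<exists>m. finite_measure m \<and> sets m = sets borel \<and> (\<forall>L. (\<integral>x. chi L x \<partial>m) = Sp L (e n) \<bullet> e n)" for n
    by (rule spectral_measure[of "e n"]) blast
  then obtain m where m: "\<And>n. finite_measure (m n)" "\<And>n. sets (m n) = sets borel"
    "\<And>n L. (\<integral>x. chi L x \<partial>m n) = Sp L (e n) \<bullet> e n" by metis
  obtain \<mu> where sets_mu: "sets \<mu> = sets borel"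
    and em: "\<And>A. A \<in> sets borel \<Longrightarrow> emeasure \<mu> A = (\<Sum>n. emeasure (m n) A)"
    using sum_of_measures[of m borel] m(2) by blast
  have space_mu: "space \<mu> = UNIV" and space_m: "space (m n) = UNIV" for n
    using sets_eq_imp_space_eq[OF sets_mu] sets_eq_imp_space_eq[OF m(2)] by simp_all
  \<comment> \<open>The total mass is the squared norm of e n, whose geometric bound makes the sum
    of all spectral measures finite.\<close>
  have m_UNIV: "emeasure (m n) UNIV \<le> ennreal ((1/4)^n)" for n
  proof -
    interpret finite_measure "m n" by (rule m)
    have "measure (m n) UNIV = e n \<bullet> e n" using m(3)[of n "[]"] by (simp add: space_m)
    also have "\<dots> \<le> ((1/2)^n)\<^sup>2"
      using e(2)[of n] by (simp add: dot_square_norm power_mono)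
    also have "\<dots> = (1/4)^n" by (simp add: power2_eq_square flip: power_mult_distrib)
    finally show ?thesis by (simp add: emeasure_eq_measure ennreal_leI)
  qed
  have fin: "finite_measure \<mu>"
  proof (rule finite_measureI)
    have "emeasure \<mu> UNIV \<le> (\<Sum>n. ennreal ((1/4)^n))"
      using em[of UNIV] m_UNIV by (simp add: suminf_le)
    also have "\<dots> = ennreal (\<Sum>n. (1/4)^n)" by (rule suminf_ennreal2) auto
    finally show "emeasure \<mu> (space \<mu>) \<noteq> \<infinity>" by (auto simp: space_mu top_unique)
  qed
  interpret mu: finite_measure \<mu> by (rule fin)
  note mu_meas [simp] = measurable_borel_eq[OF sets_mu]
  have m_check: "distr (m n) borel check = m n" for n
  proof (rule measure_eq_of_characters)
    have check_m: "check \<in> measurable (m n) borel"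
      using check_borel by (simp only: measurable_borel_eq[OF m(2)])
    show "finite_measure (distr (m n) borel check)"
      by (intro finite_measure.finite_measure_distr m check_m)
    show "(\<integral>x. chi L x \<partial>distr (m n) borel check) = (\<integral>x. chi L x \<partial>m n)" for L
    proof -
      have "(\<integral>x. chi L x \<partial>distr (m n) borel check) = (\<integral>x. chi L (check x) \<partial>m n)"
        by (rule integral_distr[OF check_m chi_borel])
      also have "\<dots> = (-1) ^ length L * (Sp L (e n) \<bullet> e n)" by (simp add: chi_check m(3))
      also have "\<dots> = Sp L (e n) \<bullet> e n" by (rule parity)
      finally show ?thesis by (simp add: m(3))
    qed
  qed (use m in auto)
  have vim: "emeasure (distr M borel check) A = emeasure M (check -` A)"
    if "sets M = sets borel" "A \<in> sets borel" for M and A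
    using that sets_eq_imp_space_eq[OF that(1)] check_borel
    by (subst emeasure_distr) (auto simp: measurable_borel_eq[OF that(1)])
  have check_sets: "check -` A \<in> sets borel" if "A \<in> sets borel" for A
    using measurable_sets[OF check_borel that] by simp
  have mu_check: "distr \<mu> borel check = \<mu>"
  proof (rule measure_eqI)
    fix A assume "A \<in> sets (distr \<mu> borel check)"
    then have A: "A \<in> sets borel" by simp
    have "emeasure (m n) (check -` A) = emeasure (m n) A" for n
      using vim[OF m(2) A, of n] by (simp add: m_check)
    then show "emeasure (distr \<mu> borel check) A = emeasure \<mu> A"
      using A check_sets[OF A] by (simp add: vim[OF sets_mu A] em)
  qed (simp add: sets_mu)
  have ac: "absolutely_continuous \<mu> (m n)" for n
  proof (unfold absolutely_continuous_def, rule subsetI)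
    fix A assume "A \<in> null_sets \<mu>"
    then have A: "A \<in> sets borel" "(\<Sum>n. emeasure (m n) A) = 0" by (auto simp: null_sets_def sets_mu em)
    then have "emeasure (m n) A = 0" by (simp add: suminf_eq_zero_iff)
    then show "A \<in> null_sets (m n)" using A m(2) by (auto simp: null_sets_def)
  qed
  define g where "g n x = enn2real (RN_deriv \<mu> (m n) x)" for n x
  have g_meas [measurable]: "g n \<in> borel_measurable borel" for n
    using borel_measurable_RN_deriv[of \<mu> "m n"] unfolding g_def[abs_def] by simp
  have g_nn: "0 \<le> g n x" for n x by (simp add: g_def)
  have m_density: "m n = density \<mu> (\<lambda>x. ennreal (g n x))" for n
  proof -
    interpret mn: finite_measure "m n" by (rule m)
    have "m n = density \<mu> (RN_deriv \<mu> (m n))"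
      using mu.density_RN_deriv[OF ac] m(2) sets_mu by simp
    also have "\<dots> = density \<mu> (\<lambda>x. ennreal (g n x))"
    proof (rule density_cong)
      have "AE x in \<mu>. RN_deriv \<mu> (m n) x \<noteq> \<infinity>"
        by (rule mu.RN_deriv_finite[OF mn.sigma_finite_measure_axioms ac]) (simp add: m(2) sets_mu)
      then show "AE x in \<mu>. RN_deriv \<mu> (m n) x = ennreal (g n x)"
        by eventually_elim (simp add: g_def ennreal_enn2real_if)
    qed (use g_meas borel_measurable_RN_deriv[of \<mu> "m n"] in auto)
    finally show ?thesis .
  qed
  have g_int: "integrable \<mu> (\<lambda>x. chi L x * g n x)"
    and g_char: "(\<integral>x. chi L x * g n x \<partial>\<mu>) = Sp L (e n) \<bullet> e n" for n L
  proof -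
    have "integrable (m n) (chi L)" using integrable_chi m by blast
    then show "integrable \<mu> (\<lambda>x. chi L x * g n x)"
      using g_nn g_meas by (subst (asm) m_density, subst (asm) integrable_density) (auto simp: mult.commute)
    show "(\<integral>x. chi L x * g n x \<partial>\<mu>) = Sp L (e n) \<bullet> e n"
      using m(3)[of n L] g_nn g_meas
      by (subst (asm) m_density, subst (asm) integral_density) (auto simp: mult.commute)
  qed
  have check_mu: "check \<in> measurable \<mu> borel" using check_borel by simp
  \<comment> \<open>The Radon-Nikodym density g n is check-invariant only almost everywhere;
    averaging over x and \<open>check x\<close> makes it so at every point without changing its
    moments.\<close>
  define h where "h n x = (g n x + g n (check x)) / 2" for n x
  \<comment> \<open>On this check-invariant set every spectral measure vanishes, hence so does
    \<mu>. Setting all densities to 1 there secures positivity everywhere.\<close>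
  define bad where "bad = {x. \<forall>n. h n x = 0}"
  define f where "f n x = (if x \<in> bad then 1 else h n x)" for n x
  have h_meas [measurable]: "h n \<in> borel_measurable borel" for n
  proof -
    have "(\<lambda>x. g n (check x)) \<in> borel_measurable borel"
      by (rule measurable_compose[OF check_borel g_meas])
    then show ?thesis unfolding h_def[abs_def] by measurable
  qed
  have bad_meas [measurable]: "bad \<in> sets borel"
  proof -
    have "{x \<in> space borel. \<forall>n. h n x = 0} \<in> sets borel" by measurable
    then show ?thesis by (simp add: bad_def)
  qed
  have f_meas: "f n \<in> borel_measurable borel" for n
    unfolding f_def[abs_def] by measurable
  have h_nn: "0 \<le> h n x" for n x using g_nn by (simp add: h_def)
  have "emeasure (m n) bad = 0" for n
  proof -
    have "g n x = 0" if "x \<in> bad" for x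
      using that g_nn[of n x] g_nn[of n "check x"] by (auto simp: bad_def h_def dest!: spec[of _ n])
    then have "(\<integral>\<^sup>+x. ennreal (g n x) * indicator bad x \<partial>\<mu>) = (\<integral>\<^sup>+x. 0 \<partial>\<mu>)"
      by (intro nn_integral_cong) (auto simp: indicator_def)
    then show ?thesis
      by (subst m_density, subst emeasure_density) (use g_meas sets_mu in auto)
  qed
  then have "emeasure \<mu> bad = 0" by (simp add: em)
  then have "AE x in \<mu>. x \<notin> bad" by (intro AE_not_in) (auto simp: null_sets_def sets_mu)
  then have fh: "AE x in \<mu>. f n x = h n x" for n by eventually_elim (simp add: f_def)
  have h_check: "h n (check x) = h n x" for n x by (simp add: h_def add.commute)
  have g_check: "integrable \<mu> (\<lambda>x. chi L x * g n (check x))"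
     "(\<integral>x. chi L x * g n (check x) \<partial>\<mu>) = Sp L (e n) \<bullet> e n" for n L
  proof -
    let ?F = "\<lambda>x. chi L (check x) * g n x"
    have F: "?F x = (-1) ^ length L * (chi L x * g n x)" for x
      by (simp add: chi_check)
    have F_meas: "?F \<in> borel_measurable borel"
      using g_meas by (simp add: chi_check)
    have F_check: "chi L x * g n (check x) = ?F (check x)" for x by simp
    have "integrable (distr \<mu> borel check) ?F"
      unfolding mu_check F by (intro integrable_mult_right g_int)
    then show "integrable \<mu> (\<lambda>x. chi L x * g n (check x))"
      unfolding F_check by (rule integrable_distr[OF check_mu])
    have "(\<integral>x. chi L x * g n (check x) \<partial>\<mu>) = (\<integral>x. ?F x \<partial>distr \<mu> borel check)"
      unfolding F_check by (rule integral_distr[OF check_mu F_meas, symmetric])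
    also have "\<dots> = (-1) ^ length L * (Sp L (e n) \<bullet> e n)"
      unfolding mu_check F by (simp add: g_char)
    also have "\<dots> = Sp L (e n) \<bullet> e n" by (rule parity)
    finally show "(\<integral>x. chi L x * g n (check x) \<partial>\<mu>) = Sp L (e n) \<bullet> e n" .
  qed
  have h_sum: "chi L x * h n x = 1/2 * (chi L x * g n x) + 1/2 * (chi L x * g n (check x))"
    for L n x by (simp add: h_def algebra_simps)
  have h_int: "integrable \<mu> (\<lambda>x. chi L x * h n x)" for L n
    unfolding h_sum by (intro Bochner_Integration.integrable_add integrable_mult_right g_int g_check)
  have h_char: "(\<integral>x. chi L x * h n x \<partial>\<mu>) = Sp L (e n) \<bullet> e n" for L n
    unfolding h_sum
    by (subst Bochner_Integration.integral_add)
       (auto intro!: g_int g_check integrable_mult_right simp: g_char g_check)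
  have fh': "AE x in \<mu>. chi L x * f n x = chi L x * h n x" for L n
    using fh[of n] by eventually_elim simp
  show ?thesis
  proof (rule that, intro spectral_model.intro spectral_model_axioms.intro cantor_measure.intro
      cantor_measure_axioms.intro conjugate_system_axioms e(1,3,4,5) fin sets_mu mu_check f_meas)
    show "0 \<le> f n x" for n x by (simp add: f_def h_nn)
    show "f n (check x) = f n x" for n x by (simp add: f_def bad_def h_check)
    show "\<exists>n. 0 < f n x" for x
      using h_nn by (auto simp: f_def bad_def less_le)
    show "integrable \<mu> (f n)" for n
      using h_int[of "[]" n] fh[of n] f_meas h_meas by (subst integrable_cong_AE[of _ _ "h n"]) auto
    show "(\<integral>x. chi L x * f n x \<partial>\<mu>) = Sp L (e n) \<bullet> e n" for n L
      using f_meas h_meas by (subst integral_cong_AE[OF _ _ fh']) (auto simp: h_char)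
  qed ((rule fin sets_mu e(1,3,4,5) mu_check f_meas | assumption)+)
qed

end

section \<open>Fibres\<close>

instance ell2 :: banach ..

definition unit_ell2 :: "nat \<Rightarrow> ell2" where
  "unit_ell2 j = Abs_ell2 (\<lambda>i. if i = j then 1 else 0)"

lemma nth_unit_ell2: "ell2_nth (unit_ell2 j) i = (if i = j then 1 else 0)"
proof -
  have "summable (\<lambda>i. (if i = j then 1 else 0 :: real)\<^sup>2)"
    by (rule summable_finite[of "{j}"]) auto
  then show ?thesis unfolding unit_ell2_def by (subst Abs_ell2_inverse) auto
qed

lemma inner_unit_ell2: "u \<bullet> unit_ell2 j = ell2_nth u j"
proof -
  have "u \<bullet> unit_ell2 j = (\<Sum>n\<in>{j}. ell2_nth u n * ell2_nth (unit_ell2 j) n)"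
    unfolding inner_ell2_def by (rule suminf_finite) (auto simp: nth_unit_ell2)
  then show ?thesis by (simp add: nth_unit_ell2)
qed

lemma ell2_nth_linear: "ell2_nth (u + v) j = ell2_nth u j + ell2_nth v j"
  "ell2_nth (u - v) j = ell2_nth u j - ell2_nth v j"
  "ell2_nth (r *\<^sub>R u) j = r * ell2_nth u j" "ell2_nth (- u) j = - ell2_nth u j" "ell2_nth 0 j = 0"
  by (simp_all add: plus_ell2.rep_eq minus_ell2.rep_eq scaleR_ell2.rep_eq uminus_ell2.rep_eq zero_ell2.rep_eq)

lemma ell2_eqI: "(\<And>j. ell2_nth u j = ell2_nth v j) \<Longrightarrow> u = v"
  by (simp add: ell2_nth_inject[symmetric] fun_eq_iff)

lemma continuous_ell2_nth: "continuous_on UNIV (\<lambda>u. ell2_nth u j)"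
  unfolding inner_unit_ell2[symmetric] by (intro continuous_intros)

lemma ell2_truncation: "(\<lambda>N. \<Sum>j<N. ell2_nth u j *\<^sub>R unit_ell2 j) \<longlonglongrightarrow> u"
proof -
  define t where "t N = (\<Sum>j<N. ell2_nth u j *\<^sub>R unit_ell2 j)" for N
  have t: "ell2_nth (t N) i = (if i < N then ell2_nth u i else 0)" for N i
    unfolding t_def by (induction N) (auto simp: ell2_nth_linear nth_unit_ell2 less_Suc_eq)
  have "(norm (u - t N))\<^sup>2 = (\<Sum>n. (ell2_nth u (n + N))\<^sup>2)" for N
  proof -
    have "(norm (u - t N))\<^sup>2 = (\<Sum>n. (ell2_nth (u - t N) (n + N))\<^sup>2) + (\<Sum>n<N. (ell2_nth (u - t N) n)\<^sup>2)"
      unfolding norm_ell2_sq by (rule suminf_split_initial_segment) (rule summable_ell2)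
    then show ?thesis by (simp add: ell2_nth_linear t)
  qed
  moreover have "(\<lambda>N. \<Sum>n. (ell2_nth u (n + N))\<^sup>2) \<longlonglongrightarrow> 0"
    by (rule suminf_exist_split2) (rule summable_ell2)
  ultimately have "(\<lambda>N. sqrt ((norm (u - t N))\<^sup>2)) \<longlonglongrightarrow> sqrt 0"
    by (intro tendsto_real_sqrt) simp
  then have "(\<lambda>N. norm (t N - u)) \<longlonglongrightarrow> 0" by (simp add: norm_minus_commute)
  then have "(\<lambda>N. t N - u) \<longlonglongrightarrow> 0" by (rule tendsto_norm_zero_cancel)
  then have "t \<longlonglongrightarrow> u" by (rule LIM_zero_cancel)
  then show ?thesis unfolding t_def[abs_def] .
qed

section \<open>The complexified fibre space as a real Hilbert space with the operator
  \<open>ic\<close>\<close>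

type_synonym cell2 = "ell2 \<times> ell2"

abbreviation ic :: "cell2 \<Rightarrow> cell2" where
  "ic \<equiv> cx_scale \<i>"

lemma ic_simps [simp]: "ic (a, b) = (- b, a)" "fst (ic p) = - snd p" "snd (ic p) = fst p"
  by (simp_all add: cx_scale_def)

lemma ic_ic [simp]: "ic (ic p) = - p"
  by (simp add: prod_eq_iff)

lemma ic_linear: "ic (p + q) = ic p + ic q" "ic (p - q) = ic p - ic q" "ic (r *\<^sub>R p) = r *\<^sub>R ic p"
  "ic (- p) = - ic p" "ic 0 = 0"
  by (simp_all add: prod_eq_iff)

lemma norm_ic [simp]: "norm (ic p) = norm p"
  by (cases p) (simp add: norm_Pair add.commute)

lemma ic_skew: "ic p \<bullet> q = - (p \<bullet> ic q)"
  by (simp add: inner_prod_def)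

lemma cx_scale_Re_Im: "cx_scale z p = Re z *\<^sub>R p + Im z *\<^sub>R ic p"
  by (simp add: prod_eq_iff cx_scale_def)

lemma cx_inner_real: "cx_inner p q = Complex (p \<bullet> q) (p \<bullet> ic q)"
  by (simp add: cx_inner_def inner_prod_def complex_eq_iff)

lemma norm_cx_conj [simp]: "norm (cx_conj p) = norm p"
  by (simp add: cx_conj_def norm_prod_def)

lemma cx_conj_simps: "cx_conj (p + q) = cx_conj p + cx_conj q" "cx_conj (r *\<^sub>R p) = r *\<^sub>R cx_conj p"
  "cx_conj (p - q) = cx_conj p - cx_conj q" "cx_conj (- p) = - cx_conj p" "cx_conj (cx_conj p) = p"
  "cx_conj (ic p) = - ic (cx_conj p)"
  by (simp_all add: prod_eq_iff cx_conj_def)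

lemma continuous_ic: "continuous_on UNIV ic"
proof -
  have "ic = (\<lambda>p. (- snd p, fst p))" by (simp add: fun_eq_iff prod_eq_iff)
  then show ?thesis by (simp only:) (intro continuous_intros)
qed

lemma continuous_cx_conj: "continuous_on UNIV (cx_conj :: cell2 \<Rightarrow> cell2)"
  unfolding cx_conj_def[abs_def] by (intro continuous_intros)

lemma ic_measurable [measurable]: "ic \<in> borel_measurable borel"
  by (rule borel_measurable_continuous_onI[OF continuous_ic])

lemma cx_conj_measurable [measurable]: "(cx_conj :: cell2 \<Rightarrow> cell2) \<in> borel_measurable borel"
  by (rule borel_measurable_continuous_onI[OF continuous_cx_conj])

definition eps :: "nat \<Rightarrow> cell2" where
  "eps j = (unit_ell2 j, 0)"

lemma inner_eps: "p \<bullet> eps j = ell2_nth (fst p) j" "p \<bullet> ic (eps j) = ell2_nth (snd p) j"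
  by (simp_all add: eps_def inner_prod_def inner_unit_ell2)

lemma eps_orthonormal: "eps i \<bullet> eps j = (if i = j then 1 else 0)" "eps i \<bullet> ic (eps j) = 0"
  by (simp_all add: inner_eps) (simp_all add: eps_def nth_unit_ell2 ell2_nth_linear)

lemma norm_eps [simp]: "norm (eps j) = 1"
  by (simp add: norm_eq_sqrt_inner eps_orthonormal)

lemma cx_conj_eps [simp]: "cx_conj (eps j) = eps j"
  by (simp add: cx_conj_def eps_def)

definition supported :: "nat set \<Rightarrow> ell2 set" where
  "supported A = {u. \<forall>j. j \<notin> A \<longrightarrow> ell2_nth u j = 0}"

definition csupp :: "nat set \<Rightarrow> cell2 set" where
  "csupp A = supported A \<times> supported A"

lemma csupp_iff: "p \<in> csupp A \<longleftrightarrow> (\<forall>j. j \<notin> A \<longrightarrow> p \<bullet> eps j = 0 \<and> p \<bullet> ic (eps j) = 0)"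
  by (cases p) (auto simp: csupp_def supported_def inner_eps)

lemma subspace_supported: "subspace (supported A)" and closed_supported: "closed (supported A)"
proof -
  show "subspace (supported A)" by (auto simp: subspace_def supported_def ell2_nth_linear)
  have "supported A = (\<Inter>j\<in>-A. {u. ell2_nth u j = 0})" by (auto simp: supported_def)
  then show "closed (supported A)"
    by (simp only:) (intro closed_INT ballI closed_Collect_eq continuous_ell2_nth continuous_on_const)
qed

lemma subspace_csupp: "subspace (csupp A)"
  unfolding csupp_def by (intro subspace_Times subspace_supported)

lemma closed_csupp: "closed (csupp A)"
  unfolding csupp_def by (intro closed_Times closed_supported)

lemma ic_csupp: "p \<in> csupp A \<Longrightarrow> ic p \<in> csupp A"
  by (cases p) (simp add: csupp_def supported_def ell2_nth_linear)

lemma cx_conj_csupp: "p \<in> csupp A \<Longrightarrow> cx_conj p \<in> csupp A"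
  by (cases p) (simp add: csupp_def supported_def cx_conj_def ell2_nth_linear)

lemma eps_csupp: "j \<in> A \<Longrightarrow> eps j \<in> csupp A"
  by (auto simp: eps_def csupp_def supported_def ell2_nth_linear nth_unit_ell2)

lemma cell2_eqI:
  assumes "\<And>j. p \<bullet> eps j = q \<bullet> eps j" "\<And>j. p \<bullet> ic (eps j) = q \<bullet> ic (eps j)"
  shows "p = q"
  using assms by (auto simp: inner_eps prod_eq_iff intro!: ell2_eqI)

lemma csupp_eqI:
  assumes "p \<in> csupp A" "q \<in> csupp A"
    "\<And>j. j \<in> A \<Longrightarrow> p \<bullet> eps j = q \<bullet> eps j" "\<And>j. j \<in> A \<Longrightarrow> p \<bullet> ic (eps j) = q \<bullet> ic (eps j)"
  shows "p = q"
proof (rule cell2_eqI)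
  show "p \<bullet> eps j = q \<bullet> eps j" for j using assms by (cases "j \<in> A") (simp_all add: csupp_iff)
  show "p \<bullet> ic (eps j) = q \<bullet> ic (eps j)" for j using assms by (cases "j \<in> A") (simp_all add: csupp_iff)
qed

text \<open>The positive and negative parts of h are densities of two finite measures with equal
  characters. The measures agree, so the parts agree, and since one of them is zero at each point
  both are.\<close>

lemma integral_zero_of_characters:
  fixes h :: "cantor \<Rightarrow> real"
  assumes "finite_measure \<mu>" and sets_mu: "sets \<mu> = sets borel" and h: "integrable \<mu> h"
    and zero: "\<And>L. (\<integral>x. chi L x * h x \<partial>\<mu>) = 0"
  shows "AE x in \<mu>. h x = 0"
proof -
  interpret finite_measure \<mu> by fact
  define p where "p x = max 0 (h x)" for x
  define n where "n x = max 0 (- h x)" for x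
  have p_nn: "0 \<le> p x" and n_nn: "0 \<le> n x" for x by (simp_all add: p_def n_def)
  have hm: "h \<in> borel_measurable \<mu>" using h by auto
  have pn_meas: "p \<in> borel_measurable \<mu>" "n \<in> borel_measurable \<mu>"
    using hm unfolding p_def[abs_def] n_def[abs_def] by measurable
  have int_p: "integrable \<mu> p" and int_n: "integrable \<mu> n"
    unfolding p_def[abs_def] n_def[abs_def] by (intro integrable_max integrable_minus h; simp)+
  have char_meas: "chi L \<in> borel_measurable \<mu>" for L
    using chi_borel by (simp only: measurable_borel_eq[OF sets_mu])
  have int: "integrable \<mu> (\<lambda>x. chi L x * q x)" if "integrable \<mu> q" for q L
    by (rule Bochner_Integration.integrable_bound[OF that])
       (use that char_meas in \<open>auto simp: abs_mult intro!: borel_measurable_times\<close>)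
  have dens: "finite_measure (density \<mu> (\<lambda>x. ennreal (q x)))"
    "(\<integral>x. chi L x \<partial>density \<mu> (\<lambda>x. ennreal (q x))) = (\<integral>x. chi L x * q x \<partial>\<mu>)"
    if q: "integrable \<mu> q" "\<And>x. 0 \<le> q x" for q L
  proof -
    have "(\<integral>\<^sup>+x. ennreal (q x) \<partial>\<mu>) = ennreal (\<integral>x. q x \<partial>\<mu>)"
      using q by (intro nn_integral_eq_integral) auto
    then have "emeasure (density \<mu> (\<lambda>x. ennreal (q x))) (space (density \<mu> (\<lambda>x. ennreal (q x)))) \<noteq> \<infinity>"
      using q by (simp add: emeasure_density cong: nn_integral_cong)
    then show "finite_measure (density \<mu> (\<lambda>x. ennreal (q x)))" by (rule finite_measureI)
    show "(\<integral>x. chi L x \<partial>density \<mu> (\<lambda>x. ennreal (q x))) = (\<integral>x. chi L x * q x \<partial>\<mu>)"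
      using q char_meas by (subst integral_density) (auto simp: mult.commute)
  qed
  have eq: "density \<mu> (\<lambda>x. ennreal (p x)) = density \<mu> (\<lambda>x. ennreal (n x))"
  proof (rule measure_eq_of_characters)
    show "finite_measure (density \<mu> (\<lambda>x. ennreal (p x)))" "finite_measure (density \<mu> (\<lambda>x. ennreal (n x)))"
      by (rule dens(1)[OF int_p p_nn], rule dens(1)[OF int_n n_nn])
    show "(\<integral>x. chi L x \<partial>density \<mu> (\<lambda>x. ennreal (p x))) = (\<integral>x. chi L x \<partial>density \<mu> (\<lambda>x. ennreal (n x)))" for L
    proof -
      have "(\<integral>x. chi L x * p x \<partial>\<mu>) - (\<integral>x. chi L x * n x \<partial>\<mu>) = (\<integral>x. chi L x * h x \<partial>\<mu>)"
        by (subst Bochner_Integration.integral_diff[symmetric, OF int[OF int_p] int[OF int_n]])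
           (auto intro!: Bochner_Integration.integral_cong simp: p_def n_def max_def algebra_simps)
      then show ?thesis using zero[of L] by (simp add: dens(2)[OF int_p p_nn] dens(2)[OF int_n n_nn])
    qed
  qed (simp_all add: sets_mu)
  have "AE x in \<mu>. ennreal (p x) = ennreal (n x)"
  proof (rule sigma_finite_density_unique[THEN iffD1, OF _ _ _ eq])
    interpret D: finite_measure "density \<mu> (\<lambda>x. ennreal (p x))" by (rule dens(1)[OF int_p p_nn])
    show "sigma_finite_measure (density \<mu> (\<lambda>x. ennreal (p x)))" by (rule D.sigma_finite_measure_axioms)
  qed (use pn_meas in auto)
  then show ?thesis
    by eventually_elim (auto simp: p_def n_def max_def split: if_splits)
qed

section \<open>The model on a total set of vectors\<close>

lemma subspace_closure:
  fixes M :: "'a::real_normed_vector set"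
  assumes "subspace M" shows "subspace (closure M)"
proof (rule subspaceI)
  show "0 \<in> closure M" using subspace_0[OF assms] closure_subset[of M] by auto
  fix x y :: 'a and r :: real
  assume "x \<in> closure M"
  then obtain a where a: "\<And>n. a n \<in> M" "a \<longlonglongrightarrow> x" unfolding closure_sequential by auto
  then have "r *\<^sub>R a n \<in> M" for n using assms by (simp add: subspace_scale)
  moreover have "(\<lambda>n. r *\<^sub>R a n) \<longlonglongrightarrow> r *\<^sub>R x" by (intro tendsto_intros a)
  ultimately show "r *\<^sub>R x \<in> closure M"
    unfolding closure_sequential by (intro exI[of _ "\<lambda>n. r *\<^sub>R a n"]) simp
  assume "y \<in> closure M"
  then obtain b where b: "\<And>n. b n \<in> M" "b \<longlonglongrightarrow> y" unfolding closure_sequential by auto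
  have "a n + b n \<in> M" for n using assms a b by (simp add: subspace_add)
  moreover have "(\<lambda>n. a n + b n) \<longlonglongrightarrow> x + y" by (intro tendsto_intros a b)
  ultimately show "x + y \<in> closure M"
    unfolding closure_sequential by (intro exI[of _ "\<lambda>n. a n + b n"]) simp
qed

section \<open>Square-integrable sections with values in the constant space
  \<open>cell2\<close>\<close>

context cantor_measure
begin

lemma space_mu [simp]: "space \<mu> = UNIV"
  using sets_eq_imp_space_eq[OF sets_mu] by simp

lemma measurable_mu: "borel_measurable \<mu> = borel_measurable borel"
  by (rule measurable_borel_eq[OF sets_mu])

text \<open>The values range over all of \<open>cell2\<close>; membership in the fibres is carried
  separately, as an almost-everywhere statement.\<close>

definition L2 :: "(cantor \<Rightarrow> cell2) \<Rightarrow> bool" where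
  "L2 f \<longleftrightarrow> f \<in> borel_measurable borel \<and> integrable \<mu> (\<lambda>x. (norm (f x))\<^sup>2)"

definition ip :: "(cantor \<Rightarrow> cell2) \<Rightarrow> (cantor \<Rightarrow> cell2) \<Rightarrow> real" where
  "ip f g = (\<integral>x. f x \<bullet> g x \<partial>\<mu>)"

lemma L2_measurable: "L2 f \<Longrightarrow> f \<in> borel_measurable borel"
  by (simp add: L2_def)

lemma norm_add_sq_le: "(norm (a + b))\<^sup>2 \<le> 2 * (norm a)\<^sup>2 + 2 * (norm (b :: 'a::real_inner))\<^sup>2"
proof -
  have "0 \<le> (a - b) \<bullet> (a - b)" by simp
  then show ?thesis
    by (simp add: power2_norm_eq_inner inner_add_left inner_add_right inner_diff_left inner_diff_right inner_commute)
qed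

lemma L2_add:
  assumes "L2 f" "L2 g" shows "L2 (\<lambda>x. f x + g x)"
  unfolding L2_def
proof
  show m: "(\<lambda>x. f x + g x) \<in> borel_measurable borel"
    using assms by (intro borel_measurable_add L2_measurable)
  have "integrable \<mu> (\<lambda>x. 2 * (norm (f x))\<^sup>2 + 2 * (norm (g x))\<^sup>2)"
    using assms unfolding L2_def by (intro Bochner_Integration.integrable_add integrable_mult_right) auto
  then show "integrable \<mu> (\<lambda>x. (norm (f x + g x))\<^sup>2)"
  proof (rule Bochner_Integration.integrable_bound)
    show "(\<lambda>x. (norm (f x + g x))\<^sup>2) \<in> borel_measurable \<mu>"
      unfolding measurable_mu using m by measurable
  qed (simp add: norm_add_sq_le)
qed

lemma L2_image:
  assumes "L2 f" "h \<in> borel_measurable borel" "\<And>x. norm (h x) = norm (f x)"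
  shows "L2 h"
  using assms by (simp add: L2_def)

lemma L2_scaleR: "L2 f \<Longrightarrow> L2 (\<lambda>x. r *\<^sub>R f x)"
  by (auto simp: L2_def power_mult_distrib intro!: borel_measurable_scaleR)

lemma L2_diff: "L2 f \<Longrightarrow> L2 g \<Longrightarrow> L2 (\<lambda>x. f x - g x)"
  using L2_add[of f "\<lambda>x. (-1) *\<^sub>R g x"] L2_scaleR[of g "-1"] by simp

lemma L2_ic: "L2 f \<Longrightarrow> L2 (\<lambda>x. ic (f x))"
  by (rule L2_image[of f]) (auto simp: L2_def)

lemma L2_char: "L2 f \<Longrightarrow> L2 (\<lambda>x. chi L x *\<^sub>R f x)"
  by (rule L2_image[of f]) (auto simp: L2_def intro!: borel_measurable_scaleR)

lemma L2_bsgn: "L2 f \<Longrightarrow> L2 (\<lambda>x. bsgn (x k) *\<^sub>R f x)"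
  using L2_char[of f "[k]"] by simp

lemma L2_inner_integrable: assumes "L2 f" "L2 g" shows "integrable \<mu> (\<lambda>x. f x \<bullet> g x)"
proof (rule Bochner_Integration.integrable_bound)
  show "integrable \<mu> (\<lambda>x. (norm (f x))\<^sup>2 + (norm (g x))\<^sup>2)"
    using assms unfolding L2_def by (intro Bochner_Integration.integrable_add) auto
  show "(\<lambda>x. f x \<bullet> g x) \<in> borel_measurable \<mu>"
    unfolding measurable_mu using assms by (intro borel_measurable_inner) (auto simp: L2_def)
  have "\<bar>a \<bullet> b\<bar> \<le> (norm a)\<^sup>2 + (norm b)\<^sup>2" for a b :: cell2
  proof -
    have "\<bar>a \<bullet> b\<bar> \<le> norm a * norm b" by (rule Cauchy_Schwarz_ineq2)
    also have "\<dots> \<le> (norm a)\<^sup>2 + (norm b)\<^sup>2"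
      using sum_squares_bound[of "norm a" "norm b"] mult_nonneg_nonneg[OF norm_ge_zero[of a] norm_ge_zero[of b]]
      by linarith
    finally show ?thesis .
  qed
  then show "AE x in \<mu>. norm (f x \<bullet> g x) \<le> norm ((norm (f x))\<^sup>2 + (norm (g x))\<^sup>2)" by simp
qed

lemma ip_commute: "ip f g = ip g f"
  by (simp add: ip_def inner_commute)

lemma ip_add_left: "L2 f \<Longrightarrow> L2 g \<Longrightarrow> L2 h \<Longrightarrow> ip (\<lambda>x. f x + g x) h = ip f h + ip g h"
  unfolding ip_def inner_add_left
  by (rule Bochner_Integration.integral_add) (auto intro: L2_inner_integrable)

lemma ip_diff_left: "L2 f \<Longrightarrow> L2 g \<Longrightarrow> L2 h \<Longrightarrow> ip (\<lambda>x. f x - g x) h = ip f h - ip g h"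
  unfolding ip_def inner_diff_left
  by (rule Bochner_Integration.integral_diff) (auto intro: L2_inner_integrable)

lemma ip_scaleR_left: "ip (\<lambda>x. r *\<^sub>R f x) h = r * ip f h"
  by (simp add: ip_def)

lemma ip_add_right: "L2 f \<Longrightarrow> L2 g \<Longrightarrow> L2 h \<Longrightarrow> ip h (\<lambda>x. f x + g x) = ip h f + ip h g"
  and ip_diff_right: "L2 f \<Longrightarrow> L2 g \<Longrightarrow> L2 h \<Longrightarrow> ip h (\<lambda>x. f x - g x) = ip h f - ip h g"
  and ip_scaleR_right: "ip h (\<lambda>x. r *\<^sub>R f x) = r * ip h f"
  by (simp_all add: ip_commute[of h] ip_add_left ip_diff_left ip_scaleR_left)

lemma ip_self: "ip f f = (\<integral>x. (norm (f x))\<^sup>2 \<partial>\<mu>)"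
  by (simp add: ip_def power2_norm_eq_inner)

lemma ip_self_nonneg [simp]: "0 \<le> ip f f"
  unfolding ip_self by (rule Bochner_Integration.integral_nonneg) simp

lemma ip_self_zero: "L2 f \<Longrightarrow> ip f f = 0 \<Longrightarrow> AE x in \<mu>. f x = 0"
  unfolding ip_self L2_def by (subst (asm) integral_nonneg_eq_0_iff_AE) auto

lemma ip_cong_AE:
  assumes "L2 f" "L2 f'" "L2 g" "L2 g'" "AE x in \<mu>. f x = f' x" "AE x in \<mu>. g x = g' x"
  shows "ip f g = ip f' g'"
  unfolding ip_def
proof (rule integral_cong_AE)
  show "(\<lambda>x. f x \<bullet> g x) \<in> borel_measurable \<mu>" "(\<lambda>x. f' x \<bullet> g' x) \<in> borel_measurable \<mu>"
    using assms(1-4) unfolding measurable_mu by (auto intro!: borel_measurable_inner simp: L2_def)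
  show "AE x in \<mu>. f x \<bullet> g x = f' x \<bullet> g' x" using assms(5,6) by eventually_elim simp
qed

text \<open>\<open>ip\<close> acts on functions and not on classes, so it is only semidefinite; the
  discriminant argument therefore treats \<open>ip g g = 0\<close> as a case of its own.\<close>

lemma ip_Cauchy_Schwarz: assumes "L2 f" "L2 g" shows "\<bar>ip f g\<bar> \<le> sqrt (ip f f) * sqrt (ip g g)"
proof -
  define a b c where "a = ip f f" and "b = ip f g" and "c = ip g g"
  have quad: "0 \<le> a + 2 * t * b + t\<^sup>2 * c" for t
  proof -
    have "0 \<le> ip (\<lambda>x. f x + t *\<^sub>R g x) (\<lambda>x. f x + t *\<^sub>R g x)" by (rule ip_self_nonneg)
    also have "\<dots> = a + 2 * t * b + t\<^sup>2 * c"
      using assms by (simp add: ip_add_left ip_add_right L2_add L2_scaleR ip_scaleR_left ip_scaleR_right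
          a_def b_def c_def ip_commute[of g f] power2_eq_square algebra_simps)
    finally show ?thesis .
  qed
  have "b\<^sup>2 \<le> a * c"
  proof (cases "c = 0")
    case True
    have "b = 0"
    proof (rule ccontr)
      assume "b \<noteq> 0"
      then show False using quad[of "- (a + 1) / (2 * b)"] True by (simp add: field_simps)
    qed
    then show ?thesis using True by simp
  next
    case False
    then have "c > 0" using ip_self_nonneg[of g] by (simp add: c_def less_le)
    then show ?thesis using quad[of "- b / c"] by (simp add: field_simps power2_eq_square)
  qed
  then have "sqrt (b\<^sup>2) \<le> sqrt (a * c)" by (rule real_sqrt_le_mono)
  then show ?thesis by (simp add: a_def b_def c_def real_sqrt_mult)
qed

lemma L2_direct_integral: "f \<in> direct_integral \<mu> V \<longleftrightarrow> L2 f \<and> (AE x in \<mu>. f x \<in> V x)"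
  by (auto simp: direct_integral_def L2_def)

end

section \<open>Fibres numbered by the generators that are active at a point\<close>

context spectral_model
begin

text \<open>Generators whose density vanishes at x are skipped when coordinates are handed out. The
  coordinates in use at x then form an initial segment of the naturals, so the fibre at x depends
  only on its dimension, and equal dimensions mean equal fibres.\<close>

definition rank :: "nat \<Rightarrow> cantor \<Rightarrow> nat" where
  "rank n x = card {m. m < n \<and> 0 < f m x}"

definition act :: "cantor \<Rightarrow> nat set" where
  "act x = {rank n x | n. 0 < f n x}"

abbreviation V :: "cantor \<Rightarrow> cell2 set" where
  "V x \<equiv> csupp (act x)"

lemma rank_Suc: "rank (Suc n) x = rank n x + (if 0 < f n x then 1 else 0)"
proof -
  have "{m. m < Suc n \<and> 0 < f m x} = {m. m < n \<and> 0 < f m x} \<union> (if 0 < f n x then {n} else {})"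
    by (auto simp: less_Suc_eq)
  then show ?thesis by (simp add: rank_def)
qed

lemma rank_0 [simp]: "rank 0 x = 0"
  by (simp add: rank_def)

lemma rank_strict: "m < n \<Longrightarrow> 0 < f m x \<Longrightarrow> rank m x < rank n x"
  unfolding rank_def by (rule psubset_card_mono) auto

lemma rank_inj: "0 < f m x \<Longrightarrow> 0 < f n x \<Longrightarrow> rank m x = rank n x \<Longrightarrow> m = n"
  using rank_strict[of m n x] rank_strict[of n m x] by (cases m n rule: linorder_cases) auto

lemma below_rank_act: "i < rank n x \<Longrightarrow> i \<in> act x"
proof (induction n)
  case (Suc n)
  then show ?case by (auto simp: rank_Suc act_def less_Suc_eq split: if_splits)
qed simp

lemma act_down: "j \<in> act x \<Longrightarrow> i < j \<Longrightarrow> i \<in> act x"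
  using below_rank_act by (auto simp: act_def)

lemma act_0: "0 \<in> act x"
proof -
  obtain n where "0 < f n x" using f_pos by blast
  then have "rank n x \<in> act x" by (auto simp: act_def)
  then show ?thesis using act_down by (cases "rank n x") auto
qed

lemma rank_check: "rank n (check x) = rank n x" and act_check: "act (check x) = act x"
  by (simp_all add: rank_def act_def f_check)

lemma rank_measurable: "rank n \<in> measurable borel (count_space UNIV)"
proof (induction n)
  case (Suc n)
  have "(\<lambda>x. rank n x + (if 0 < f n x then 1 else 0)) \<in> measurable borel (count_space UNIV)"
    using Suc by measurable
  then show ?case by (simp only: rank_Suc[abs_def])
qed simp

lemma act_measurable: "{x. j \<in> act x} \<in> sets borel"
proof -
  have "{x. j \<in> act x} = (\<Union>n. {x \<in> space borel. 0 < f n x} \<inter> (rank n -` {j} \<inter> space borel))"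
    by (auto simp: act_def)
  also have "\<dots> \<in> sets borel"
  proof (rule sets.countable_UN)
    have "{x \<in> space borel. 0 < f n x} \<inter> (rank n -` {j} \<inter> space borel) \<in> sets borel" for n
    proof (rule sets.Int)
      show "{x \<in> space borel. 0 < f n x} \<in> sets borel" by measurable
      show "rank n -` {j} \<inter> space borel \<in> sets borel"
        by (rule measurable_sets[OF rank_measurable]) simp
    qed
    then show "range (\<lambda>n. {x \<in> space borel. 0 < f n x} \<inter> (rank n -` {j} \<inter> space borel)) \<subseteq> sets borel"
      by blast
  qed
  finally show ?thesis .
qed

definition F :: "nat \<Rightarrow> cantor \<Rightarrow> cell2" where
  "F n x = sqrt (f n x) *\<^sub>R eps (rank n x)"

lemma F_measurable: "F n \<in> borel_measurable borel"
proof -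
  have "(\<lambda>x. eps (rank n x)) \<in> borel_measurable borel"
    by (rule measurable_compose[OF rank_measurable[of n], of eps]) simp
  moreover have "(\<lambda>x. sqrt (f n x)) \<in> borel_measurable borel" by measurable
  ultimately show ?thesis unfolding F_def[abs_def] by (intro borel_measurable_scaleR)
qed

text \<open>Distinct generators active at x have distinct ranks, so the sections are orthogonal at
  every point; the square root makes the squared norm equal to the spectral density.\<close>

lemma F_inner: "F n x \<bullet> F m x = (if n = m then f n x else 0)" "F n x \<bullet> ic (F m x) = 0"
  using f_nonneg[of n x] f_nonneg[of m x] rank_inj[of n x m]
  by (auto simp: F_def ic_linear eps_orthonormal less_le)

lemma F_L2: "L2 (F n)"
proof -
  have "(norm (F n x))\<^sup>2 = f n x" for x using F_inner[of n x n] by (simp add: power2_norm_eq_inner)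
  then show ?thesis using F_measurable f_integrable by (simp add: L2_def)
qed

lemma F_supp: "F n x \<in> V x"
proof (cases "f n x = 0")
  case False
  then have "rank n x \<in> act x" using f_nonneg[of n x] by (auto simp: act_def less_le)
  then show ?thesis unfolding F_def by (intro subspace_scale subspace_csupp eps_csupp)
qed (simp add: F_def subspace_0 subspace_csupp)

lemma F_check: "cx_conj (F n (check x)) = F n x"
  by (simp add: F_def cx_conj_simps f_check rank_check)

text \<open>The intended spectral transform on the real span of the vectors obtained from the e n by
  i and the S k, given as a graph. A relation presupposes no well-definedness: one vector may have
  several expressions, and \<open>comb_ip\<close> later shows that their sections agree almost
  everywhere.\<close>

inductive comb :: "'v \<Rightarrow> (cantor \<Rightarrow> cell2) \<Rightarrow> bool" where
  comb_e: "comb (e n) (F n)"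
| comb_add: "comb v g \<Longrightarrow> comb w h \<Longrightarrow> comb (v + w) (\<lambda>x. g x + h x)"
| comb_scaleR: "comb v g \<Longrightarrow> comb (r *\<^sub>R v) (\<lambda>x. r *\<^sub>R g x)"
| comb_Jc: "comb v g \<Longrightarrow> comb (Jc v) (\<lambda>x. ic (g x))"
| comb_S: "comb v g \<Longrightarrow> comb (S k v) (\<lambda>x. bsgn (x k) *\<^sub>R g x)"

lemma comb_L2: "comb v g \<Longrightarrow> L2 g"
  by (induction rule: comb.induct) (auto intro: F_L2 L2_add L2_scaleR L2_ic L2_bsgn)

lemma comb_supp: "comb v g \<Longrightarrow> g x \<in> V x"
  by (induction rule: comb.induct)
     (auto intro: F_supp subspace_add subspace_scale subspace_csupp ic_csupp)

lemma comb_diff: "comb v g \<Longrightarrow> comb w h \<Longrightarrow> comb (v - w) (\<lambda>x. g x - h x)"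
  using comb_add[OF _ comb_scaleR[of w h "-1"], of v g] by simp

text \<open>No weight appears, since \<mu>, the densities and the ranks are check-invariant. The
  sign in K S_k = - S_k K is the sign change of \<open>bsgn\<close> under
  \<open>check\<close>.\<close>

lemma comb_K: "comb v g \<Longrightarrow> comb (K v) (\<lambda>x. cx_conj (g (check x)))"
proof (induction rule: comb.induct)
  case (comb_e n)
  then show ?case using comb.comb_e[of n] by (simp add: K_e F_check)
next
  case (comb_add v g w h)
  then show ?case using comb.comb_add by (simp add: K_add cx_conj_simps)
next
  case (comb_scaleR v g r)
  then show ?case using comb.comb_scaleR by (simp add: K_scaleR cx_conj_simps)
next
  case (comb_Jc v g)
  then show ?case using comb.comb_scaleR[OF comb.comb_Jc[OF comb_Jc.IH], of "-1"]
    by (simp add: K_Jc cx_conj_simps)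
next
  case (comb_S v g k)
  have "bsgn (check x k) = - bsgn (x k)" for x
    using chi_check[of "[k]" x] by simp
  then show ?case using comb.comb_scaleR[OF comb.comb_S[OF comb_S.IH, of k], of "-1"]
    by (simp add: K_S cx_conj_simps)
qed

text \<open>Both formulas are proved together and for all words L, because the \<open>S k\<close>
  step lengthens L and the \<open>Jc\<close> step exchanges the two formulas.\<close>

lemma comb_inner_F:
  assumes "comb w h"
  shows "(\<integral>x. chi L x * (F n x \<bullet> h x) \<partial>\<mu>) = Sp L (e n) \<bullet> w"
    and "(\<integral>x. chi L x * (F n x \<bullet> ic (h x)) \<partial>\<mu>) = Sp L (e n) \<bullet> Jc w"
proof -
  have int: "integrable \<mu> (\<lambda>x. chi L x * (F n x \<bullet> h x))" if "L2 h" for L n h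
    using L2_inner_integrable[OF L2_char[OF F_L2, of L n] that] by simp
  have "(\<forall>L. (\<integral>x. chi L x * (F n x \<bullet> h x) \<partial>\<mu>) = Sp L (e n) \<bullet> w) \<and>
      (\<forall>L. (\<integral>x. chi L x * (F n x \<bullet> ic (h x)) \<partial>\<mu>) = Sp L (e n) \<bullet> Jc w)"
    using assms
  proof (induction rule: comb.induct)
    case (comb_e m)
    \<comment> \<open>A self-adjoint operator commuting with i has real diagonal values; this is the
      vanishing of their imaginary part.\<close>
    have "Sp L (e n) \<bullet> Jc (e n) = 0" for L
    proof -
      have "Sp L (e n) \<bullet> Jc (e n) = e n \<bullet> Jc (Sp L (e n))" by (simp add: Sp_selfadjoint Sp_Jc)
      also have "\<dots> = - (Sp L (e n) \<bullet> Jc (e n))" by (metis Jc_skew inner_commute)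
      finally show ?thesis by simp
    qed
    then show ?case by (cases "n = m") (simp_all add: F_inner f_char e_orth)
  next
    case (comb_add v g w h)
    then show ?case
      using int[OF comb_L2] int[OF L2_ic[OF comb_L2]]
      by (simp add: inner_add_right ring_distribs ic_linear scaleC_add_right)
  next
    case (comb_scaleR v g r)
    then show ?case by (simp add: ic_linear linear_scale[OF Jc_linear] mult.left_commute)
  next
    case (comb_Jc v g)
    then show ?case by simp
  next
    case (comb_S v g k)
    show ?case
    proof (intro conjI allI)
      fix L
      have 1: "(\<lambda>x. chi L x * (F n x \<bullet> (bsgn (x k) *\<^sub>R g x))) =
          (\<lambda>x. chi (k # L) x * (F n x \<bullet> g x))"
        and 2: "(\<lambda>x. chi L x * (F n x \<bullet> ic (bsgn (x k) *\<^sub>R g x))) =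
          (\<lambda>x. chi (k # L) x * (F n x \<bullet> ic (g x)))"
        by (simp_all add: fun_eq_iff ic_linear)
      show "(\<integral>x. chi L x * (F n x \<bullet> (bsgn (x k) *\<^sub>R g x)) \<partial>\<mu>) = Sp L (e n) \<bullet> S k v"
        unfolding 1 comb_S.IH[THEN conjunct1, rule_format] by (simp add: S_selfadjoint)
      show "(\<integral>x. chi L x * (F n x \<bullet> ic (bsgn (x k) *\<^sub>R g x)) \<partial>\<mu>) = Sp L (e n) \<bullet> Jc (S k v)"
        unfolding 2 comb_S.IH[THEN conjunct2, rule_format] by (simp add: S_selfadjoint S_Jc)
    qed
  qed
  then show "(\<integral>x. chi L x * (F n x \<bullet> h x) \<partial>\<mu>) = Sp L (e n) \<bullet> w"
    "(\<integral>x. chi L x * (F n x \<bullet> ic (h x)) \<partial>\<mu>) = Sp L (e n) \<bullet> Jc w" by blast+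
qed

text \<open>Induction on the first argument: each operator is moved to the second one by its adjoint
  until a generator remains, where \<open>comb_inner_F\<close> for the empty word applies.\<close>

lemma comb_ip: "comb v g \<Longrightarrow> comb w h \<Longrightarrow> ip g h = v \<bullet> w"
proof (induction arbitrary: w h rule: comb.induct)
  case (comb_e n)
  then show ?case using comb_inner_F(1)[of w h "[]" n] by (simp add: ip_def)
next
  case (comb_add v g v' g')
  then show ?case by (simp add: ip_add_left comb_L2 inner_add_left)
next
  case (comb_scaleR v g r)
  then show ?case by (simp add: ip_scaleR_left)
next
  case (comb_Jc v g)
  have "ip (\<lambda>x. ic (g x)) h = - ip g (\<lambda>x. ic (h x))" by (simp add: ip_def ic_skew)
  then show ?case using comb_Jc.IH[OF comb.comb_Jc[OF comb_Jc.prems]] by (simp add: Jc_skew)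
next
  case (comb_S v g k)
  have "ip (\<lambda>x. bsgn (x k) *\<^sub>R g x) h = ip g (\<lambda>x. bsgn (x k) *\<^sub>R h x)" by (simp add: ip_def)
  then show ?case using comb_S.IH[OF comb.comb_S[OF comb_S.prems]] by (simp add: S_selfadjoint)
qed

lemma comb_dense: "closure {v. \<exists>g. comb v g} = UNIV"
proof -
  let ?D = "{v. \<exists>g. comb v g}"
  have sub: "subspace ?D"
  proof (rule subspaceI)
    show "0 \<in> ?D" using comb_scaleR[OF comb_e, of 0] by auto
    show "v + w \<in> ?D" if "v \<in> ?D" "w \<in> ?D" for v w
      using that comb_add[of v _ w] by fast
    show "r *\<^sub>R v \<in> ?D" if "v \<in> ?D" for v r
      using that comb_scaleR[of v _ r] by fast
  qed
  have image: "F v \<in> closure ?D" if "v \<in> closure ?D" "bounded_linear F" "\<And>v g. comb v g \<Longrightarrow> \<exists>g. comb (F v) g"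
    for F :: "'v \<Rightarrow> 'v" and v
  proof -
    have "F ` closure ?D \<subseteq> closure (F ` ?D)"
      by (rule closure_bounded_linear_image_subset[OF that(2)])
    also have "\<dots> \<subseteq> closure ?D" by (rule closure_mono) (use that(3) in auto)
    finally show ?thesis using that(1) by blast
  qed
  have "inv_subspace (closure ?D)"
    unfolding inv_subspace_def
  proof (intro conjI allI ballI)
    show "Jc v \<in> closure ?D" if "v \<in> closure ?D" for v
      by (rule image[OF that isometry_bounded_linear[OF Jc_linear norm_Jc]]) (rule exI, rule comb_Jc)
    show "S k v \<in> closure ?D" if "v \<in> closure ?D" for v k
      by (rule image[OF that isometry_bounded_linear[OF S_linear S_norm]]) (rule exI, rule comb_S)
  qed (use sub in \<open>auto intro: subspace_closure\<close>)
  moreover have "range e \<subseteq> closure ?D" using comb_e closure_subset[of ?D] by auto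
  ultimately have "inv_subspace hull (range e) \<subseteq> closure ?D"
    by (intro hull_minimal[where S = inv_subspace])
  then show ?thesis using e_total by blast
qed

end

section \<open>The spectral representation\<close>

context spectral_model
begin

abbreviation sqdist :: "(cantor \<Rightarrow> cell2) \<Rightarrow> (cantor \<Rightarrow> cell2) \<Rightarrow> real" where
  "sqdist g h \<equiv> ip (\<lambda>x. g x - h x) (\<lambda>x. g x - h x)"

text \<open>The closure of the graph \<open>comb\<close>, in norm on the left and in square mean on
  the right.\<close>

definition rel :: "'v \<Rightarrow> (cantor \<Rightarrow> cell2) \<Rightarrow> bool" where
  "rel v g \<longleftrightarrow> L2 g \<and> (\<exists>w h. (\<forall>m. comb (w m) (h m)) \<and> w \<longlonglongrightarrow> v \<and>
     (\<lambda>m. sqdist g (h m)) \<longlonglongrightarrow> 0)"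

lemma relE:
  assumes "rel v g"
  obtains w h where "L2 g" "\<And>m. comb (w m) (h m)" "w \<longlonglongrightarrow> v"
    "(\<lambda>m. sqdist g (h m)) \<longlonglongrightarrow> 0"
  using assms unfolding rel_def by blast

lemma relI:
  assumes "L2 g" "\<And>m. comb (w m) (h m)" "w \<longlonglongrightarrow> v"
    "(\<lambda>m. sqdist g (h m)) \<longlonglongrightarrow> 0"
  shows "rel v g"
  unfolding rel_def using assms by (intro conjI exI[of _ w] exI[of _ h] allI)

lemma rel_L2: "rel v g \<Longrightarrow> L2 g"
  by (simp add: rel_def)

lemma rel_comb: assumes "comb v g" shows "rel v g"
  by (rule relI[of g "\<lambda>_. v" "\<lambda>_. g"]) (use assms comb_L2 in \<open>auto simp: ip_def\<close>)

lemma rel_ip_self: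
  assumes "rel v g" shows "ip g g = v \<bullet> v"
proof -
  obtain w h where g: "L2 g" and c: "\<And>m. comb (w m) (h m)" and w: "w \<longlonglongrightarrow> v"
    and lim: "(\<lambda>m. sqdist g (h m)) \<longlonglongrightarrow> 0"
    using assms by (rule relE) blast
  let ?d = "\<lambda>m x. g x - h m x"
  have h: "L2 (h m)" and d: "L2 (?d m)" for m using comb_L2[OF c] g by (auto intro: L2_diff)
  \<comment> \<open>Writes g as h m plus an error and expands; the cross term tends to zero by
    Cauchy-Schwarz because the norms of the w m stay bounded.\<close>
  have eq: "ip g g = w m \<bullet> w m + 2 * ip (h m) (?d m) + ip (?d m) (?d m)" for m
  proof -
    have "ip g g = ip (\<lambda>x. h m x + ?d m x) (\<lambda>x. h m x + ?d m x)" by simp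
    also have "\<dots> = ip (h m) (h m) + 2 * ip (h m) (?d m) + ip (?d m) (?d m)"
      unfolding ip_add_left[OF h d L2_add[OF h d]] ip_add_right[OF h d h] ip_add_right[OF h d d]
      by (simp add: ip_commute[of "?d m" "h m"])
    finally show ?thesis using comb_ip[OF c c] by simp
  qed
  have "(\<lambda>m. ip (h m) (?d m)) \<longlonglongrightarrow> 0"
  proof (rule Lim_null_comparison)
    show "\<forall>\<^sub>F m in sequentially. norm (ip (h m) (?d m)) \<le> sqrt (w m \<bullet> w m) * sqrt (ip (?d m) (?d m))"
      using ip_Cauchy_Schwarz[OF h d] comb_ip[OF c c] by (intro always_eventually) simp
    have "(\<lambda>m. sqrt (w m \<bullet> w m) * sqrt (ip (?d m) (?d m))) \<longlonglongrightarrow> sqrt (v \<bullet> v) * sqrt 0"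
      by (intro tendsto_intros w lim)
    then show "(\<lambda>m. sqrt (w m \<bullet> w m) * sqrt (ip (?d m) (?d m))) \<longlonglongrightarrow> 0" by simp
  qed
  then have "(\<lambda>m. w m \<bullet> w m + 2 * ip (h m) (?d m) + ip (?d m) (?d m)) \<longlonglongrightarrow> v \<bullet> v + 2 * 0 + 0"
    by (intro tendsto_intros w lim)
  then have "(\<lambda>m. ip g g) \<longlonglongrightarrow> v \<bullet> v" unfolding eq[symmetric] by simp
  then show ?thesis by (simp add: LIMSEQ_const_iff)
qed

lemma rel_add:
  assumes "rel v g" "rel v' g'" shows "rel (v + v') (\<lambda>x. g x + g' x)"
proof -
  obtain w h where 1: "L2 g" "\<And>m. comb (w m) (h m)" "w \<longlonglongrightarrow> v"
    "(\<lambda>m. sqdist g (h m)) \<longlonglongrightarrow> 0"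
    using assms(1) by (rule relE) blast
  obtain w' h' where 2: "L2 g'" "\<And>m. comb (w' m) (h' m)" "w' \<longlonglongrightarrow> v'"
    "(\<lambda>m. sqdist g' (h' m)) \<longlonglongrightarrow> 0"
    using assms(2) by (rule relE) blast
  let ?d = "\<lambda>m x. g x - h m x" and ?d' = "\<lambda>m x. g' x - h' m x"
  let ?s = "\<lambda>m x. g x + g' x - (h m x + h' m x)"
  have L: "L2 (?d m)" "L2 (?d' m)" "L2 (?s m)" for m
    by (intro L2_diff L2_add 1(1) 2(1) comb_L2[OF 1(2)] comb_L2[OF 2(2)])+
  have "(\<lambda>m. ip (?s m) (?s m)) \<longlonglongrightarrow> 0"
  proof (rule Lim_null_comparison)
    have "ip (?s m) (?s m) \<le> 2 * ip (?d m) (?d m) + 2 * ip (?d' m) (?d' m)" for m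
    proof -
      have "ip (?s m) (?s m) \<le> (\<integral>x. 2 * (norm (?d m x))\<^sup>2 + 2 * (norm (?d' m x))\<^sup>2 \<partial>\<mu>)"
        unfolding ip_self
      proof (rule integral_mono)
        show "(norm (?s m x))\<^sup>2 \<le> 2 * (norm (?d m x))\<^sup>2 + 2 * (norm (?d' m x))\<^sup>2" for x
          using norm_add_sq_le[of "?d m x" "?d' m x"] by (simp add: algebra_simps)
      qed (use L in \<open>auto simp: L2_def intro!: Bochner_Integration.integrable_add integrable_mult_right\<close>)
      also have "\<dots> = 2 * ip (?d m) (?d m) + 2 * ip (?d' m) (?d' m)"
        unfolding ip_self using L
        by (subst Bochner_Integration.integral_add) (auto simp: L2_def intro!: integrable_mult_right)
      finally show ?thesis .
    qed
    then show "\<forall>\<^sub>F m in sequentially. norm (ip (?s m) (?s m)) \<le> 2 * ip (?d m) (?d m) + 2 * ip (?d' m) (?d' m)"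
      by (intro always_eventually) simp
    have "(\<lambda>m. 2 * ip (?d m) (?d m) + 2 * ip (?d' m) (?d' m)) \<longlonglongrightarrow> 2 * 0 + 2 * 0"
      by (intro tendsto_intros 1 2)
    then show "(\<lambda>m. 2 * ip (?d m) (?d m) + 2 * ip (?d' m) (?d' m)) \<longlonglongrightarrow> 0" by simp
  qed
  then show ?thesis
    by (intro relI[of _ "\<lambda>m. w m + w' m" "\<lambda>m x. h m x + h' m x"])
       (auto intro!: L2_add 1 2 comb_add tendsto_add)
qed

text \<open>Passes to the closure any operator whose counterpart on sections multiplies squared
  norms by a constant. That constant is r * r for \<open>rel_scaleR\<close> and 1 for the
  isometries.\<close>

lemma rel_map:
  assumes g: "rel v g" and A: "bounded_linear A"
    and comb: "\<And>w h. comb w h \<Longrightarrow> comb (A w) (B h)"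
    and L2: "\<And>h. L2 h \<Longrightarrow> L2 (B h)"
    and ip: "\<And>h. L2 h \<Longrightarrow> ip (B h) (B h) = c * ip h h"
    and diff: "\<And>h h'. B (\<lambda>x. h x - h' x) = (\<lambda>x. B h x - B h' x)"
  shows "rel (A v) (B g)"
proof -
  obtain w h where 1: "L2 g" "\<And>m. comb (w m) (h m)" "w \<longlonglongrightarrow> v"
    "(\<lambda>m. sqdist g (h m)) \<longlonglongrightarrow> 0"
    using g by (rule relE) blast
  show ?thesis
  proof (rule relI)
    show "L2 (B g)" by (intro L2 1)
    show "comb (A (w m)) (B (h m))" for m by (intro comb 1)
    show "(\<lambda>m. A (w m)) \<longlonglongrightarrow> A v" by (rule bounded_linear.tendsto[OF A 1(3)])
    have "L2 (\<lambda>x. g x - h m x)" for m by (intro L2_diff 1(1) comb_L2[OF 1(2)])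
    then have "sqdist (B g) (B (h m)) = c * sqdist g (h m)" for m
      unfolding diff[symmetric] by (rule ip)
    then show "(\<lambda>m. sqdist (B g) (B (h m))) \<longlonglongrightarrow> 0"
      using tendsto_mult_left[OF 1(4), of c] by simp
  qed
qed

lemma rel_scaleR: "rel v g \<Longrightarrow> rel (r *\<^sub>R v) (\<lambda>x. r *\<^sub>R g x)"
  by (rule rel_map[where A = "\<lambda>v. r *\<^sub>R v" and B = "\<lambda>g x. r *\<^sub>R g x" and c = "r * r"])
     (auto intro: bounded_linear_scaleR_right comb_scaleR L2_scaleR simp: ip_scaleR_left ip_scaleR_right algebra_simps)

lemma rel_Jc: "rel v g \<Longrightarrow> rel (Jc v) (\<lambda>x. ic (g x))"
  by (rule rel_map[where A = Jc and B = "\<lambda>g x. ic (g x)" and c = 1])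
     (auto intro: isometry_bounded_linear Jc_linear comb_Jc L2_ic simp: ip_self ic_linear)

lemma rel_S: "rel v g \<Longrightarrow> rel (S k v) (\<lambda>x. bsgn (x k) *\<^sub>R g x)"
  by (rule rel_map[where A = "S k" and B = "\<lambda>g x. bsgn (x k) *\<^sub>R g x" and c = 1])
     (auto intro: isometry_bounded_linear S_linear S_norm comb_S L2_bsgn simp: ip_def algebra_simps)

lemma check_mu: "check \<in> measurable \<mu> borel"
  using check_borel by (simp add: measurable_mu)

lemma integral_check:
  assumes "h \<in> borel_measurable borel" shows "(\<integral>x. h (check x) \<partial>\<mu>) = (\<integral>x. h x \<partial>\<mu> :: real)"
  using integral_distr[OF check_mu assms] by (simp add: mu_check)

lemma AE_check: assumes "AE x in \<mu>. p x" shows "AE x in \<mu>. p (check x)"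
proof -
  have "AE x in distr \<mu> borel check. p x" by (subst mu_check) (rule assms)
  then show ?thesis by (rule AE_distrD[OF check_mu])
qed

lemma L2_conj_check: assumes "L2 h" shows "L2 (\<lambda>x. cx_conj (h (check x)))"
  unfolding L2_def
proof
  have h: "h \<in> borel_measurable borel" and int: "integrable \<mu> (\<lambda>x. (norm (h x))\<^sup>2)"
    using assms by (auto simp: L2_def)
  show "(\<lambda>x. cx_conj (h (check x))) \<in> borel_measurable borel"
    by (rule measurable_compose[OF measurable_compose[OF check_borel h] cx_conj_measurable])
  have "integrable (distr \<mu> borel check) (\<lambda>x. (norm (h x))\<^sup>2)" using int by (simp add: mu_check)
  then show "integrable \<mu> (\<lambda>x. (norm (cx_conj (h (check x))))\<^sup>2)"
    using integrable_distr[OF check_mu] by simp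
qed

lemma rel_K: "rel v g \<Longrightarrow> rel (K v) (\<lambda>x. cx_conj (g (check x)))"
proof (rule rel_map[where A = K and B = "\<lambda>g x. cx_conj (g (check x))" and c = 1])
  fix h assume "L2 h"
  then have [measurable]: "h \<in> borel_measurable borel" by (rule L2_measurable)
  have "(\<lambda>x. (norm (h x))\<^sup>2) \<in> borel_measurable borel" by measurable
  from integral_check[OF this]
  show "ip (\<lambda>x. cx_conj (h (check x))) (\<lambda>x. cx_conj (h (check x))) = 1 * ip h h"
    by (simp add: ip_self)
qed (auto intro: isometry_bounded_linear K_linear K_norm comb_K L2_conj_check simp: cx_conj_simps)

lemma rel_diff: "rel v g \<Longrightarrow> rel w h \<Longrightarrow> rel (v - w) (\<lambda>x. g x - h x)"
  using rel_add[of v g "(-1) *\<^sub>R w" "\<lambda>x. (-1) *\<^sub>R h x"] rel_scaleR[of w h "-1"] by simp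

lemma rel_unique: assumes "rel v g" "rel v h" shows "AE x in \<mu>. g x = h x"
proof -
  have "rel 0 (\<lambda>x. g x - h x)" using rel_diff[OF assms] by simp
  then have "AE x in \<mu>. g x - h x = 0" using rel_ip_self rel_L2 by (intro ip_self_zero) auto
  then show ?thesis by simp
qed

lemma rel_ip: assumes "rel v g" "rel w h" shows "ip g h = v \<bullet> w"
proof -
  have L: "L2 g" "L2 h" using assms by (auto intro: rel_L2)
  have "ip (\<lambda>x. g x + h x) (\<lambda>x. g x + h x) = (v + w) \<bullet> (v + w)"
    by (rule rel_ip_self) (rule rel_add[OF assms])
  then have "ip g g + ip h h + 2 * ip g h = v \<bullet> v + w \<bullet> w + 2 * (v \<bullet> w)"
    using L by (simp add: ip_add_left ip_add_right L2_add inner_add_left inner_add_right ip_commute[of h g] inner_commute)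
  then show ?thesis using rel_ip_self[OF assms(1)] rel_ip_self[OF assms(2)] by simp
qed

text \<open>A rapidly converging sequence of combinations has a section limit almost everywhere, and
  since the fibres are closed the limit takes values in them.\<close>

lemma rel_exists: "\<exists>g. rel v g \<and> (AE x in \<mu>. g x \<in> V x)"
proof -
  \<comment> \<open>The extra factor 1/2 bounds the distance of the terms m and k by (1/2)^m, whose
    square is the rate (1/4)^m that \<open>L2_Cauchy_limit\<close> asks for.\<close>
  have "\<exists>w. (\<exists>h. comb w h) \<and> dist w v < (1/2)^m / 2" for m
  proof -
    have "v \<in> closure {v. \<exists>g. comb v g}" by (simp add: comb_dense)
    moreover have "(1/2)^m / 2 > (0::real)" by simp
    ultimately show ?thesis unfolding closure_approachable by blast
  qed
  then obtain w h where c: "\<And>m. comb (w m) (h m)" and w: "\<And>m. dist (w m) v < (1/2)^m / 2" by metis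
  have hL: "L2 (h m)" and hm: "h m \<in> borel_measurable \<mu>" for m
    using comb_L2[OF c] by (auto simp: L2_def measurable_mu)
  have ball: "norm (w k - w m) \<le> (1/2)^m" if "m \<le> k" for m k
  proof -
    have "(1/2::real)^k \<le> (1/2)^m" using that by (intro power_decreasing) auto
    then show ?thesis
      using w[of k] w[of m] dist_triangle2[of "w k" "w m" v] unfolding dist_norm by linarith
  qed
  have fast: "(\<integral>\<^sup>+x. ennreal ((norm (h k x - h m x))\<^sup>2) \<partial>\<mu>) \<le> ennreal ((1/4)^m)" if "m \<le> k" for m k
  proof -
    have d: "comb (w k - w m) (\<lambda>x. h k x - h m x)" by (rule comb_diff[OF c c])
    have "(\<integral>\<^sup>+x. ennreal ((norm (h k x - h m x))\<^sup>2) \<partial>\<mu>) = ennreal (sqdist (h k) (h m))"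
      unfolding ip_self using comb_L2[OF d] by (intro nn_integral_eq_integral) (auto simp: L2_def)
    also have "sqdist (h k) (h m) = (norm (w k - w m))\<^sup>2"
      using comb_ip[OF d d] by (simp add: power2_norm_eq_inner)
    also have "\<dots> \<le> ((1/2)^m)\<^sup>2" using ball[OF that] by (intro power_mono) auto
    also have "\<dots> = (1/4)^m" by (simp add: power2_eq_square flip: power_mult_distrib)
    finally show ?thesis by (simp add: ennreal_leI)
  qed
  obtain g where g: "g \<in> borel_measurable \<mu>" and conv: "AE x in \<mu>. (\<lambda>m. h m x) \<longlonglongrightarrow> g x"
    and le: "\<And>m. (\<integral>\<^sup>+x. ennreal ((norm (g x - h m x))\<^sup>2) \<partial>\<mu>) \<le> ennreal ((1/4)^m)"
  proof (rule L2_Cauchy_limit[OF finite_measure_axioms hm fast])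
    fix g
    assume 1: "g \<in> borel_measurable \<mu>" and 2: "AE x in \<mu>. (\<lambda>m. h m x) \<longlonglongrightarrow> g x"
      and 3: "\<And>m. (\<integral>\<^sup>+x. ennreal ((norm (g x - h m x))\<^sup>2) \<partial>\<mu>) \<le> ennreal ((1/4)^m)"
    show thesis by (rule that[OF 1 2 3])
  qed
  have dL: "L2 (\<lambda>x. g x - h m x)" for m
    unfolding L2_def
  proof
    show m: "(\<lambda>x. g x - h m x) \<in> borel_measurable borel"
      using g hm[of m] by (auto simp: measurable_mu intro: borel_measurable_diff)
    show "integrable \<mu> (\<lambda>x. (norm (g x - h m x))\<^sup>2)"
    proof (rule integrableI_bounded)
      show "(\<lambda>x. (norm (g x - h m x))\<^sup>2) \<in> borel_measurable \<mu>"
        unfolding measurable_mu using m by measurable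
      show "(\<integral>\<^sup>+x. ennreal (norm ((norm (g x - h m x))\<^sup>2)) \<partial>\<mu>) < \<infinity>"
        using le[of m] by (simp add: le_less_trans)
    qed
  qed
  have ip_le: "sqdist g (h m) \<le> (1/4)^m" for m
  proof -
    have "ennreal (sqdist g (h m)) = (\<integral>\<^sup>+x. ennreal ((norm (g x - h m x))\<^sup>2) \<partial>\<mu>)"
      unfolding ip_self using dL[of m] by (intro nn_integral_eq_integral[symmetric]) (auto simp: L2_def)
    then have "ennreal (sqdist g (h m)) \<le> ennreal ((1/4)^m)"
      using le[of m] by (simp only:)
    then show ?thesis by (subst (asm) ennreal_le_iff) auto
  qed
  have gL: "L2 g" using L2_add[OF dL[of 0] hL[of 0]] by simp
  have "rel v g"
  proof (rule relI[OF gL c])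
    have z: "(\<lambda>m. (1/2::real)^m / 2) \<longlonglongrightarrow> 0 / 2" by (intro tendsto_intros LIMSEQ_power_zero) auto
    show "w \<longlonglongrightarrow> v"
      by (rule metric_tendsto_imp_tendsto[OF z]) (use w in \<open>auto intro!: always_eventually less_imp_le simp: dist_norm\<close>)
    have "(\<lambda>m. (1/4::real)^m) \<longlonglongrightarrow> 0" by (intro LIMSEQ_power_zero) auto
    then show "(\<lambda>m. sqdist g (h m)) \<longlonglongrightarrow> 0"
      by (rule Lim_null_comparison[rotated]) (use ip_le in \<open>auto intro!: always_eventually\<close>)
  qed
  moreover have "AE x in \<mu>. g x \<in> V x"
    using conv
  proof eventually_elim
    case (elim x)
    show ?case by (rule closed_sequentially[OF closed_csupp _ elim]) (rule comb_supp[OF c])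
  qed
  ultimately show ?thesis by blast
qed

text \<open>A representative is chosen for each vector separately, so every algebraic identity of T
  holds off a null set that depends on the vectors in it.\<close>

definition T :: "'v \<Rightarrow> cantor \<Rightarrow> cell2" where
  "T v = (SOME g. rel v g \<and> (AE x in \<mu>. g x \<in> V x))"

lemma rel_T: "rel v (T v)" and T_supp: "AE x in \<mu>. T v x \<in> V x"
  using someI_ex[OF rel_exists[of v]] by (simp_all add: T_def)

lemma T_L2: "L2 (T v)"
  by (rule rel_L2[OF rel_T])

lemma T_ip: "ip (T v) (T w) = v \<bullet> w"
  by (rule rel_ip[OF rel_T rel_T])

lemma T_add: "AE x in \<mu>. T (v + w) x = T v x + T w x"
  by (rule rel_unique[OF rel_T rel_add[OF rel_T rel_T]])

lemma T_scaleR: "AE x in \<mu>. T (r *\<^sub>R v) x = r *\<^sub>R T v x"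
  by (rule rel_unique[OF rel_T rel_scaleR[OF rel_T]])

lemma T_Jc: "AE x in \<mu>. T (Jc v) x = ic (T v x)"
  by (rule rel_unique[OF rel_T rel_Jc[OF rel_T]])

lemma T_S: "AE x in \<mu>. T (S k v) x = bsgn (x k) *\<^sub>R T v x"
  by (rule rel_unique[OF rel_T rel_S[OF rel_T]])

lemma T_K: "AE x in \<mu>. T (K v) x = cx_conj (T v (check x))"
  by (rule rel_unique[OF rel_T rel_K[OF rel_T]])

lemma T_e: "AE x in \<mu>. T (e n) x = F n x"
  by (rule rel_unique[OF rel_T rel_comb[OF comb_e]])

lemma T_Sp: "AE x in \<mu>. T (Sp L v) x = chi L x *\<^sub>R T v x"
proof (induction L)
  case (Cons k L)
  then show ?case using T_S[of k "Sp L v"] by eventually_elim simp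
qed simp

text \<open>Orthogonality to T of all words applied to e n says that the function
  \<open>F n x \<bullet> g x\<close> has vanishing characters, so it is zero almost everywhere; the
  same holds for \<open>ic (g x)\<close>. At active n the values \<open>F n x\<close> are nonzero
  multiples of the basis vectors of the fibre, so g vanishes.\<close>

lemma T_complete:
  assumes g: "L2 g" and supp: "AE x in \<mu>. g x \<in> V x"
    and orth: "\<And>v. ip (T v) g = 0"
  shows "AE x in \<mu>. g x = 0"
proof -
  have fin: "finite_measure \<mu>" by (rule finite_measure_axioms)
  have A: "AE x in \<mu>. F n x \<bullet> h x = 0" if h: "L2 h" and orth: "\<And>v. ip (T v) h = 0" for n h
  proof (rule integral_zero_of_characters[OF fin sets_mu L2_inner_integrable[OF F_L2 h]])
    fix L
    have "ip (T (Sp L (e n))) h = ip (\<lambda>x. chi L x *\<^sub>R F n x) h"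
    proof (rule ip_cong_AE[OF T_L2 L2_char[OF F_L2] h h])
      show "AE x in \<mu>. T (Sp L (e n)) x = chi L x *\<^sub>R F n x"
        using T_Sp[of L "e n"] T_e[of n] by eventually_elim simp
    qed simp
    then show "(\<integral>x. chi L x * (F n x \<bullet> h x) \<partial>\<mu>) = 0"
      using orth[of "Sp L (e n)"] by (simp add: ip_def)
  qed
  have "ip (T v) (\<lambda>x. ic (g x)) = 0" for v
  proof -
    have "ip (T v) (\<lambda>x. ic (g x)) = - ip (\<lambda>x. ic (T v x)) g" by (simp add: ip_def ic_skew)
    also have "ip (\<lambda>x. ic (T v x)) g = ip (T (Jc v)) g"
      by (rule ip_cong_AE[OF L2_ic[OF T_L2] T_L2 g g]) (use T_Jc[of v] in auto)
    finally show ?thesis by (simp add: orth)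
  qed
  then have 2: "AE x in \<mu>. \<forall>n. F n x \<bullet> ic (g x) = 0"
    unfolding AE_all_countable by (intro allI A L2_ic g)
  have 1: "AE x in \<mu>. \<forall>n. F n x \<bullet> g x = 0"
    unfolding AE_all_countable by (intro allI A g orth)
  show ?thesis
    using 1 2 supp
  proof eventually_elim
    case (elim x)
    show ?case
    proof (rule csupp_eqI[OF elim(3) subspace_0[OF subspace_csupp]])
      fix j assume "j \<in> act x"
      then obtain n where n: "0 < f n x" "j = rank n x" by (auto simp: act_def)
      have "sqrt (f n x) * (eps j \<bullet> g x) = 0" using elim(1)[rule_format, of n] by (simp add: F_def n)
      then show "g x \<bullet> eps j = 0 \<bullet> eps j" using n by (simp add: inner_commute)
      have "sqrt (f n x) * (eps j \<bullet> ic (g x)) = 0" using elim(2)[rule_format, of n] by (simp add: F_def n)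
      then have "eps j \<bullet> ic (g x) = 0" using n by simp
      then show "g x \<bullet> ic (eps j) = 0 \<bullet> ic (eps j)"
        using ic_skew[of "g x" "eps j"] by (simp add: inner_commute)
    qed
  qed
qed

text \<open>The Riesz vector w of the functional \<open>ip (T v) g\<close> is the candidate
  preimage: g - T w is orthogonal to the range of T, and \<open>T_complete\<close> applies.\<close>

lemma T_surj:
  assumes g: "L2 g" and supp: "AE x in \<mu>. g x \<in> V x"
  shows "\<exists>v. AE x in \<mu>. T v x = g x"
proof -
  have "bounded_linear (\<lambda>v. ip (T v) g)"
  proof (rule bounded_linear_intro)
    show "ip (T (v + w)) g = ip (T v) g + ip (T w) g" for v w
      using ip_cong_AE[OF T_L2 L2_add[OF T_L2 T_L2] g g T_add[of v w]] by (simp add: ip_add_left T_L2 g)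
    show "ip (T (r *\<^sub>R v)) g = r *\<^sub>R ip (T v) g" for r v
      using ip_cong_AE[OF T_L2 L2_scaleR[OF T_L2] g g T_scaleR[of r v]] by (simp add: ip_scaleR_left)
    show "norm (ip (T v) g) \<le> norm v * sqrt (ip g g)" for v
      using ip_Cauchy_Schwarz[OF T_L2 g, of v] by (simp add: T_ip norm_eq_sqrt_inner)
  qed
  then obtain w where w: "\<And>v. ip (T v) g = v \<bullet> w"
    by (rule riesz_on_subspace[OF closed_UNIV subspace_UNIV]) blast
  have "AE x in \<mu>. g x - T w x = 0"
  proof (rule T_complete[OF L2_diff[OF g T_L2]])
    show "AE x in \<mu>. g x - T w x \<in> V x"
      using supp T_supp[of w] by eventually_elim (rule subspace_diff[OF subspace_csupp])
    show "ip (T v) (\<lambda>x. g x - T w x) = 0" for v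
      by (simp add: ip_diff_right g T_L2 w T_ip)
  qed
  then have "AE x in \<mu>. T w x = g x" by eventually_elim simp
  then show ?thesis by blast
qed

end

section \<open>Isometries of fibres\<close>

text \<open>
  Complex orthogonality in terms of the real inner product: \<open>p \<bullet> q\<close> and \<open>p \<bullet> ic q\<close> are the real and
  imaginary parts of \<open>cx_inner p q\<close>.
\<close>

definition orthosystem :: "nat set \<Rightarrow> (nat \<Rightarrow> cell2) \<Rightarrow> bool" where
  "orthosystem A a \<longleftrightarrow>
     (\<forall>i j. a i \<bullet> a j = (if i = j \<and> j \<in> A then 1 else 0)) \<and> (\<forall>i j. a i \<bullet> ic (a j) = 0)"

definition psum :: "(nat \<Rightarrow> cell2) \<Rightarrow> cell2 \<Rightarrow> nat set \<Rightarrow> cell2" where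
  "psum a v J = (\<Sum>j\<in>J. ell2_nth (fst v) j *\<^sub>R a j + ell2_nth (snd v) j *\<^sub>R ic (a j))"

text \<open>The operator with eps j sent to a j. As a plain \<open>lim\<close> it is defined for
  every a and v, so the fibre operators made from it are measurable in x everywhere, including
  points where the series need not converge.\<close>

definition basis_op :: "(nat \<Rightarrow> cell2) \<Rightarrow> cell2 \<Rightarrow> cell2" where
  "basis_op a v = lim (\<lambda>N. psum a v {..<N})"

lemma ic_sum: "ic (\<Sum>j\<in>J. f j) = (\<Sum>j\<in>J. ic (f j))"
  by (induction J rule: infinite_finite_induct) (auto simp: ic_linear)

lemma psum_add: "psum a (v + w) J = psum a v J + psum a w J"
  by (simp add: psum_def ell2_nth_linear scaleR_add_left sum.distrib algebra_simps)

lemma psum_scaleR: "psum a (r *\<^sub>R v) J = r *\<^sub>R psum a v J"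
  by (simp add: psum_def ell2_nth_linear scaleR_sum_right scaleR_add_right)

lemma psum_ic: "psum a (ic v) J = ic (psum a v J)"
  by (simp add: psum_def ell2_nth_linear ic_sum ic_linear algebra_simps)

lemma psum_inner:
  assumes "\<And>j. j \<in> A \<Longrightarrow> z \<bullet> a j = u \<bullet> eps j" "\<And>j. j \<in> A \<Longrightarrow> z \<bullet> ic (a j) = u \<bullet> ic (eps j)"
    and "v \<in> csupp A"
  shows "z \<bullet> psum a v J = u \<bullet> psum eps v J"
  unfolding psum_def inner_sum_right
proof (rule sum.cong[OF HOL.refl])
  fix j
  show "z \<bullet> (ell2_nth (fst v) j *\<^sub>R a j + ell2_nth (snd v) j *\<^sub>R ic (a j)) =
      u \<bullet> (ell2_nth (fst v) j *\<^sub>R eps j + ell2_nth (snd v) j *\<^sub>R ic (eps j))"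
    using assms by (cases "j \<in> A") (auto simp: inner_add_right csupp_iff inner_eps)
qed

lemma orthosystem_inner:
  assumes "orthosystem A a" shows "ic (a i) \<bullet> a j = 0" "ic (a i) \<bullet> ic (a j) = a i \<bullet> a j"
  using assms by (auto simp: orthosystem_def ic_skew)

lemma psum_norm:
  assumes a: "orthosystem A a" and v: "v \<in> csupp A" and J: "finite J"
  shows "(norm (psum a v J))\<^sup>2 = (\<Sum>j\<in>J. (ell2_nth (fst v) j)\<^sup>2 + (ell2_nth (snd v) j)\<^sup>2)"
proof -
  have zero: "ell2_nth (fst v) j = 0" "ell2_nth (snd v) j = 0" if "j \<notin> A" for j
    using v that by (auto simp: csupp_iff inner_eps)
  define t where "t j = ell2_nth (fst v) j *\<^sub>R a j + ell2_nth (snd v) j *\<^sub>R ic (a j)" for j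
  have t: "t i \<bullet> t j = (if i = j then (ell2_nth (fst v) j)\<^sup>2 + (ell2_nth (snd v) j)\<^sup>2 else 0)" for i j
    using a orthosystem_inner[OF a] zero[of j]
    by (auto simp: t_def inner_add_left inner_add_right orthosystem_def power2_eq_square)
  have "(norm (psum a v J))\<^sup>2 = (\<Sum>j\<in>J. \<Sum>i\<in>J. t i \<bullet> t j)"
    unfolding psum_def power2_norm_eq_inner t_def[symmetric] inner_sum_left inner_sum_right ..
  then show ?thesis using J by (simp add: t)
qed

lemma orthosystem_eps: "orthosystem UNIV eps"
  by (simp add: orthosystem_def eps_orthonormal)

lemma csupp_UNIV [simp]: "v \<in> csupp UNIV"
  by (simp add: csupp_iff)

lemma psum_eps_tendsto: "(\<lambda>N. psum eps v {..<N}) \<longlonglongrightarrow> v"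
proof -
  have "psum eps v J = (\<Sum>j\<in>J. ell2_nth (fst v) j *\<^sub>R unit_ell2 j, \<Sum>j\<in>J. ell2_nth (snd v) j *\<^sub>R unit_ell2 j)" for J
    by (simp add: psum_def eps_def sum_prod)
  then show ?thesis
    using tendsto_Pair[OF ell2_truncation[of "fst v"] ell2_truncation[of "snd v"]] by simp
qed

text \<open>Differences of partial sums have the same norm as those of the expansion of v in the
  basis eps, which converges.\<close>

lemma basis_op_tendsto:
  assumes a: "orthosystem A a" and v: "v \<in> csupp A"
  shows "(\<lambda>N. psum a v {..<N}) \<longlonglongrightarrow> basis_op a v"
proof -
  have diff: "norm (psum a v {..<M} - psum a v {..<N}) =
      norm (psum eps v {..<M} - psum eps v {..<N})" for M N
  proof -
    have *: "norm (psum a v {..<M} - psum a v {..<N}) =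
        norm (psum eps v {..<M} - psum eps v {..<N})" if "N \<le> M" for M N
    proof -
      have "psum b v {..<M} - psum b v {..<N} = psum b v {N..<M}" for b
      proof -
        have M: "{..<M} = {..<N} \<union> {N..<M}" using that by auto
        show ?thesis unfolding psum_def M by (subst sum.union_disjoint) auto
      qed
      moreover have "(norm (psum a v {N..<M}))\<^sup>2 = (norm (psum eps v {N..<M}))\<^sup>2"
        using psum_norm[OF a v] psum_norm[OF orthosystem_eps csupp_UNIV] by simp
      ultimately show ?thesis by (simp add: power2_eq_iff_nonneg)
    qed
    show ?thesis
      using *[of N M] *[of M N] by (cases "N \<le> M") (simp_all add: norm_minus_commute)
  qed
  have "Cauchy (\<lambda>N. psum eps v {..<N})"
    by (rule LIMSEQ_imp_Cauchy[OF psum_eps_tendsto])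
  then have "Cauchy (\<lambda>N. psum a v {..<N})"
    unfolding Cauchy_def dist_norm diff .
  then show ?thesis
    unfolding basis_op_def by (simp add: Cauchy_convergent_iff convergent_LIMSEQ_iff)
qed

definition cisometry :: "nat set \<Rightarrow> (cell2 \<Rightarrow> cell2) \<Rightarrow> bool" where
  "cisometry A C \<longleftrightarrow> (\<forall>v\<in>csupp A. \<forall>w\<in>csupp A. C (v + w) = C v + C w) \<and>
     (\<forall>r. \<forall>v\<in>csupp A. C (r *\<^sub>R v) = r *\<^sub>R C v) \<and>
     (\<forall>v\<in>csupp A. C (ic v) = ic (C v)) \<and> (\<forall>v\<in>csupp A. norm (C v) = norm v)"

lemma cisometry_basis_op:
  assumes a: "orthosystem A a" shows "cisometry A (basis_op a)"
proof -
  note lim = basis_op_tendsto[OF a]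
  have 1: "basis_op a (v + w) = basis_op a v + basis_op a w" if "v \<in> csupp A" "w \<in> csupp A" for v w
    by (rule LIMSEQ_unique[OF lim[OF subspace_add[OF subspace_csupp that]]])
       (unfold psum_add, intro tendsto_intros lim that)
  have 2: "basis_op a (r *\<^sub>R v) = r *\<^sub>R basis_op a v" if "v \<in> csupp A" for r v
    by (rule LIMSEQ_unique[OF lim[OF subspace_scale[OF subspace_csupp that]]])
       (unfold psum_scaleR, intro tendsto_intros lim that)
  have 3: "basis_op a (ic v) = ic (basis_op a v)" if "v \<in> csupp A" for v
  proof (rule LIMSEQ_unique[OF lim[OF ic_csupp[OF that]]])
    show "(\<lambda>N. psum a (ic v) {..<N}) \<longlonglongrightarrow> ic (basis_op a v)"
      unfolding psum_ic
      by (rule continuous_on_tendsto_compose[OF continuous_ic lim[OF that]]) auto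
  qed
  have 4: "norm (basis_op a v) = norm v" if "v \<in> csupp A" for v
  proof -
    have eq: "norm (psum a v {..<N}) = norm (psum eps v {..<N})" for N
    proof -
      have "(norm (psum a v {..<N}))\<^sup>2 = (norm (psum eps v {..<N}))\<^sup>2"
        using psum_norm[OF a that] psum_norm[OF orthosystem_eps csupp_UNIV] by simp
      then show ?thesis by (simp add: power2_eq_iff_nonneg)
    qed
    show ?thesis
      by (rule LIMSEQ_unique[OF tendsto_norm[OF lim[OF that]]])
         (unfold eq, rule tendsto_norm[OF psum_eps_tendsto])
  qed
  show ?thesis unfolding cisometry_def using 1 2 3 4 by blast
qed

lemma basis_op_csupp:
  assumes "orthosystem A a" "\<And>j. a j \<in> csupp B" "v \<in> csupp A"
  shows "basis_op a v \<in> csupp B"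
proof (rule closed_sequentially[OF closed_csupp _ basis_op_tendsto[OF assms(1,3)]])
  show "psum a v {..<N} \<in> csupp B" for N
    unfolding psum_def
    by (intro subspace_sum subspace_csupp subspace_add subspace_scale ic_csupp assms(2))
qed

text \<open>Equality in Bessel's inequality: z has the coefficients of u along the system a, and
  also the norm of u, so nothing of z is left outside the closed span of the system.\<close>

lemma basis_op_eqI:
  assumes a: "orthosystem A a" and u: "u \<in> csupp A" and z: "norm z = norm u"
    and "\<And>j. j \<in> A \<Longrightarrow> z \<bullet> a j = u \<bullet> eps j" "\<And>j. j \<in> A \<Longrightarrow> z \<bullet> ic (a j) = u \<bullet> ic (eps j)"
  shows "z = basis_op a u"
proof -
  have eq: "z \<bullet> psum a u J = u \<bullet> psum eps u J" for J
    by (rule psum_inner[OF assms(4,5) u])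
  have "z \<bullet> basis_op a u = u \<bullet> u"
  proof (rule LIMSEQ_unique)
    show "(\<lambda>N. z \<bullet> psum a u {..<N}) \<longlonglongrightarrow> z \<bullet> basis_op a u"
      by (intro tendsto_intros basis_op_tendsto[OF a u])
    show "(\<lambda>N. z \<bullet> psum a u {..<N}) \<longlonglongrightarrow> u \<bullet> u"
      unfolding eq by (intro tendsto_inner tendsto_const psum_eps_tendsto)
  qed
  moreover have "norm (basis_op a u) = norm u"
    using cisometry_basis_op[OF a] u by (simp add: cisometry_def)
  ultimately have "(norm (z - basis_op a u))\<^sup>2 = 0"
    using z by (simp add: power2_norm_eq_inner inner_diff_left inner_diff_right inner_commute norm_eq_sqrt_inner)
  then show ?thesis by simp
qed

lemma cisometryD:
  assumes "cisometry A C"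
  shows "v \<in> csupp A \<Longrightarrow> w \<in> csupp A \<Longrightarrow> C (v + w) = C v + C w"
    and "v \<in> csupp A \<Longrightarrow> C (r *\<^sub>R v) = r *\<^sub>R C v"
    and "v \<in> csupp A \<Longrightarrow> C (ic v) = ic (C v)"
    and "v \<in> csupp A \<Longrightarrow> norm (C v) = norm v"
  using assms unfolding cisometry_def by blast+

lemma cisometry_minus: assumes "cisometry A C" "v \<in> csupp A" shows "C (- v) = - C v"
  using cisometryD(2)[OF assms, of "-1"] by simp

lemma cisometry_inner:
  assumes C: "cisometry A C" and vw: "v \<in> csupp A" "w \<in> csupp A" shows "C v \<bullet> C w = v \<bullet> w"
  using cisometryD(4)[OF C subspace_add[OF subspace_csupp vw]] cisometryD(1)[OF C vw]
    cisometryD(4)[OF C vw(1)] cisometryD(4)[OF C vw(2)]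
  by (simp add: dot_norm)

lemma cisometry_cx_inner:
  assumes C: "cisometry A C" and vw: "v \<in> csupp A" "w \<in> csupp A"
  shows "cx_inner (C v) (C w) = cx_inner v w"
  using cisometry_inner[OF C vw] cisometry_inner[OF C vw(1) ic_csupp[OF vw(2)]] C vw
  by (simp add: cx_inner_real cisometry_def)

lemma cisometry_cx_scale:
  assumes C: "cisometry A C" and v: "v \<in> csupp A" shows "C (cx_scale z v) = cx_scale z (C v)"
proof -
  have "Re z *\<^sub>R v \<in> csupp A" "Im z *\<^sub>R ic v \<in> csupp A" "ic v \<in> csupp A"
    by (auto intro!: subspace_scale subspace_csupp ic_csupp v)
  then show ?thesis
    unfolding cx_scale_Re_Im[of z] by (simp add: cisometryD[OF C] v)
qed

text \<open>Obtained from \<open>basis_op_eqI\<close> with z = C v. It makes an isometry of a fibre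
  determined by its values on the basis, which is how all relations between the fibre operators are
  checked.\<close>

lemma cisometry_eq_basis_op:
  assumes C: "cisometry A C" and v: "v \<in> csupp A"
  shows "C v = basis_op (\<lambda>j. if j \<in> A then C (eps j) else 0) v"
proof (rule basis_op_eqI[OF _ v cisometryD(4)[OF C v]])
  have ic_C: "ic (C (eps j)) = C (ic (eps j))" if "j \<in> A" for j
    by (rule cisometryD(3)[OF C eps_csupp[OF that], symmetric])
  have in1: "C u \<bullet> C (eps j) = u \<bullet> eps j"
    and in2: "C u \<bullet> ic (C (eps j)) = u \<bullet> ic (eps j)" if "j \<in> A" "u \<in> csupp A" for u j
    unfolding ic_C[OF that(1)]
    by (rule cisometry_inner[OF C that(2)]; intro ic_csupp eps_csupp that(1))+
  show "orthosystem A (\<lambda>j. if j \<in> A then C (eps j) else 0)"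
    unfolding orthosystem_def by (simp add: in1 in2 eps_csupp eps_orthonormal ic_linear)
  show "C v \<bullet> (if j \<in> A then C (eps j) else 0) = v \<bullet> eps j"
    "C v \<bullet> ic (if j \<in> A then C (eps j) else 0) = v \<bullet> ic (eps j)" if "j \<in> A" for j
    using that by (simp_all add: in1 in2 v)
qed

lemma cisometry_eqI:
  assumes C: "cisometry A C" and D: "cisometry A D" and eq: "\<And>j. j \<in> A \<Longrightarrow> C (eps j) = D (eps j)"
    and v: "v \<in> csupp A"
  shows "C v = D v"
proof -
  have "(\<lambda>j. if j \<in> A then C (eps j) else 0) = (\<lambda>j. if j \<in> A then D (eps j) else 0)" using eq by auto
  then show ?thesis
    unfolding cisometry_eq_basis_op[OF C v] cisometry_eq_basis_op[OF D v] by simp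
qed

lemma cisometry_compose:
  assumes "cisometry A C" "cisometry B D" "\<And>v. v \<in> csupp A \<Longrightarrow> C v \<in> csupp B"
  shows "cisometry A (\<lambda>v. D (C v))"
  using assms unfolding cisometry_def by simp

lemma cisometry_conj:
  assumes C: "cisometry A C"
  shows "cisometry A (\<lambda>v. cx_conj (C (cx_conj v)))"
  using cisometryD[OF C cx_conj_csupp] cisometryD(1)[OF C cx_conj_csupp cx_conj_csupp]
    cisometry_minus[OF C ic_csupp[OF cx_conj_csupp]]
  unfolding cisometry_def by (simp add: cx_conj_simps)

lemma cisometry_scale:
  assumes "cisometry A C" "\<bar>r\<bar> = 1" shows "cisometry A (\<lambda>v. r *\<^sub>R C v)"
  using assms unfolding cisometry_def by (simp add: ic_linear scaleR_add_right)

lemma cisometry_id: "cisometry A (\<lambda>v. v)"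
  by (simp add: cisometry_def)

text \<open>A comparison of dimensions. For initial segments a point n of A outside B forces B below
  n; then a space of real dimension at most 2 n would contain 2 (n + 1) orthonormal vectors.\<close>

lemma orthosystem_dimension:
  assumes a: "orthosystem A a" and supp: "\<And>j. a j \<in> csupp B"
    and A: "\<And>i j. j \<in> A \<Longrightarrow> i < j \<Longrightarrow> i \<in> A" and B: "\<And>i j. j \<in> B \<Longrightarrow> i < j \<Longrightarrow> i \<in> B"
  shows "A \<subseteq> B"
proof
  fix n assume n: "n \<in> A"
  show "n \<in> B"
  proof (rule ccontr)
    assume "n \<notin> B"
    then have Bn: "j < n" if "j \<in> B" for j using B[OF that] that by (metis linorder_neqE_nat)
    have nB: "j \<notin> B" if "n \<le> j" for j using Bn[of j] that by auto
    have An: "j \<in> A" if "j \<le> n" for j using A[OF n] n that by (cases "j = n") auto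
    \<comment> \<open>Complex dimension is counted over the reals: each vector contributes itself
      and its multiple by i.\<close>
    define X where "X = a ` {..n} \<union> (\<lambda>j. ic (a j)) ` {..n}"
    define Y where "Y = eps ` {..<n} \<union> (\<lambda>j. ic (eps j)) ` {..<n}"
    have aa: "a i \<bullet> a j = (if i = j then 1 else 0)" "a i \<bullet> ic (a j) = 0" "ic (a i) \<bullet> a j = 0"
      "ic (a i) \<bullet> ic (a j) = (if i = j then 1 else 0)" if "i \<le> n" "j \<le> n" for i j
      using a orthosystem_inner[OF a] An that by (auto simp: orthosystem_def)
    have inj1: "inj_on a {..n}"
    proof (rule inj_onI)
      fix i j assume "i \<in> {..n}" "j \<in> {..n}" "a i = a j"
      then show "i = j" using aa(1)[of i j] aa(1)[of j j] by (cases "i = j") simp_all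
    qed
    have inj2: "inj_on (\<lambda>j. ic (a j)) {..n}"
    proof (rule inj_onI)
      fix i j assume "i \<in> {..n}" "j \<in> {..n}" "ic (a i) = ic (a j)"
      then show "i = j" using aa(4)[of i j] aa(4)[of j j] by (cases "i = j") simp_all
    qed
    have ne: "a i \<noteq> ic (a j)" if "i \<le> n" "j \<le> n" for i j
      using aa(1)[of i i] aa(2)[of i j] that by auto
    have disj: "a ` {..n} \<inter> (\<lambda>j. ic (a j)) ` {..n} = {}"
    proof (rule equals0I)
      fix z assume "z \<in> a ` {..n} \<inter> (\<lambda>j. ic (a j)) ` {..n}"
      then obtain i j where "i \<le> n" "j \<le> n" "z = a i" "z = ic (a j)" by blast
      then show False using ne[of i j] by simp
    qed
    have cX: "card X = 2 * (n + 1)"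
      unfolding X_def using disj by (subst card_Un_disjoint) (auto simp: card_image inj1 inj2)
    have cY: "card Y \<le> 2 * n"
    proof -
      have "card Y \<le> card (eps ` {..<n}) + card ((\<lambda>j. ic (eps j)) ` {..<n})"
        unfolding Y_def by (rule card_Un_le)
      also have "\<dots> \<le> n + n"
        by (intro add_mono) (metis card_image_le card_lessThan finite_lessThan)+
      finally show ?thesis by simp
    qed
    have "independent X"
    proof (rule pairwise_orthogonal_independent)
      show "pairwise orthogonal X"
      proof (rule pairwiseI)
        fix p q assume pq: "p \<in> X" "q \<in> X" "p \<noteq> q"
        have "\<exists>i\<le>n. z = a i \<or> z = ic (a i)" if "z \<in> X" for z
          using that unfolding X_def by blast
        then obtain i j where "i \<le> n" "p = a i \<or> p = ic (a i)" "j \<le> n" "q = a j \<or> q = ic (a j)"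
          using pq by metis
        then show "orthogonal p q"
          unfolding orthogonal_def using aa[of i j] pq(3) by (cases "i = j") fastforce+
      qed
      show "0 \<notin> X"
      proof
        assume "0 \<in> X"
        then obtain j where "j \<le> n" "a j = 0 \<or> ic (a j) = 0" by (auto simp: X_def)
        then show False using aa(1)[of j j] aa(4)[of j j] by auto
      qed
    qed
    moreover have "X \<subseteq> span Y"
    proof -
      have "v \<in> span Y" if "v \<in> csupp B" for v
      proof -
        have "v = psum eps v {..<n}"
        proof (rule LIMSEQ_unique[OF psum_eps_tendsto])
          have "psum eps v {..<N} = psum eps v {..<n}" if "N \<ge> n" for N
            unfolding psum_def using that \<open>v \<in> csupp B\<close> nB
            by (intro sum.mono_neutral_right) (auto simp: csupp_iff inner_eps)
          then show "(\<lambda>N. psum eps v {..<N}) \<longlonglongrightarrow> psum eps v {..<n}"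
            by (intro tendsto_eventually eventually_sequentiallyI[of n])
        qed
        also have "\<dots> \<in> span Y"
          unfolding psum_def
          by (intro span_sum span_add span_scale span_base) (auto simp: Y_def)
        finally show ?thesis .
      qed
      then show ?thesis unfolding X_def using supp ic_csupp by blast
    qed
    moreover have "finite Y" by (simp add: Y_def)
    ultimately have "card X \<le> card Y" using independent_span_bound by blast
    then show False using cX cY by simp
  qed
qed

section \<open>The operators \<open>c\<^sub>k\<close>\<close>

lemma delta_delta [simp]: "x + delta k + delta k = (x :: cantor)"
proof -
  have "(b :: bit) + c + c = b" for b c by (cases "b = 0"; cases "c = 0") auto
  then show ?thesis by (simp add: fun_eq_iff)
qed

lemma cx_conj_zero [simp]: "cx_conj 0 = (0 :: cell2)"
  by (simp add: cx_conj_def prod_eq_iff)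

lemma bsgn_delta: "bsgn (delta k l) = (if l = k then - 1 else 1)"
  by (simp add: delta_def)

locale imprimitivity_model = spectral_model S K \<mu> e f
  for S :: "nat \<Rightarrow> 'v::{complex_inner, complete_space} \<Rightarrow> 'v" and K \<mu> e f +
  fixes W :: "nat \<Rightarrow> 'v \<Rightarrow> 'v" and s :: "nat \<Rightarrow> real"
  assumes W_linear: "\<And>k. linear (W k)"
    and W_norm: "\<And>k v. norm (W k v) = norm v"
    and W_W [simp]: "\<And>k v. W k (W k v) = v"
    and W_commute: "\<And>j k v. W j (W k v) = W k (W j v)"
    and W_Jc: "\<And>k v. W k (Jc v) = Jc (W k v)"
    and S_W: "\<And>l k v. S l (W k v) = (if l = k then - 1 else 1) *\<^sub>R W k (S l v)"
    and K_W: "\<And>k v. K (W k v) = s k *\<^sub>R W k (K v)"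
    and abs_s: "\<And>k. \<bar>s k\<bar> = 1"
begin

lemma W_add: "W k (v + w) = W k v + W k w" and W_scaleR: "W k (r *\<^sub>R v) = r *\<^sub>R W k v"
  using W_linear[of k] by (auto simp: linear_add linear_scale)

lemma Sp_W: "Sp L (W k v) = chi L (delta k) *\<^sub>R W k (Sp L v)"
  by (induction L) (auto simp: S_scaleR S_W bsgn_delta)

section \<open>Spectral measures as densities and their translation by W\<close>

definition weight :: "'v \<Rightarrow> cantor measure" where
  "weight v = density \<mu> (\<lambda>x. ennreal ((norm (T v x))\<^sup>2))"

lemma T_measurable: "T v \<in> borel_measurable borel"
  by (rule L2_measurable[OF T_L2])

lemma norm_T_borel: "(\<lambda>x. (norm (T v x))\<^sup>2) \<in> borel_measurable borel"
  by (intro borel_measurable_power measurable_compose[OF T_measurable borel_measurable_norm])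

lemma weight_measurable: "(\<lambda>x. ennreal ((norm (T v x))\<^sup>2)) \<in> borel_measurable borel"
  by (rule measurable_compose[OF norm_T_borel measurable_ennreal])

lemma norm_T_integrable: "integrable \<mu> (\<lambda>x. (norm (T v x))\<^sup>2)"
  using T_L2 by (simp add: L2_def)

lemma weight_finite: "finite_measure (weight v)"
proof (rule finite_measureI)
  have m: "(\<lambda>x. ennreal ((norm (T v x))\<^sup>2)) \<in> borel_measurable \<mu>"
    unfolding measurable_mu by (rule weight_measurable)
  have "emeasure (weight v) (space (weight v)) = (\<integral>\<^sup>+x. ennreal ((norm (T v x))\<^sup>2) * indicator (space \<mu>) x \<partial>\<mu>)"
    unfolding weight_def space_density by (rule emeasure_density[OF m sets.top])
  also have "\<dots> = (\<integral>\<^sup>+x. ennreal ((norm (T v x))\<^sup>2) \<partial>\<mu>)" by simp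
  also have "\<dots> = ennreal (\<integral>x. (norm (T v x))\<^sup>2 \<partial>\<mu>)"
    by (rule nn_integral_eq_integral[OF norm_T_integrable]) simp
  finally show "emeasure (weight v) (space (weight v)) \<noteq> \<infinity>" by simp
qed

lemma sets_weight: "sets (weight v) = sets borel"
  by (simp add: weight_def sets_mu)

text \<open>Identifies \<open>weight v\<close> as the spectral measure of v.\<close>

lemma weight_char: "(\<integral>x. chi L x \<partial>weight v) = Sp L v \<bullet> v"
proof -
  have "(\<integral>x. chi L x \<partial>weight v) = (\<integral>x. (norm (T v x))\<^sup>2 *\<^sub>R chi L x \<partial>\<mu>)"
    unfolding weight_def
    by (rule integral_density) (use norm_T_borel chi_borel in \<open>simp_all add: measurable_mu\<close>)
  also have "\<dots> = ip (\<lambda>x. chi L x *\<^sub>R T v x) (T v)"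
    by (simp add: ip_def power2_norm_eq_inner mult.commute)
  also have "\<dots> = ip (T (Sp L v)) (T v)"
    by (rule ip_cong_AE[OF L2_char[OF T_L2] T_L2 T_L2 T_L2]) (use T_Sp[of L v] in auto)
  finally show ?thesis by (simp add: T_ip)
qed

lemma translate_mu: "(\<lambda>x. x + d) \<in> measurable \<mu> borel"
  using translate_borel by (simp add: measurable_mu)

text \<open>Compared on characters: moving \<open>Sp L\<close> past \<open>W k\<close> costs the
  sign \<open>chi L (delta k)\<close>, and translation by \<open>delta k\<close> multiplies
  \<open>chi L\<close> by the same sign.\<close>

lemma weight_W: "weight (W k v) = distr (weight v) borel (\<lambda>x. x + delta k)"
proof (rule measure_eq_of_characters)
  have tr: "(\<lambda>x. x + delta k) \<in> measurable (weight v) borel"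
    using translate_borel by (simp only: measurable_borel_eq[OF sets_weight])
  show "finite_measure (distr (weight v) borel (\<lambda>x. x + delta k))"
    by (rule finite_measure.finite_measure_distr[OF weight_finite tr])
  show "(\<integral>x. chi L x \<partial>weight (W k v)) = (\<integral>x. chi L x \<partial>distr (weight v) borel (\<lambda>x. x + delta k))" for L
  proof -
    have "(\<integral>x. chi L x \<partial>distr (weight v) borel (\<lambda>x. x + delta k)) =
        (\<integral>x. chi L (x + delta k) \<partial>weight v)"
      by (rule integral_distr[OF tr chi_borel])
    also have "\<dots> = chi L (delta k) * (Sp L v \<bullet> v)"
      by (simp add: chi_add weight_char)
    also have "Sp L v \<bullet> v = W k (Sp L v) \<bullet> W k v"
      by (rule isometry_inner[OF W_linear W_norm, symmetric])
    also have "chi L (delta k) * (W k (Sp L v) \<bullet> W k v) = Sp L (W k v) \<bullet> W k v"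
      by (simp add: Sp_W)
    also have "\<dots> = (\<integral>x. chi L x \<partial>weight (W k v))" by (rule weight_char[symmetric])
    finally show ?thesis by (rule HOL.sym)
  qed
qed (simp_all add: weight_finite sets_weight)

text \<open>A measurable choice of basis in all fibres, padded with 0. It is bounded and \<mu> is
  finite, so each \<open>frame j\<close> is the image under T of a vector \<open>fvec j\<close>;
  these countably many vectors span almost every fibre.\<close>

definition frame :: "nat \<Rightarrow> cantor \<Rightarrow> cell2" where
  "frame j x = (if j \<in> act x then eps j else 0)"

lemma frame_L2: "L2 (frame j)"
proof -
  have m: "frame j \<in> borel_measurable borel"
    unfolding frame_def[abs_def]
    by (rule measurable_If) (use act_measurable[of j] in auto)
  have "integrable \<mu> (\<lambda>x. (norm (frame j x))\<^sup>2)"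
  proof (rule integrable_const_bound[where B = 1])
    show "(\<lambda>x. (norm (frame j x))\<^sup>2) \<in> borel_measurable \<mu>"
      unfolding measurable_mu by (intro borel_measurable_power measurable_compose[OF m borel_measurable_norm])
  qed (simp add: frame_def)
  with m show ?thesis by (simp add: L2_def)
qed

definition fvec :: "nat \<Rightarrow> 'v" where
  "fvec j = (SOME v. AE x in \<mu>. T v x = frame j x)"

lemma T_fvec: "AE x in \<mu>. T (fvec j) x = frame j x"
proof -
  have "frame j x \<in> V x" for x
    by (simp add: frame_def eps_csupp subspace_0 subspace_csupp)
  then have "\<exists>v. AE x in \<mu>. T v x = frame j x" by (intro T_surj frame_L2) simp
  then show ?thesis unfolding fvec_def by (rule someI_ex)
qed

lemma frame_0: "frame 0 x = eps 0"
  by (simp add: frame_def act_0)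

text \<open>Coordinate 0 is active everywhere, so \<mu> is itself the spectral measure of a vector.
  With \<open>weight_W\<close> this makes the translates of \<mu> absolutely continuous with respect
  to \<mu>.\<close>

lemma weight_fvec_0: "weight (fvec 0) = \<mu>"
proof -
  have "weight (fvec 0) = density \<mu> (\<lambda>x. 1)"
    unfolding weight_def
  proof (rule density_cong)
    show "AE x in \<mu>. ennreal ((norm (T (fvec 0) x))\<^sup>2) = 1"
      using T_fvec[of 0] by eventually_elim (simp add: frame_0)
  qed (use weight_measurable in \<open>simp_all add: measurable_mu\<close>)
  then show ?thesis by (simp add: density_1)
qed

lemma sets_translate: "sets (translate_measure \<mu> d) = sets borel"
  by (simp add: translate_measure_def)

lemma finite_translate: "finite_measure (translate_measure \<mu> d)"
  unfolding translate_measure_def by (rule finite_measure_distr[OF translate_mu])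

lemma ac_translate: "absolutely_continuous \<mu> (translate_measure \<mu> (delta k))"
proof -
  have "translate_measure \<mu> (delta k) = weight (W k (fvec 0))"
    by (simp add: weight_W weight_fvec_0 translate_measure_def)
  then show ?thesis
    unfolding weight_def
    using weight_measurable by (simp add: absolutely_continuousI_density measurable_mu)
qed

lemma AE_translate: assumes "AE x in \<mu>. p x" shows "AE x in \<mu>. p (x + delta k)"
proof -
  have "AE x in translate_measure \<mu> (delta k). p x"
    by (rule absolutely_continuous_AE[OF _ ac_translate assms]) (simp add: sets_translate sets_mu)
  then show ?thesis unfolding translate_measure_def by (rule AE_distrD[OF translate_mu])
qed

section \<open>Radon-Nikodym factors and the pointwise norm of the translated sections\<close>

definition RN :: "nat \<Rightarrow> cantor \<Rightarrow> ennreal" where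
  "RN k = RN_deriv \<mu> (translate_measure \<mu> (delta k))"

definition rn :: "nat \<Rightarrow> cantor \<Rightarrow> real" where
  "rn k x = enn2real (RN k x)"

lemma rn_nonneg: "0 \<le> rn k x"
  by (simp add: rn_def)

lemma RN_measurable: "RN k \<in> borel_measurable borel"
  using borel_measurable_RN_deriv[of \<mu>] unfolding RN_def by (simp add: measurable_mu)

lemma rn_measurable: "rn k \<in> borel_measurable borel"
  unfolding rn_def[abs_def] by (rule measurable_compose[OF RN_measurable]) simp

lemma density_RN: "density \<mu> (RN k) = translate_measure \<mu> (delta k)"
  unfolding RN_def by (rule density_RN_deriv[OF ac_translate]) (simp add: sets_translate sets_mu)

lemma RN_eq_rn: "AE x in \<mu>. RN k x = ennreal (rn k x)"
proof -
  interpret t: finite_measure "translate_measure \<mu> (delta k)" by (rule finite_translate)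
  have "AE x in \<mu>. RN k x \<noteq> \<infinity>"
    unfolding RN_def
    by (rule RN_deriv_finite[OF t.sigma_finite_measure_axioms ac_translate]) (simp add: sets_translate sets_mu)
  then show ?thesis by eventually_elim (simp add: rn_def ennreal_enn2real_if)
qed

text \<open>Change of variables: integrating G (x + \<open>delta k\<close>) against \<mu> is
  integrating G against the translated measure, whose density is \<open>RN k\<close>. The indicator
  and the norm are both rewritten through \<open>delta_delta\<close>.\<close>

lemma distr_weight:
  "distr (weight v) borel (\<lambda>x. x + delta k) = density \<mu> (\<lambda>x. RN k x * ennreal ((norm (T v (x + delta k)))\<^sup>2))"
proof (rule measure_eqI)
  let ?g = "\<lambda>x. ennreal ((norm (T v x))\<^sup>2)" and ?t = "\<lambda>x. x + delta k"
  have g: "?g \<in> borel_measurable borel" by (rule weight_measurable)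
  have gt: "(\<lambda>x. ?g (?t x)) \<in> borel_measurable borel"
    by (rule measurable_compose[OF translate_borel g])
  fix A assume "A \<in> sets (distr (weight v) borel ?t)"
  then have A: "A \<in> sets borel" by simp
  define G where "G x = ?g (?t x) * indicator A x" for x
  have G: "G \<in> borel_measurable borel"
    unfolding G_def[abs_def] using gt A by (intro borel_measurable_times_ennreal borel_measurable_indicator)
  have tr: "?t \<in> measurable (weight v) borel"
    using translate_borel by (simp only: measurable_borel_eq[OF sets_weight])
  have pre: "?t -` A \<in> sets borel" using measurable_sets[OF translate_borel A] by simp
  have "emeasure (distr (weight v) borel ?t) A = emeasure (weight v) (?t -` A)"
    using tr A sets_eq_imp_space_eq[OF sets_weight[of v]] by (simp add: emeasure_distr)
  also have "\<dots> = (\<integral>\<^sup>+x. ?g x * indicator (?t -` A) x \<partial>\<mu>)"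
    unfolding weight_def using g pre by (intro emeasure_density) (simp_all add: measurable_mu sets_mu)
  also have "\<dots> = (\<integral>\<^sup>+x. G (?t x) \<partial>\<mu>)"
    by (intro nn_integral_cong) (simp add: G_def indicator_def)
  also have "\<dots> = (\<integral>\<^sup>+x. G x \<partial>translate_measure \<mu> (delta k))"
    unfolding translate_measure_def by (rule nn_integral_distr[OF translate_mu, symmetric]) (simp only: measurable_distr_eq1 G)
  also have "\<dots> = (\<integral>\<^sup>+x. RN k x * G x \<partial>\<mu>)"
    unfolding density_RN[symmetric] using RN_measurable G by (intro nn_integral_density) (simp_all add: measurable_mu)
  also have "\<dots> = emeasure (density \<mu> (\<lambda>x. RN k x * ?g (?t x))) A"
    using RN_measurable gt A
    by (subst emeasure_density) (simp_all add: measurable_mu sets_mu G_def mult.assoc borel_measurable_times_ennreal)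
  finally show "emeasure (distr (weight v) borel ?t) A = emeasure (density \<mu> (\<lambda>x. RN k x * ?g (?t x))) A" .
qed (simp add: sets_mu)

text \<open>By \<open>weight_W\<close> and \<open>distr_weight\<close> both sides are densities of
  one finite measure. This extracts pointwise information about \<open>W k\<close>, which does not
  act pointwise on sections.\<close>

lemma T_W_norm: "AE x in \<mu>. (norm (T (W k v) x))\<^sup>2 = rn k x * (norm (T v (x + delta k)))\<^sup>2"
proof -
  have "AE x in \<mu>. ennreal ((norm (T (W k v) x))\<^sup>2) = RN k x * ennreal ((norm (T v (x + delta k)))\<^sup>2)"
  proof (rule sigma_finite_density_unique[THEN iffD1])
    show "density \<mu> (\<lambda>x. ennreal ((norm (T (W k v) x))\<^sup>2)) =
        density \<mu> (\<lambda>x. RN k x * ennreal ((norm (T v (x + delta k)))\<^sup>2))"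
      using weight_W[of k v] distr_weight[of v k] by (simp add: weight_def)
    interpret w: finite_measure "weight (W k v)" by (rule weight_finite)
    show "sigma_finite_measure (density \<mu> (\<lambda>x. ennreal ((norm (T (W k v) x))\<^sup>2)))"
      using w.sigma_finite_measure_axioms by (simp add: weight_def)
    show "(\<lambda>x. ennreal ((norm (T (W k v) x))\<^sup>2)) \<in> borel_measurable \<mu>"
      using weight_measurable by (simp add: measurable_mu)
    show "(\<lambda>x. RN k x * ennreal ((norm (T v (x + delta k)))\<^sup>2)) \<in> borel_measurable \<mu>"
      unfolding measurable_mu
      by (intro borel_measurable_times_ennreal RN_measurable measurable_compose[OF translate_borel weight_measurable])
  qed
  then show ?thesis
    using RN_eq_rn[of k]
  proof eventually_elim
    case (elim x)
    then have "ennreal ((norm (T (W k v) x))\<^sup>2) = ennreal (rn k x * (norm (T v (x + delta k)))\<^sup>2)"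
      by (simp add: ennreal_mult rn_nonneg)
    then show ?case by (subst (asm) ennreal_inj) (auto simp: rn_nonneg)
  qed
qed

lemma T_W_inner: "AE x in \<mu>. T (W k v) x \<bullet> T (W k w) x = rn k x * (T v (x + delta k) \<bullet> T w (x + delta k))"
  using T_W_norm[of k v] T_W_norm[of k w] T_W_norm[of k "v + w"] T_add[of "W k v" "W k w"]
    AE_translate[OF T_add[of v w], of k]
proof eventually_elim
  case (elim x)
  then have "(norm (T (W k v) x + T (W k w) x))\<^sup>2 = rn k x * (norm (T v (x + delta k) + T w (x + delta k)))\<^sup>2"
    by (simp add: W_add)
  with elim(1,2) show ?case by (simp add: dot_norm field_simps)
qed

text \<open>Read \<open>T_W_norm\<close> at \<open>W k (fvec 0)\<close>: as \<open>W k\<close> is an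
  involution, the left side is the squared norm of \<open>eps 0\<close>, which is 1.\<close>

lemma rn_pos: "AE x in \<mu>. 0 < rn k x"
  using T_W_norm[of k "W k (fvec 0)"] T_fvec[of 0]
proof eventually_elim
  case (elim x)
  then have "rn k x \<noteq> 0" by (auto simp: frame_0)
  then show ?case using rn_nonneg[of k x] by simp
qed

section \<open>The fibre operators and their relations\<close>

text \<open>The values that c_k(x) must take on the basis of the fibre at x +
  \<open>delta k\<close>, solved from the desired formula for \<open>W k\<close> on the frame
  vectors.\<close>

definition image_frame :: "nat \<Rightarrow> cantor \<Rightarrow> nat \<Rightarrow> cell2" where
  "image_frame k x j = (1 / sqrt (rn k x)) *\<^sub>R T (W k (fvec j)) x"

definition c :: "nat \<Rightarrow> cantor \<Rightarrow> cell2 \<Rightarrow> cell2" where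
  "c k x = basis_op (image_frame k x)"

definition good :: "nat \<Rightarrow> cantor \<Rightarrow> bool" where
  "good k x \<longleftrightarrow> 0 < rn k x \<and> orthosystem (act (x + delta k)) (image_frame k x) \<and> (\<forall>j. image_frame k x j \<in> V x)"

lemma T_W_Jc: "AE x in \<mu>. T (W k (Jc v)) x = ic (T (W k v) x)"
  using T_Jc[of "W k v"] by (simp add: W_Jc)

text \<open>For a fixed v one null set serves the whole countable frame; the second formula is
  \<open>T_W_inner\<close> for the vector i times \<open>fvec j\<close>.\<close>

lemma T_W_frame:
  "AE x in \<mu>. \<forall>j. T (W k v) x \<bullet> T (W k (fvec j)) x = rn k x * (T v (x + delta k) \<bullet> frame j (x + delta k)) \<and>
     T (W k v) x \<bullet> ic (T (W k (fvec j)) x) = rn k x * (T v (x + delta k) \<bullet> ic (frame j (x + delta k)))"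
  unfolding AE_all_countable
proof
  fix j
  show "AE x in \<mu>. T (W k v) x \<bullet> T (W k (fvec j)) x = rn k x * (T v (x + delta k) \<bullet> frame j (x + delta k)) \<and>
     T (W k v) x \<bullet> ic (T (W k (fvec j)) x) = rn k x * (T v (x + delta k) \<bullet> ic (frame j (x + delta k)))"
    using T_W_inner[of k v "fvec j"] T_W_inner[of k v "Jc (fvec j)"] T_W_Jc[of k "fvec j"]
      AE_translate[OF T_fvec[of j], of k] AE_translate[OF T_Jc[of "fvec j"], of k]
    by eventually_elim simp
qed

lemma AE_good: "AE x in \<mu>. good k x"
proof -
  have "AE x in \<mu>. \<forall>i. T (fvec i) (x + delta k) = frame i (x + delta k)"
    unfolding AE_all_countable by (intro allI AE_translate T_fvec)
  moreover have "AE x in \<mu>. \<forall>i j.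
      T (W k (fvec i)) x \<bullet> T (W k (fvec j)) x = rn k x * (T (fvec i) (x + delta k) \<bullet> frame j (x + delta k)) \<and>
      T (W k (fvec i)) x \<bullet> ic (T (W k (fvec j)) x) = rn k x * (T (fvec i) (x + delta k) \<bullet> ic (frame j (x + delta k)))"
    using T_W_frame by (subst AE_all_countable) blast
  moreover have "AE x in \<mu>. \<forall>j. T (W k (fvec j)) x \<in> V x"
    unfolding AE_all_countable by (intro allI T_supp)
  ultimately show ?thesis
    using rn_pos[of k]
  proof eventually_elim
    case (elim x)
    have sq: "1 / sqrt (rn k x) * (1 / sqrt (rn k x) * (rn k x * t)) = t" for t
      using elim(4) by (simp add: field_simps)
    have 1: "image_frame k x i \<bullet> image_frame k x j = frame i (x + delta k) \<bullet> frame j (x + delta k)"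
      and 2: "image_frame k x i \<bullet> ic (image_frame k x j) = frame i (x + delta k) \<bullet> ic (frame j (x + delta k))" for i j
      unfolding image_frame_def ic_linear inner_scaleR_left inner_scaleR_right
        elim(2)[rule_format, THEN conjunct1] elim(2)[rule_format, THEN conjunct2] elim(1)[rule_format]
      by (rule sq)+
    have "orthosystem (act (x + delta k)) (image_frame k x)"
      unfolding orthosystem_def 1 2 by (auto simp: frame_def eps_orthonormal ic_linear)
    moreover have "image_frame k x j \<in> V x" for j
      unfolding image_frame_def by (intro subspace_scale subspace_csupp elim(3)[rule_format])
    ultimately show ?case using elim(4) by (simp add: good_def)
  qed
qed

text \<open>After division by the square root of the Radon-Nikodym factor, T (W k v) x has the frame
  coefficients and, by \<open>T_W_norm\<close>, also the norm of T v (x + \<open>delta k\<close>).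
  So \<open>basis_op_eqI\<close> identifies it, with no limit taken in v.\<close>

lemma T_W: "AE x in \<mu>. T (W k v) x = sqrt (rn k x) *\<^sub>R c k x (T v (x + delta k))"
  using T_W_frame[of k v] T_W_norm[of k v] AE_good[of k] AE_translate[OF T_supp[of v], of k]
proof eventually_elim
  case (elim x)
  then have r: "0 < rn k x" and orth: "orthosystem (act (x + delta k)) (image_frame k x)" by (auto simp: good_def)
  define z where "z = (1 / sqrt (rn k x)) *\<^sub>R T (W k v) x"
  have sq: "1 / sqrt (rn k x) * (1 / sqrt (rn k x) * (rn k x * t)) = t" for t
    using r by (simp add: field_simps)
  have za: "z \<bullet> image_frame k x j = T v (x + delta k) \<bullet> frame j (x + delta k)"
    and zia: "z \<bullet> ic (image_frame k x j) = T v (x + delta k) \<bullet> ic (frame j (x + delta k))" for j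
    unfolding image_frame_def z_def ic_linear inner_scaleR_left inner_scaleR_right 
      elim(1)[rule_format, THEN conjunct1] elim(1)[rule_format, THEN conjunct2]
    by (rule sq)+
  have "(norm z)\<^sup>2 = (norm (T v (x + delta k)))\<^sup>2"
    using elim(2) r by (simp add: z_def power_mult_distrib power_divide)
  then have zn: "norm z = norm (T v (x + delta k))" by (simp add: power2_eq_iff_nonneg)
  have "z = basis_op (image_frame k x) (T v (x + delta k))"
    by (rule basis_op_eqI[OF orth elim(4) zn]) (simp_all add: za zia frame_def)
  then have "sqrt (rn k x) *\<^sub>R c k x (T v (x + delta k)) = sqrt (rn k x) *\<^sub>R z" by (simp add: c_def)
  also have "\<dots> = T (W k v) x" using r by (simp add: z_def)
  finally show ?case ..
qed

text \<open>\<open>orthosystem_dimension\<close> is applied at x and at x + \<open>delta k\<close>;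
  a second translation leads back to x, which gives both inclusions.\<close>

lemma act_translate: "AE x in \<mu>. act (x + delta k) = act x"
  using AE_good[of k] AE_translate[OF AE_good[of k], of k]
proof eventually_elim
  case (elim x)
  have "act (x + delta k) \<subseteq> act x"
    by (rule orthosystem_dimension[of _ "image_frame k x"]) (use elim(1) act_down in \<open>auto simp: good_def\<close>)
  moreover have "act x \<subseteq> act (x + delta k)"
    by (rule orthosystem_dimension[of _ "image_frame k (x + delta k)"]) (use elim(2) act_down in \<open>auto simp: good_def\<close>)
  ultimately show ?case by blast
qed

definition regular :: "nat \<Rightarrow> cantor \<Rightarrow> bool" where
  "regular k x \<longleftrightarrow> good k x \<and> act (x + delta k) = act x"

lemma AE_regular: "AE x in \<mu>. regular k x"
  using AE_good[of k] act_translate[of k] by eventually_elim (simp add: regular_def)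

lemma regular_rn: "regular k x \<Longrightarrow> 0 < rn k x"
  by (simp add: regular_def good_def)

lemma regular_act: "regular k x \<Longrightarrow> act (x + delta k) = act x"
  by (simp add: regular_def)

lemma regular_cisometry: "regular k x \<Longrightarrow> cisometry (act x) (c k x)"
  unfolding c_def regular_def good_def using cisometry_basis_op by metis

lemma regular_csupp: "regular k x \<Longrightarrow> v \<in> V x \<Longrightarrow> c k x v \<in> V x"
  unfolding c_def regular_def good_def using basis_op_csupp by metis

lemma T_W_fvec: "AE x in \<mu>. \<forall>j. T (W k (fvec j)) x = sqrt (rn k x) *\<^sub>R c k x (frame j (x + delta k))"
  unfolding AE_all_countable
proof
  fix j
  show "AE x in \<mu>. T (W k (fvec j)) x = sqrt (rn k x) *\<^sub>R c k x (frame j (x + delta k))"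
    using T_W[of k "fvec j"] AE_translate[OF T_fvec[of j], of k] by eventually_elim simp
qed

text \<open>Stands in for the chain rule of Radon-Nikodym derivatives: comparing norms shows that
  the two products of such factors coincide.\<close>

lemma cisometry_scaled:
  assumes C: "cisometry A C" and D: "cisometry A D" and "0 < \<alpha>" "0 < \<beta>" and j: "j \<in> A"
    and eq: "\<alpha> *\<^sub>R C (eps j) = \<beta> *\<^sub>R D (eps j)"
  shows "C (eps j) = D (eps j)"
proof -
  have "norm (\<alpha> *\<^sub>R C (eps j)) = norm (\<beta> *\<^sub>R D (eps j))" using eq by simp
  then have "\<alpha> = \<beta>"
    using assms(3,4) by (simp add: cisometryD(4)[OF C eps_csupp[OF j]] cisometryD(4)[OF D eps_csupp[OF j]])
  then show ?thesis using eq assms(3) by simp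
qed

lemma T_W_W_fvec:
  "AE x in \<mu>. \<forall>j. T (W k (W l (fvec j))) x =
     sqrt (rn k x) *\<^sub>R c k x (sqrt (rn l (x + delta k)) *\<^sub>R c l (x + delta k) (frame j (x + delta k + delta l)))"
  unfolding AE_all_countable
proof
  fix j
  show "AE x in \<mu>. T (W k (W l (fvec j))) x =
     sqrt (rn k x) *\<^sub>R c k x (sqrt (rn l (x + delta k)) *\<^sub>R c l (x + delta k) (frame j (x + delta k + delta l)))"
    using T_W[of k "W l (fvec j)"] AE_translate[OF T_W_fvec[of l], of k] by eventually_elim simp
qed

lemma compose_cisometry:
  assumes "regular k x" "regular l (x + delta k)"
  shows "cisometry (act x) (\<lambda>v. c k x (c l (x + delta k) v))"
proof (rule cisometry_compose[where C = "c l (x + delta k)" and D = "c k x" and B = "act x"])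
  show "cisometry (act x) (c l (x + delta k))"
    using regular_cisometry[OF assms(2)] regular_act[OF assms(1)] by simp
  show "cisometry (act x) (c k x)" by (rule regular_cisometry[OF assms(1)])
  show "c l (x + delta k) v \<in> V x" if "v \<in> V x" for v
    using regular_csupp[OF assms(2)] regular_act[OF assms(1)] that by simp
qed

lemma compose_scale:
  assumes "regular k x" "regular l (x + delta k)" "v \<in> V x"
  shows "c k x (t *\<^sub>R c l (x + delta k) v) = t *\<^sub>R c k x (c l (x + delta k) v)"
  using cisometryD(2)[OF regular_cisometry[OF assms(1)]] regular_csupp[OF assms(2)]
    regular_act[OF assms(1)] assms(3) by simp

text \<open>The fibre form of \<open>W_W\<close>. Together with isometry it supplies surjectivity
  and the adjoint relation in \<open>standard_data\<close>.\<close>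

lemma c_involution: "AE x in \<mu>. \<forall>v\<in>V x. c k x (c k (x + delta k) v) = v"
proof -
  have Tb: "AE x in \<mu>. \<forall>j. T (fvec j) x = frame j x" unfolding AE_all_countable by (intro allI T_fvec)
  show ?thesis
    using AE_regular[of k] AE_translate[OF AE_regular[of k], of k] T_W_W_fvec[of k k] Tb
  proof eventually_elim
    case (elim x)
    note comp = compose_cisometry[OF elim(1,2)]
    show ?case
    proof
      fix v assume v: "v \<in> V x"
      show "c k x (c k (x + delta k) v) = v"
      proof (rule cisometry_eqI[OF comp cisometry_id _ v])
        fix j assume j: "j \<in> act x"
        \<comment> \<open>The coefficient 1 is written out so that \<open>cisometry_scaled\<close>
          can compare the identity with the composition.\<close>
        have "1 *\<^sub>R eps j = sqrt (rn k x) *\<^sub>R c k x (sqrt (rn k (x + delta k)) *\<^sub>R c k (x + delta k) (eps j))"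
          using elim(3)[rule_format, of j] elim(4) j by (simp add: frame_def)
        also have "\<dots> = (sqrt (rn k x) * sqrt (rn k (x + delta k))) *\<^sub>R c k x (c k (x + delta k) (eps j))"
          by (simp add: compose_scale[OF elim(1,2) eps_csupp[OF j]])
        finally have "eps j = c k x (c k (x + delta k) (eps j))"
          by (rule cisometry_scaled[OF cisometry_id comp _ _ j, rotated -1]) (simp_all add: regular_rn elim(1,2))
        then show "c k x (c k (x + delta k) (eps j)) = eps j" by (rule HOL.sym)
      qed
    qed
  qed
qed

lemma c_commuting:
  "AE x in \<mu>. \<forall>v\<in>V x. c k x (c l (x + delta k) v) = c l x (c k (x + delta l) v)"
  using AE_regular[of k] AE_translate[OF AE_regular[of l], of k] AE_regular[of l]
    AE_translate[OF AE_regular[of k], of l] T_W_W_fvec[of k l] T_W_W_fvec[of l k]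
proof eventually_elim
  case (elim x)
  note comp = compose_cisometry[OF elim(1,2)] compose_cisometry[OF elim(3,4)]
  have act: "act (x + delta k + delta l) = act x" using elim(1,2) by (simp add: regular_act)
  have comm: "x + delta l + delta k = x + delta k + delta l" by (simp add: ac_simps)
  show ?case
  proof
    fix v assume v: "v \<in> V x"
    show "c k x (c l (x + delta k) v) = c l x (c k (x + delta l) v)"
    proof (rule cisometry_eqI[OF comp _ v])
      fix j assume j: "j \<in> act x"
      have "sqrt (rn k x) *\<^sub>R c k x (sqrt (rn l (x + delta k)) *\<^sub>R c l (x + delta k) (eps j)) =
          sqrt (rn l x) *\<^sub>R c l x (sqrt (rn k (x + delta l)) *\<^sub>R c k (x + delta l) (eps j))"
        using elim(5)[rule_format, of j] elim(6)[rule_format, of j] j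
        by (simp add: frame_def comm act W_commute[of k l])
      then have "(sqrt (rn k x) * sqrt (rn l (x + delta k))) *\<^sub>R c k x (c l (x + delta k) (eps j)) =
          (sqrt (rn l x) * sqrt (rn k (x + delta l))) *\<^sub>R c l x (c k (x + delta l) (eps j))"
        by (simp add: compose_scale[OF elim(1,2) eps_csupp[OF j]] compose_scale[OF elim(3,4) eps_csupp[OF j]])
      then show "c k x (c l (x + delta k) (eps j)) = c l x (c k (x + delta l) (eps j))"
        by (rule cisometry_scaled[OF comp _ _ j, rotated -1]) (simp_all add: regular_rn elim(1-4))
    qed
  qed
qed

lemma check_translate: "check (x + delta k) = check x + delta k"
  by (simp add: check_def ac_simps)

lemma T_K_fvec: "AE x in \<mu>. \<forall>j. T (K (fvec j)) x = frame j x"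
  unfolding AE_all_countable
proof
  fix j
  show "AE x in \<mu>. T (K (fvec j)) x = frame j x"
    using T_K[of "fvec j"] AE_check[OF T_fvec[of j]]
    by eventually_elim (simp add: frame_def act_check)
qed

lemma c_conj:
  "AE x in \<mu>. \<forall>v\<in>V x. cx_conj (c k x (cx_conj v)) = s k *\<^sub>R c k (check x) v"
proof -
  have 1: "AE x in \<mu>. \<forall>j. T (K (W k (fvec j))) x = s k *\<^sub>R (sqrt (rn k x) *\<^sub>R c k x (frame j (x + delta k)))"
    unfolding AE_all_countable
  proof
    fix j
    have "AE x in \<mu>. T (W k (K (fvec j))) x = sqrt (rn k x) *\<^sub>R c k x (frame j (x + delta k))"
      using T_W[of k "K (fvec j)"] AE_translate[OF T_K_fvec, of k] by eventually_elim simp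
    then show "AE x in \<mu>. T (K (W k (fvec j))) x = s k *\<^sub>R (sqrt (rn k x) *\<^sub>R c k x (frame j (x + delta k)))"
      unfolding K_W using T_scaleR[of "s k" "W k (K (fvec j))"] by eventually_elim simp
  qed
  have 2: "AE x in \<mu>. \<forall>j. T (K (W k (fvec j))) x = cx_conj (sqrt (rn k (check x)) *\<^sub>R c k (check x) (frame j (x + delta k)))"
    unfolding AE_all_countable
  proof
    fix j
    show "AE x in \<mu>. T (K (W k (fvec j))) x = cx_conj (sqrt (rn k (check x)) *\<^sub>R c k (check x) (frame j (x + delta k)))"
      using T_K[of "W k (fvec j)"] AE_check[OF T_W_fvec[of k]]
      by eventually_elim (simp add: frame_def check_translate[symmetric] act_check)
  qed
  \<comment> \<open>T of K v at x is computed from values at \<open>check x\<close>, so the relation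
    first appears with x and \<open>check x\<close> interchanged; \<open>AE_check\<close> swaps them
    at the end.\<close>
  have "AE x in \<mu>. \<forall>v\<in>V x. cx_conj (c k (check x) (cx_conj v)) = s k *\<^sub>R c k x v"
    using 1 2 AE_regular[of k] AE_check[OF AE_regular[of k]]
  proof eventually_elim
    case (elim x)
    have C: "cisometry (act x) (\<lambda>v. cx_conj (c k (check x) (cx_conj v)))"
      using cisometry_conj[OF regular_cisometry[OF elim(4)]] by (simp add: act_check)
    have D: "cisometry (act x) (\<lambda>v. s k *\<^sub>R c k x v)"
      by (rule cisometry_scale[OF regular_cisometry[OF elim(3)] abs_s])
    show ?case
    proof
      fix v assume v: "v \<in> V x"
      show "cx_conj (c k (check x) (cx_conj v)) = s k *\<^sub>R c k x v"
      proof (rule cisometry_eqI[OF C D _ v])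
        fix j assume j: "j \<in> act x"
        have eq: "sqrt (rn k (check x)) *\<^sub>R cx_conj (c k (check x) (cx_conj (eps j))) = sqrt (rn k x) *\<^sub>R (s k *\<^sub>R c k x (eps j))"
          using elim(1)[rule_format, of j] elim(2)[rule_format, of j] j regular_act[OF elim(3)]
          by (simp add: frame_def cx_conj_simps mult.commute)
        show "cx_conj (c k (check x) (cx_conj (eps j))) = s k *\<^sub>R c k x (eps j)"
          by (rule cisometry_scaled[OF C D _ _ j eq]) (simp_all add: regular_rn elim(3,4))
      qed
    qed
  qed
  from AE_check[OF this] show ?thesis by (simp add: act_check)
qed

end

section \<open>Standard representations\<close>

lemma chi_append: "chi (L @ M) x = chi L x * chi M x"
  by (simp add: chi_def)

lemma parity_sign_eq: "parity_sign x n = chi [0..<n] x"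
proof (induction n)
  case (Suc n)
  have "{i. i < Suc n \<and> x i = 1} = {i. i < n \<and> x i = 1} \<union> (if x n = 1 then {n} else {})"
    by (auto simp: less_Suc_eq)
  then have "parity_sign x (Suc n) = parity_sign x n * bsgn (x n)"
    by (cases "x n = 1") (simp_all add: parity_sign_def)
  then show ?case by (simp add: Suc chi_append)
qed (simp add: parity_sign_def)

text \<open>Addition is mod 2, so adding \<open>delta k\<close> for a point k of the support removes
  k, and adding it again restores the sequence.\<close>

lemma Delta_induct [consumes 1, case_names zero step]:
  assumes "d \<in> Delta" and zero: "p 0" and step: "\<And>d k. p d \<Longrightarrow> p (d + delta k)"
  shows "p d"
proof -
  have "finite {i. d i = 1}" using assms(1) by (simp add: Delta_def)
  then show ?thesis
  proof (induction "{i. d i = 1}" arbitrary: d rule: finite_induct)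
    case empty
    have "d i = 0" for i using empty by (cases "d i = 0") auto
    then have "d = 0" by (simp add: fun_eq_iff)
    show ?case unfolding \<open>d = 0\<close> by (rule zero)
  next
    case (insert k F)
    have dk: "d k = 1" using insert(4) by auto
    have "(d + delta k) i = 1 \<longleftrightarrow> i \<in> F" for i
    proof (cases "i = k")
      case True
      then show ?thesis using insert(2) dk by (simp add: delta_def)
    next
      case False
      then have "i \<in> F \<longleftrightarrow> d i = 1" using insert(4) by auto
      then show ?thesis using False by (simp add: delta_def)
    qed
    then have "F = {i. (d + delta k) i = 1}" by blast
    from insert(3)[OF this] have "p (d + delta k + delta k)" by (rule step)
    then show ?case by (simp only: delta_delta)
  qed
qed

lemma closure_span_unit_ell2:
  "closure (span (range (\<lambda>n. if n \<in> A then unit_ell2 n else 0))) = supported A"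
proof
  let ?R = "range (\<lambda>n. if n \<in> A then unit_ell2 n else 0)"
  have "?R \<subseteq> supported A" by (auto simp: supported_def nth_unit_ell2 ell2_nth_linear)
  then show "closure (span ?R) \<subseteq> supported A"
    by (intro closure_minimal closed_supported span_minimal subspace_supported)
  show "supported A \<subseteq> closure (span ?R)"
  proof
    fix u assume u: "u \<in> supported A"
    have "(\<Sum>j<N. ell2_nth u j *\<^sub>R unit_ell2 j) \<in> span ?R" for N
    proof (rule span_sum)
      fix j
      show "ell2_nth u j *\<^sub>R unit_ell2 j \<in> span ?R"
      proof (cases "j \<in> A")
        case True
        then have "unit_ell2 j \<in> ?R" by (intro range_eqI[of _ _ j]) simp
        then show ?thesis by (intro span_scale span_base)
      next
        case False
        then show ?thesis using u by (simp add: supported_def span_zero)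
      qed
    qed
    then show "u \<in> closure (span ?R)"
      unfolding closure_sequential using ell2_truncation[of u]
      by (intro exI[of _ "\<lambda>N. \<Sum>j<N. ell2_nth u j *\<^sub>R unit_ell2 j"]) blast
  qed
qed

section \<open>Verification of the data and of the intertwining relations\<close>

context imprimitivity_model
begin

lemma act_cases: "act x = (if \<forall>j. j \<in> act x then UNIV else {..<(LEAST j. j \<notin> act x)})"
proof (cases "\<forall>j. j \<in> act x")
  case False
  define m where "m = (LEAST j. j \<notin> act x)"
  have m: "m \<notin> act x" unfolding m_def by (rule LeastI_ex) (use False in blast)
  have "j \<in> act x \<longleftrightarrow> j < m" for j
  proof
    assume "j \<in> act x"
    then show "j < m" using m act_down[of j x m] by (metis linorder_neqE_nat)
  next
    assume "j < m"
    then show "j \<in> act x" unfolding m_def using not_less_Least by blast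
  qed
  then have "act x = {..<m}" by (intro set_eqI) (simp only: lessThan_iff)
  then show ?thesis unfolding m_def[symmetric] if_not_P[OF False] .
next
  case True
  then have "act x = UNIV" by blast
  then show ?thesis unfolding if_P[OF True] .
qed

text \<open>The active set is an initial segment, hence determined by whether it is everything and,
  if not, by its least missing index. Both depend measurably on x, so no dimension has to be
  computed.\<close>

lemma cx_dim_measurable: "(\<lambda>x. cx_dim (V x)) \<in> measurable borel (count_space UNIV)"
proof -
  have [measurable]: "Measurable.pred borel (\<lambda>x. j \<in> act x)" for j
    using act_measurable[of j] by (simp add: pred_def)
  have m: "(\<lambda>x. LEAST j. j \<notin> act x) \<in> measurable borel (count_space UNIV)" by measurable
  have "cx_dim (V x) = (if \<forall>j. j \<in> act x then cx_dim (csupp UNIV)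
      else cx_dim (csupp {..<(LEAST j. j \<notin> act x)}))" for x
  proof -
    have "cx_dim (csupp (if p then A else B)) = (if p then cx_dim (csupp A) else cx_dim (csupp B))"
      for p A B by simp
    from HOL.trans[OF arg_cong[where f = "\<lambda>A. cx_dim (csupp A)", OF act_cases[of x]] this]
    show ?thesis .
  qed
  moreover have "(\<lambda>x. if \<forall>j. j \<in> act x then cx_dim (csupp UNIV)
      else cx_dim (csupp {..<(LEAST j. j \<notin> act x)})) \<in> measurable borel (count_space UNIV)"
  proof (rule measurable_If)
    show "(\<lambda>x. cx_dim (csupp {..<(LEAST j. j \<notin> act x)})) \<in> measurable borel (count_space UNIV)"
      by (rule measurable_compose[OF m]) simp
    show "{x \<in> space borel. \<forall>j. j \<in> act x} \<in> sets borel" by measurable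
  qed simp
  ultimately show ?thesis by simp
qed

lemma image_frame_measurable: "(\<lambda>x. image_frame k x j) \<in> borel_measurable borel"
proof -
  have "(\<lambda>x. 1 / sqrt (rn k x)) \<in> borel_measurable borel"
    using rn_measurable[of k] by measurable
  then show ?thesis unfolding image_frame_def by (intro borel_measurable_scaleR T_measurable)
qed

lemma c_measurable:
  assumes g: "g \<in> borel_measurable borel" shows "(\<lambda>x. c k x (g x)) \<in> borel_measurable borel"
  unfolding c_def basis_op_def
proof (rule borel_measurable_lim_metric)
  fix N
  have m: "(\<lambda>x. ell2_nth (fst (g x)) j) \<in> borel_measurable borel"
    "(\<lambda>x. ell2_nth (snd (g x)) j) \<in> borel_measurable borel" for j
    by (rule measurable_compose[OF g], rule borel_measurable_continuous_onI,
        intro continuous_on_compose2[OF continuous_ell2_nth] continuous_intros, simp)+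
  show "(\<lambda>x. psum (image_frame k x) (g x) {..<N}) \<in> borel_measurable borel"
    unfolding psum_def
    by (intro borel_measurable_sum borel_measurable_add borel_measurable_scaleR m image_frame_measurable
        measurable_compose[OF image_frame_measurable ic_measurable])
qed

abbreviation fibre :: "cantor \<Rightarrow> ell2 set" where
  "fibre x \<equiv> supported (act x)"

lemma complexified_fibre: "complexified fibre x = V x"
  by (simp add: complexified_def csupp_def)

text \<open>\<open>ac_translate\<close> gives one implication for a single \<open>delta k\<close>.
  Applied to the translated set it gives the converse, and \<open>Delta_induct\<close> reaches all
  of Delta.\<close>

lemma null_translate:
  assumes "d \<in> Delta" "A \<in> sets borel"
  shows "emeasure \<mu> ((\<lambda>x. x + d) -` A) = 0 \<longleftrightarrow> emeasure \<mu> A = 0"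
  using assms
proof (induction arbitrary: A rule: Delta_induct)
  case zero
  then show ?case by (simp only: add.right_neutral vimage_ident)
next
  case (step d k)
  have fwd: "emeasure \<mu> ((\<lambda>x. x + delta k) -` B) = 0" if "B \<in> sets borel" "emeasure \<mu> B = 0" for B
  proof -
    have "B \<in> null_sets \<mu>" using that by (simp add: null_sets_def sets_mu)
    then have "B \<in> null_sets (translate_measure \<mu> (delta k))"
      using ac_translate by (auto simp: absolutely_continuous_def)
    then have "emeasure (translate_measure \<mu> (delta k)) B = 0" by auto
    then show ?thesis
      unfolding translate_measure_def using that(1) by (subst (asm) emeasure_distr[OF translate_mu]) auto
  qed
  have pre: "(\<lambda>x. x + t) -` B \<in> sets borel" if "B \<in> sets borel" for B and t :: cantor
    using measurable_sets[OF translate_borel[of t] that] by simp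
  let ?B = "(\<lambda>x. x + d) -` A"
  have B: "?B \<in> sets borel" by (rule pre[OF step.prems])
  have tB: "(\<lambda>x. x + delta k) -` ?B \<in> sets borel" by (rule pre[OF B])
  have eq: "(\<lambda>x. x + (d + delta k)) -` A = (\<lambda>x. x + delta k) -` ?B"
    by (simp add: vimage_def ac_simps)
  have twice: "(\<lambda>x. x + delta k) -` ((\<lambda>x. x + delta k) -` ?B) = ?B"
    unfolding vimage_def mem_Collect_eq delta_delta by (rule HOL.refl)
  have "emeasure \<mu> ((\<lambda>x. x + delta k) -` ?B) = 0 \<longleftrightarrow> emeasure \<mu> ?B = 0"
    using fwd[OF B] fwd[OF tB] unfolding twice by blast
  then show ?case unfolding eq using step.IH[OF step.prems] by simp
qed

lemma equivalent_translate: assumes "d \<in> Delta" shows "equivalent_measures (translate_measure \<mu> d) \<mu>"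
proof -
  have "emeasure (translate_measure \<mu> d) A = emeasure \<mu> ((\<lambda>x. x + d) -` A)" if "A \<in> sets borel" for A
    unfolding translate_measure_def using that by (subst emeasure_distr[OF translate_mu]) auto
  then show ?thesis
    using null_translate[OF assms]
    by (auto simp: equivalent_measures_def absolutely_continuous_def null_sets_def sets_mu sets_translate)
qed

lemma act_Delta: assumes "d \<in> Delta" shows "AE x in \<mu>. act (x + d) = act x"
  using assms
proof (induction rule: Delta_induct)
  case (step d k)
  have "AE x in \<mu>. act (x + delta k + d) = act (x + delta k)" by (rule AE_translate[OF step])
  then show ?case
    using act_translate[of k]
  proof eventually_elim
    case (elim x)
    have "x + (d + delta k) = x + delta k + d" by (simp only: ac_simps)
    then show ?case by (simp only: elim)
  qed
qed (simp only: add.right_neutral eventually_True simp_thms)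

theorem standard_data:
  assumes s: "\<And>k. s k = (if k = 0 then 1 else (- 1) ^ (k + 1))"
  shows "standard_quaternionic_data \<mu> fibre c"
proof (rule standard_quaternionic_data.intro)
  show "sets \<mu> = sets borel" by (rule sets_mu)
  show "sigma_finite_measure \<mu>" by (rule sigma_finite_measure_axioms)
  show "equivalent_measures (translate_measure \<mu> d) \<mu>" if "d \<in> Delta" for d
    by (rule equivalent_translate[OF that])
  show "equivalent_measures (check_measure \<mu>) \<mu>"
    unfolding check_measure_def mu_check by (simp add: equivalent_measures_def absolutely_continuous_def)
  show "measurable_hilbert_family fibre"
    unfolding measurable_hilbert_family_def
  proof (intro conjI allI exI)
    show "subspace (fibre x)" "closed (fibre x)" for x
      by (rule subspace_supported, rule closed_supported)
    show "(\<lambda>x. if n \<in> act x then unit_ell2 n else 0) \<in> borel_measurable borel" for n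
      by (rule measurable_If) (use act_measurable[of n] in auto)
    show "closure (span (range (\<lambda>n. if n \<in> act x then unit_ell2 n else 0))) = fibre x" for x
      by (rule closure_span_unit_ell2)
  qed
  show "fibre x \<noteq> {0}" for x
  proof -
    have "unit_ell2 0 \<in> fibre x" using act_0[of x] by (auto simp: supported_def nth_unit_ell2)
    moreover have "unit_ell2 0 \<noteq> 0"
    proof
      assume "unit_ell2 0 = 0"
      from arg_cong[OF this, of "\<lambda>u. ell2_nth u 0"] show False
        by (simp add: nth_unit_ell2 ell2_nth_linear)
    qed
    ultimately show ?thesis by blast
  qed
  show "AE x in \<mu>. fibre (x + d) = fibre x \<and> fibre (check x) = fibre x" if "d \<in> Delta" for d
    using act_Delta[OF that] by eventually_elim (simp add: act_check)
  show "(\<lambda>x. cx_dim (complexified fibre x)) \<in> measurable borel (count_space UNIV)"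
    unfolding complexified_fibre by (rule cx_dim_measurable)
  show "AE x in \<mu>. cx_dim (complexified fibre (check x)) = cx_dim (complexified fibre x)"
    by (simp add: complexified_fibre act_check)
  show "measurable_operator_family (complexified fibre) (c k)" for k
    unfolding measurable_operator_family_def by (blast intro: c_measurable)
  show "AE x in \<mu>. cx_unitary (complexified fibre x) (complexified fibre (x + delta k)) (c k x)" for k
    using AE_regular[of k] AE_translate[OF AE_regular[of k], of k] c_involution[of k]
  proof eventually_elim
    case (elim x)
    note C = regular_cisometry[OF elim(1)]
    have "c k x ` V x = V x"
    proof
      show "c k x ` V x \<subseteq> V x" using regular_csupp[OF elim(1)] by blast
      show "V x \<subseteq> c k x ` V x"
      proof
        fix v assume v: "v \<in> V x"
        then have "c k (x + delta k) v \<in> V x"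
          using regular_csupp[OF elim(2)] regular_act[OF elim(1)] by simp
        then show "v \<in> c k x ` V x" by (rule rev_image_eqI) (simp add: elim(3) v)
      qed
    qed
    then show ?case
      unfolding cx_unitary_def complexified_fibre regular_act[OF elim(1)]
      by (simp add: cisometryD(1)[OF C] cisometry_cx_scale[OF C] cisometry_cx_inner[OF C])
  qed
  show "AE x in \<mu>. \<forall>v\<in>complexified fibre x. \<forall>w\<in>complexified fibre (x + delta k).
      cx_inner (c k x v) w = cx_inner v (c k (x + delta k) w)" for k
    using AE_regular[of k] AE_translate[OF AE_regular[of k], of k] c_involution[of k]
  proof eventually_elim
    case (elim x)
    show ?case
      unfolding complexified_fibre regular_act[OF elim(1)]
    proof (intro ballI)
      fix v w assume v: "v \<in> V x" and w: "w \<in> V x"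
      have cw: "c k (x + delta k) w \<in> V x"
        using regular_csupp[OF elim(2)] regular_act[OF elim(1)] w by simp
      have "cx_inner (c k x v) w = cx_inner (c k x v) (c k x (c k (x + delta k) w))"
        using elim(3) w by simp
      also have "\<dots> = cx_inner v (c k (x + delta k) w)"
        by (rule cisometry_cx_inner[OF regular_cisometry[OF elim(1)] v cw])
      finally show "cx_inner (c k x v) w = cx_inner v (c k (x + delta k) w)" .
    qed
  qed
  show "AE x in \<mu>. \<forall>v\<in>complexified fibre x. c k x (c l (x + delta k) v) = c l x (c k (x + delta l) v)" for k l
    unfolding complexified_fibre by (rule c_commuting)
  show "AE x in \<mu>. \<forall>v\<in>complexified fibre x. cx_conj (c 0 x (cx_conj v)) = c 0 (check x) v"
    using c_conj[of 0] by (simp add: complexified_fibre s)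
  show "AE x in \<mu>. \<forall>v\<in>complexified fibre x.
      cx_conj (c k x (cx_conj v)) = (- 1) ^ (k + 1) *\<^sub>R c k (check x) v" if "1 \<le> k" for k
    using c_conj[of k] that by (simp add: complexified_fibre s)
qed

lemma T_unitary: "unitary_onto_direct_integral \<mu> (complexified fibre) T"
  unfolding unitary_onto_direct_integral_def
proof (intro conjI allI ballI)
  have supp: "AE x in \<mu>. T v x \<in> complexified fibre x" for v
    using T_supp[of v] by (simp add: complexified_fibre)
  show "T v \<in> direct_integral \<mu> (complexified fibre)" for v
    unfolding L2_direct_integral using T_L2 supp by blast
  show "AE x in \<mu>. T (v + w) x = T v x + T w x" for v w by (rule T_add)
  show "AE x in \<mu>. T (z *\<^sub>C v) x = cx_scale z (T v x)" for z v
    unfolding scaleC_Re_Im[of z] cx_scale_Re_Im[of z]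
    using T_add[of "Re z *\<^sub>R v" "Im z *\<^sub>R Jc v"] T_scaleR[of "Re z" v] T_scaleR[of "Im z" "Jc v"] T_Jc[of v]
    by eventually_elim simp
  show "(LINT x|\<mu>. cx_inner (T v x) (T w x)) = cinner v w" for v w
  proof -
    have int: "integrable \<mu> (\<lambda>x. T v x \<bullet> T w x)" "integrable \<mu> (\<lambda>x. T v x \<bullet> ic (T w x))"
      by (intro L2_inner_integrable T_L2 L2_ic)+
    have "(LINT x|\<mu>. cx_inner (T v x) (T w x)) =
        (LINT x|\<mu>. complex_of_real (T v x \<bullet> T w x) + \<i> * complex_of_real (T v x \<bullet> ic (T w x)))"
      by (simp only: cx_inner_real Complex_eq)
    also have "\<dots> = complex_of_real (ip (T v) (T w)) + \<i> * complex_of_real (ip (T v) (\<lambda>x. ic (T w x)))"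
      using int unfolding ip_def by simp
    also have "ip (T v) (\<lambda>x. ic (T w x)) = ip (T v) (T (Jc w))"
      by (rule ip_cong_AE[OF T_L2 T_L2 L2_ic[OF T_L2] T_L2]) (use T_Jc[of w] in auto)
    finally show ?thesis by (simp add: T_ip cinner_real Complex_eq)
  qed
  show "\<exists>v. AE x in \<mu>. T v x = g x" if "g \<in> direct_integral \<mu> (complexified fibre)" for g
    using that T_surj[of g] unfolding L2_direct_integral complexified_fibre by blast
qed

text \<open>The word S_0 ... S_k acts as multiplication by its character, which is
  \<open>parity_sign x (k + 1)\<close>, and \<open>T_W\<close> contributes the weighted
  translation.\<close>

lemma T_standard_J':
  "AE x in \<mu>. T (Sp [0..<k + 1] (W k v)) x = standard_J' \<mu> c k (T v) x"
  using T_Sp[of "[0..<k + 1]" "W k v"] T_W[of k v]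
  by eventually_elim (simp add: standard_J'_def parity_sign_eq rn_def RN_def)

lemma T_standard_J:
  "AE x in \<mu>. T (- Jc (Sp [0..<k] (W k v))) x = standard_J \<mu> c k (T v) x"
proof -
  have "AE x in \<mu>. T ((-1) *\<^sub>R Jc (Sp [0..<k] (W k v))) x =
      - ic ((chi [0..<k] x * sqrt (rn k x)) *\<^sub>R c k x (T v (x + delta k)))"
    using T_Sp[of "[0..<k]" "W k v"] T_W[of k v] T_Jc[of "Sp [0..<k] (W k v)"]
      T_scaleR[of "-1" "Jc (Sp [0..<k] (W k v))"]
    by eventually_elim simp
  moreover have "standard_J \<mu> c k (T v) x =
      - ic ((chi [0..<k] x * sqrt (rn k x)) *\<^sub>R c k x (T v (x + delta k)))" for x
    by (simp add: standard_J_def parity_sign_eq rn_def RN_def prod_eq_iff cx_scale_def)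
  ultimately show ?thesis by simp
qed

end

section \<open>From the Clifford action to the operators S, W and K\<close>

locale quaternionic_module =
  fixes \<rho> :: "'h::real_inner clifford \<Rightarrow> 'v::{complex_inner, complete_space} \<Rightarrow> 'v"
    and h h' :: "nat \<Rightarrow> 'h" and Q :: "'v \<Rightarrow> 'v"
  assumes basis: "paired_orthonormal_basis h h'"
    and unitary: "unitary_clifford_rep \<rho>"
    and quaternionic: "invariant_quaternionic_structure \<rho> Q"
    and separable: "\<exists>D :: 'v set. countable D \<and> closure D = UNIV"
begin

definition G :: "'h \<Rightarrow> 'v \<Rightarrow> 'v" where
  "G u = \<rho> (cliff u)"

lemma G_add: "G u (v + w) = G u v + G u w"
  and G_scaleC: "G u (z *\<^sub>C v) = z *\<^sub>C G u v"
  and G_add_left: "G (u + u') v = G u v + G u' v"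
  and G_norm: "norm (G u v) = norm u * norm v"
  and rho_one: "\<rho> 1 v = v" and rho_mult: "\<rho> (x * y) v = \<rho> x (\<rho> y v)"
  and rho_scaleR: "\<rho> (t *\<^sub>R x) v = t *\<^sub>R \<rho> x v"
  using unitary
  by (simp_all add: unitary_clifford_rep_def clifford_rep_def clinear_def G_def cliff_add)

lemma G_scaleR: "G u (t *\<^sub>R v) = t *\<^sub>R G u v"
  by (simp add: scaleR_scaleC G_scaleC)

lemma G_minus: "G u (- v) = - G u v"
  using G_scaleR[of u "-1" v] by simp

lemma G_square: "G u (G u v) = - ((norm u)\<^sup>2 *\<^sub>R v)"
proof -
  have "G u (G u v) = \<rho> ((- ((norm u)\<^sup>2)) *\<^sub>R 1) v"
    unfolding G_def rho_mult[symmetric] cliff_square by simp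
  also have "\<dots> = (- ((norm u)\<^sup>2)) *\<^sub>R v" unfolding rho_scaleR rho_one ..
  finally show ?thesis by simp
qed

lemma G_anticommute: "u \<bullet> w = 0 \<Longrightarrow> G u (G w v) = - G w (G u v)"
proof -
  assume "u \<bullet> w = 0"
  then have "(norm (u + w))\<^sup>2 = (norm u)\<^sup>2 + (norm w)\<^sup>2"
    by (simp add: power2_norm_eq_inner inner_add_left inner_add_right inner_commute)
  moreover have "G (u + w) (G (u + w) v) = G u (G u v) + G w (G w v) + (G u (G w v) + G w (G u v))"
    by (simp add: G_add_left G_add)
  ultimately have "G u (G w v) + G w (G u v) = 0"
    by (simp add: G_square scaleR_add_left)
  then show ?thesis by (simp add: eq_neg_iff_add_eq_0)
qed

lemma basis_inner: "h j \<bullet> h k = (if j = k then 1 else 0)" "h' j \<bullet> h' k = (if j = k then 1 else 0)"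
  "h j \<bullet> h' k = 0" "h' k \<bullet> h j = 0"
  using basis by (simp_all add: paired_orthonormal_basis_def inner_commute)

lemma basis_norm [simp]: "norm (h k) = 1" "norm (h' k) = 1"
  by (simp_all add: norm_eq_1 basis_inner)

definition S :: "nat \<Rightarrow> 'v \<Rightarrow> 'v" where
  "S k v = Jc (G (h' k) (G (h k) v))"

lemma Jc_minus: "Jc (- v) = - Jc (v :: 'v)"
  by (rule linear_neg[OF Jc_linear])

lemma Jc_scaleR: "Jc (t *\<^sub>R v) = t *\<^sub>R Jc (v :: 'v)"
  by (rule linear_scale[OF Jc_linear])

lemma S_linear: "linear (S k)"
  by (rule linearI) (simp_all add: S_def G_add G_scaleR scaleC_add_right Jc_scaleR)

lemma S_G_ne: "j \<noteq> k \<Longrightarrow> S j (G (h k) v) = G (h k) (S j v)"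
  "j \<noteq> k \<Longrightarrow> S j (G (h' k) v) = G (h' k) (S j v)"
  by (simp_all add: S_def G_scaleC G_minus basis_inner
      G_anticommute[of "h j" "h k"] G_anticommute[of "h' j" "h k"]
      G_anticommute[of "h j" "h' k"] G_anticommute[of "h' j" "h' k"])

lemma S_G_eq: "S k (G (h k) v) = - G (h k) (S k v)"
  by (simp add: S_def G_scaleC G_minus basis_inner G_anticommute[of "h k" "h' k"] Jc_minus)

lemma S_isometry: "norm (S k v) = norm v"
  by (simp add: S_def G_norm)

lemma S_involution: "S k (S k v) = v"
  by (simp add: S_def G_scaleC G_minus G_square basis_inner G_anticommute[of "h k" "h' k"] Jc_minus)

lemma S_commuting: "S j (S k v) = S k (S j v)"
proof (cases "j = k")
  case False
  have "S j (Jc w) = Jc (S j w)" for w by (simp add: S_def G_scaleC)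
  then show ?thesis using False by (simp add: S_def[of k] S_G_ne)
qed simp

sublocale involutions S
  by (rule involutions.intro) (rule S_linear S_isometry S_involution S_commuting)+

lemma S_Jc: "S k (Jc v) = Jc (S k v)"
  by (simp add: S_def G_scaleC)

lemma Sp_Jc': "Sp L (Jc v) = Jc (Sp L v)"
  by (induction L) (simp_all add: S_Jc)

definition K :: "'v \<Rightarrow> 'v" where
  "K v = S 0 (Q v)"

lemma Q_add: "Q (v + w) = Q v + Q w" and Q_scaleC: "Q (z *\<^sub>C v) = cnj z *\<^sub>C Q v"
  and Q_norm: "norm (Q v) = norm v" and Q_Q: "Q (Q v) = - v" and Q_G: "Q (G u v) = G u (Q v)"
  using quaternionic by (simp_all add: invariant_quaternionic_structure_def G_def)

lemma Q_scaleR: "Q (t *\<^sub>R v) = t *\<^sub>R Q v"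
  by (simp add: scaleR_scaleC Q_scaleC)

lemma Q_Jc: "Q (Jc v) = - Jc (Q v)"
proof -
  have "Q (Jc v) = (- 1 * \<i>) *\<^sub>C Q v" by (simp add: Q_scaleC)
  also have "\<dots> = - Jc (Q v)" by (simp only: scaleC_scaleC[symmetric] scaleC_minus_one)
  finally show ?thesis .
qed

lemma Q_S: "Q (S k v) = - S k (Q v)"
  by (simp add: S_def Q_Jc Q_G)

lemma S_minus: "S k (- v) = - S k v"
  by (rule linear_neg[OF S_linear])

lemma K_antiunitary: "linear K" "norm (K v) = norm v" "K (K v) = v" "K (Jc v) = - Jc (K v)"
  "K (S k v) = - S k (K v)"
  by (rule linearI)
    (simp_all add: K_def Q_add Q_scaleR Q_S Q_Q Q_Jc Q_norm S_norm S_add S_scaleR S_minus S_Jc S_commute)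

sublocale conjugate_system S K
  by (intro conjugate_system.intro conjugate_system_axioms.intro involutions_axioms)
     (rule S_Jc K_antiunitary separable)+

definition W :: "nat \<Rightarrow> 'v \<Rightarrow> 'v" where
  "W k v = Jc (Sp [0..<k] (G (h k) v))"

lemma Sp_G: "Sp L (G (h k) v) = chi L (delta k) *\<^sub>R G (h k) (Sp L v)"
proof (induction L)
  case (Cons l L)
  then show ?case
    by (cases "l = k") (simp_all add: S_scaleR bsgn_delta S_G_eq S_G_ne)
qed simp

lemma char_below: "j \<le> k \<Longrightarrow> chi [0..<j] (delta k) = 1"
  by (induction j) (simp_all add: chi_append bsgn_delta)

lemma char_above: "j < k \<Longrightarrow> chi [0..<k] (delta j) = - 1"
proof (induction k)
  case (Suc k)
  then show ?case
    by (cases "j = k") (simp_all add: chi_append bsgn_delta char_below)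
qed simp

lemma Sp_commute: "Sp L (Sp M v) = Sp M (Sp L v)"
  by (induction L) (simp_all add: S_Sp)

text \<open>For j < k the word in \<open>W k\<close> contains S_j while the word in
  \<open>W j\<close> does not contain S_k. Exactly one sign therefore arises from the words, and it
  cancels the sign from the anticommuting generators.\<close>

lemma W_commute_less:
  assumes "j < k" shows "W j (W k v) = W k (W j v)"
proof -
  let ?A = "Sp [0..<j]" and ?B = "Sp [0..<k]"
  have "W j (W k v) = - ?A (G (h j) (?B (G (h k) v)))"
    by (simp add: W_def G_scaleC Sp_Jc')
  also have "G (h j) (?B (G (h k) v)) = - ?B (G (h j) (G (h k) v))"
    using Sp_G[of "[0..<k]" j "G (h k) v"] by (simp add: char_above[OF assms])
  also have "G (h j) (G (h k) v) = - G (h k) (G (h j) v)"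
    using assms by (intro G_anticommute) (simp add: basis_inner)
  finally have 1: "W j (W k v) = - ?A (?B (G (h k) (G (h j) v)))"
    by (simp add: linear_neg[OF linearI[of "Sp L" for L]] Sp_add Sp_scaleR)
  have "W k (W j v) = - ?B (G (h k) (?A (G (h j) v)))"
    by (simp add: W_def G_scaleC Sp_Jc')
  also have "G (h k) (?A (G (h j) v)) = ?A (G (h k) (G (h j) v))"
    using Sp_G[of "[0..<j]" k "G (h j) v"] assms by (simp add: char_below)
  finally show ?thesis unfolding 1 by (simp add: Sp_commute)
qed

lemma Sp_minus: "Sp L (- v) = - Sp L v"
  using Sp_scaleR[of L "-1" v] by simp

text \<open>Q changes sign at the factor i of \<open>W k\<close> and at each of the k involutions in
  its word, k + 1 times in all. For k = 0 the factor \<open>S 0\<close> of K adds one more sign,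
  which makes the value +1.\<close>

definition sgn_W :: "nat \<Rightarrow> real" where
  "sgn_W k = (if k = 0 then 1 else (- 1) ^ (k + 1))"

lemma abs_sgn_W: "\<bar>sgn_W k\<bar> = 1"
  by (simp add: sgn_W_def power_abs)

lemma G_via_W: "G (h k) v = - Jc (Sp [0..<k] (W k v))"
  by (simp add: W_def Sp_Jc')

text \<open>The first k involutions cancel against the word inside \<open>W k\<close>; the remaining
  \<open>S k\<close> turns i J_k into J'_k, as J_k squares to -I.\<close>

lemma G'_via_W: "G (h' k) v = Sp [0..<k + 1] (W k v)"
proof -
  have "Sp [0..<k + 1] w = S k (Sp [0..<k] w)" for w
  proof -
    have "Sp (L @ [k]) w = S k (Sp L w)" for L by (induction L) (simp_all add: S_commute)
    then show ?thesis by simp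
  qed
  then show ?thesis
    by (simp add: W_def Sp_Jc' S_Jc) (simp add: S_def G_square G_minus)
qed

lemma W_operators:
  "linear (W k)" "norm (W k v) = norm v" "W k (W k v) = v" "W j (W k v) = W k (W j v)"
  "W k (Jc v) = Jc (W k v)" "S l (W k v) = (if l = k then - 1 else 1) *\<^sub>R W k (S l v)"
  "K (W k v) = sgn_W k *\<^sub>R W k (K v)"
proof -
  show "linear (W k)"
    by (rule linearI) (simp_all add: W_def G_add G_scaleR Sp_add Sp_scaleR scaleC_add_right Jc_scaleR)
  show "norm (W k v) = norm v" by (simp add: W_def G_norm)
  show "W k (W k v) = v"
  proof -
    have "W k (W k v) = - Sp [0..<k] (G (h k) (Sp [0..<k] (G (h k) v)))"
      by (simp add: W_def G_scaleC Sp_Jc')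
    also have "G (h k) (Sp [0..<k] (G (h k) v)) = Sp [0..<k] (G (h k) (G (h k) v))"
      using Sp_G[of "[0..<k]" k "G (h k) v"] by (simp add: char_below)
    finally show ?thesis by (simp add: G_square Sp_minus)
  qed
  show "W j (W k v) = W k (W j v)"
    using W_commute_less[of j k v] W_commute_less[of k j v] by (cases j k rule: linorder_cases) auto
  show "W k (Jc v) = Jc (W k v)" by (simp add: W_def G_scaleC Sp_Jc')
  show "S l (W k v) = (if l = k then - 1 else 1) *\<^sub>R W k (S l v)"
    by (cases "l = k") (simp_all add: W_def S_Jc S_Sp S_G_eq S_G_ne Sp_minus Jc_minus)
  have Q_Sp: "Q (Sp L w) = (- 1) ^ length L *\<^sub>R Sp L (Q w)" for L w
    by (induction L) (simp_all add: Q_S S_scaleR)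
  \<comment> \<open>Both sides are reduced to the same vector, with all involutions moved in front
    of \<open>G (h k)\<close>. Only for k = 0 does moving \<open>S 0\<close> past that generator
    cost a sign.\<close>
  have "K (W k v) = - ((- 1) ^ k *\<^sub>R Jc (S 0 (Sp [0..<k] (G (h k) (Q v)))))"
    by (simp add: K_def W_def Q_Jc Q_Sp Q_G S_minus S_Jc S_scaleR Jc_scaleR)
  moreover have "W k (K v) = (if k = 0 then - 1 else 1) *\<^sub>R Jc (S 0 (Sp [0..<k] (G (h k) (Q v))))"
    by (cases "k = 0") (simp_all add: K_def W_def S_G_eq S_G_ne[symmetric] S_Sp Jc_minus)
  ultimately show "K (W k v) = sgn_W k *\<^sub>R W k (K v)"
    by (simp add: sgn_W_def)
qed

theorem standard_model:
  "\<exists>\<mu> U c. standard_quaternionic_data \<mu> U c \<and> equivalent_to_standard \<rho> h h' \<mu> U c"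
proof -
  obtain \<mu> e f where "spectral_model S K \<mu> e f" by (rule spectral_model_exists)
  then interpret M: imprimitivity_model S K \<mu> e f W sgn_W
    by (intro imprimitivity_model.intro imprimitivity_model_axioms.intro)
       (rule W_operators abs_sgn_W | assumption)+
  have "standard_quaternionic_data \<mu> M.fibre M.c"
    by (rule M.standard_data) (rule sgn_W_def)
  moreover have "equivalent_to_standard \<rho> h h' \<mu> M.fibre M.c"
    unfolding equivalent_to_standard_def
  proof (intro exI[of _ M.T] conjI allI)
    show "unitary_onto_direct_integral \<mu> (complexified M.fibre) M.T" by (rule M.T_unitary)
    show "AE x in \<mu>. M.T (\<rho> (cliff (h k)) v) x = standard_J \<mu> M.c k (M.T v) x" for k v
      using M.T_standard_J[of k v] unfolding G_via_W[symmetric] G_def .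
    show "AE x in \<mu>. M.T (\<rho> (cliff (h' k)) v) x = standard_J' \<mu> M.c k (M.T v) x" for k v
      using M.T_standard_J'[of k v] unfolding G'_via_W[symmetric] G_def .
  qed
  ultimately show ?thesis by blast
qed

end

theorem theorem3p14:
  fixes \<rho> :: "'h::real_inner clifford \<Rightarrow> 'v::{complex_inner, complete_space} \<Rightarrow> 'v"
    and h h' :: "nat \<Rightarrow> 'h"
  assumes infinite_dimensional: "\<not> (\<exists>B :: 'h set. finite B \<and> span B = UNIV)"
    and separable_H: "separable_space (euclidean :: 'h topology)"
    and basis: "paired_orthonormal_basis h h'"
    and separable_V: "separable_space (euclidean :: 'v topology)"
    and unitary: "unitary_clifford_rep \<rho>"
    and quaternionic: "\<exists>Q. invariant_quaternionic_structure \<rho> Q"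
  shows "\<exists>\<mu> U c. standard_quaternionic_data \<mu> U c \<and> equivalent_to_standard \<rho> h h' \<mu> U c"
proof -
  obtain Q where Q: "invariant_quaternionic_structure \<rho> Q" using quaternionic by blast
  have "\<exists>D :: 'v set. countable D \<and> closure D = UNIV"
    using separable_V by (auto simp: separable_space_def euclidean_closure_of)
  then interpret quaternionic_module \<rho> h h' Q
    by unfold_locales (use basis unitary Q in auto)
  show ?thesis by (rule standard_model)
qed

end
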